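(* Let $\Gamma\subset(\mathbb{C}^2,0)$ be a germ of irreducible analytic plane curve having a Puiseux parametrization $$\phi(t)=\Big(t^n,\ t^m+\sum_{i>m}a_it^i\Big)$$ (with $\phi:(\mathbb{C},0)\to(\mathbb{C}^2,0)$ holomorphic and injective), where $n<m$ and $n$ does not divide $m$. Let $\Lambda$ be the set of contact orders of $\Gamma$ with holomorphic $1$-forms and let $\lambda\in\mathbb{N}\cup\{\infty\}$ be the Zariski invariant of $\Gamma$. Then $\Gamma$ is analytically equivalent to a branch $\Gamma'$ with Puiseux parametrization $$\Gamma'\equiv\Big(t^n,\ t^m+a'_\lambda t^\lambda+\sum_{\substack{i>\lambda\\ i+n\notin\Lambda}}a'_it^i\Big)$$ (to be read as $(t^n,t^m)$ if $\lambda=\infty$). Moreover, each elimination of a single term can be carried out by means of the time-$s$ flow associated to a holomorphic vector field (one for each term).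
   Context: A branch is a germ at the origin of an irreducible analytic curve in $\mathbb{C}^2$. Two branches in $(\mathbb{C}^2,0)$ are analytically equivalent if there is a germ of biholomorphism of $(\mathbb{C}^2,0)$ sending one onto the other. For $\Gamma$ with parametrization $\phi$, the semigroup of $\Gamma$ is $$S_\Gamma=\{\operatorname{ord}_t f(\phi(t)) : f\in\mathbb{C}\{x,y\},\ f\circ\phi\not\equiv0\},$$ and the set of contact orders with holomorphic $1$-forms is $$\Lambda=\{\operatorname{ord}_t(\phi^*\omega)+1 : \omega=A\,dx+B\,dy,\ A,B\in\mathbb{C}\{x,y\},\ \phi^*\omega\not\equiv0\},$$ where $\operatorname{ord}_t(\phi^*\omega)$ is the order at $t=0$ of the function $h$ with $\phi^*\omega=h(t)\,dt$. The Zariski invariant is $\lambda=\min\{i\in\Lambda : i\notin S_\Gamma\}-n$, with $\lambda=\infty$ if $\Lambda\setminus S_\Gamma=\emptyset$. "Elimination of a term" refers to passing to an analytically equivalent branch in whose Puiseux parametrization a term $a_it^i$ not allowed in the final form no longer appears. The time-$s$ flow associated to a vector field sends a point $p$ to the value at time $s$ of the solution, with initial condition $p$ at time $0$, of the differential equation defined by the vector field. *)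

theory Defs
  imports "HOL-Complex_Analysis.Complex_Analysis" "HOL-Library.Extended_Nat"
begin

section \<open>Holomorphic functions, maps and vector fields in two variables\<close>

definition holomorphic2_on :: "(complex \<times> complex \<Rightarrow> complex) \<Rightarrow> (complex \<times> complex) set \<Rightarrow> bool"
  where "holomorphic2_on f U \<longleftrightarrow>
    (\<forall>p\<in>U. \<exists>a b. (f has_derivative (\<lambda>h. a * fst h + b * snd h)) (at p))"

text \<open>Germs at the origin are represented by total functions whose values away from the
  origin are irrelevant. The following predicate describes the ring of convergent power
  series in two variables, that is, of germs of holomorphic functions at the origin.\<close>

definition holomorphic2_germ :: "(complex \<times> complex \<Rightarrow> complex) \<Rightarrow> bool"
  where "holomorphic2_germ f \<longleftrightarrow> (\<exists>U. open U \<and> (0, 0) \<in> U \<and> holomorphic2_on f U)"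

definition holomorphic2_map_on ::
    "(complex \<times> complex \<Rightarrow> complex \<times> complex) \<Rightarrow> (complex \<times> complex) set \<Rightarrow> bool"
  where "holomorphic2_map_on F U \<longleftrightarrow>
    holomorphic2_on (\<lambda>p. fst (F p)) U \<and> holomorphic2_on (\<lambda>p. snd (F p)) U"

definition biholomorphism_germ :: "(complex \<times> complex \<Rightarrow> complex \<times> complex) \<Rightarrow> bool"
  where "biholomorphism_germ F \<longleftrightarrow> F (0, 0) = (0, 0) \<and>
    (\<exists>U V G. open U \<and> open V \<and> (0, 0) \<in> U \<and> homeomorphism U V F G \<and>
       holomorphic2_map_on F U \<and> holomorphic2_map_on G V)"

text \<open>Near the origin, \<open>F\<close> is the flow at the (complex) time \<open>s\<close> of the holomorphic vector
  field \<open>X\<close>. Solutions are required on a disc around \<open>0\<close> containing \<open>s\<close>, which is simply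
  connected, so that their value at time \<open>s\<close> is determined by the initial condition.\<close>

definition is_time_flow ::
    "(complex \<times> complex \<Rightarrow> complex \<times> complex) \<Rightarrow> complex \<Rightarrow>
     (complex \<times> complex \<Rightarrow> complex \<times> complex) \<Rightarrow> bool"
  where "is_time_flow X s F \<longleftrightarrow>
    (\<exists>U. open U \<and> (0, 0) \<in> U \<and> holomorphic2_map_on X U \<and>
      (\<forall>\<^sub>F p in nhds (0, 0). \<exists>R \<gamma>. norm s < R \<and> \<gamma> 0 = p \<and> \<gamma> s = F p \<and>
        (\<forall>z\<in>ball 0 R. \<gamma> z \<in> U \<and>
          ((\<lambda>w. fst (\<gamma> w)) has_field_derivative fst (X (\<gamma> z))) (at z) \<and>
          ((\<lambda>w. snd (\<gamma> w)) has_field_derivative snd (X (\<gamma> z))) (at z))))"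


section \<open>Branches\<close>

text \<open>A branch is represented by a set \<open>\<Gamma>\<close> of which only the germ at the origin matters.
  The set germ given by a parametrization must not depend on the size of the disc.\<close>

definition parametrizes :: "(complex \<Rightarrow> complex \<times> complex) \<Rightarrow> (complex \<times> complex) set \<Rightarrow> bool"
  where "parametrizes \<phi> \<Gamma> \<longleftrightarrow> \<phi> 0 = (0, 0) \<and>
    (\<exists>r>0. (\<lambda>t. fst (\<phi> t)) holomorphic_on ball 0 r \<and> (\<lambda>t. snd (\<phi> t)) holomorphic_on ball 0 r \<and>
      inj_on \<phi> (ball 0 r) \<and>
      (\<forall>\<epsilon>. 0 < \<epsilon> \<and> \<epsilon> \<le> r \<longrightarrow> (\<forall>\<^sub>F p in nhds (0, 0). p \<in> \<Gamma> \<longleftrightarrow> p \<in> \<phi> ` ball 0 \<epsilon>)))"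

text \<open>For a biholomorphism germ \<open>F\<close>, the equality of set germs \<open>F \<Gamma> = \<Gamma>'\<close> is expressed
  as \<open>\<Gamma> = F\<^sup>-\<^sup>1 \<Gamma>'\<close>.\<close>

definition sends_branch ::
    "(complex \<times> complex \<Rightarrow> complex \<times> complex) \<Rightarrow> (complex \<times> complex) set \<Rightarrow>
     (complex \<times> complex) set \<Rightarrow> bool"
  where "sends_branch F \<Gamma> \<Gamma>' \<longleftrightarrow> biholomorphism_germ F \<and>
    (\<forall>\<^sub>F p in nhds (0, 0). p \<in> \<Gamma> \<longleftrightarrow> F p \<in> \<Gamma>')"

definition analytically_equivalent ::
    "(complex \<times> complex) set \<Rightarrow> (complex \<times> complex) set \<Rightarrow> bool"
  where "analytically_equivalent \<Gamma> \<Gamma>' \<longleftrightarrow> (\<exists>F. sends_branch F \<Gamma> \<Gamma>')"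

text \<open>Only the coefficients \<open>a i\<close> with \<open>i > m\<close> are used.\<close>

definition puiseux :: "nat \<Rightarrow> nat \<Rightarrow> (nat \<Rightarrow> complex) \<Rightarrow> complex \<Rightarrow> complex \<times> complex"
  where "puiseux n m a t = (t ^ n, t ^ m + (\<Sum>i. if i > m then a i * t ^ i else 0))"

text \<open>Convergence has to be required explicitly because \<^const>\<open>suminf\<close> is total.\<close>

definition puiseux_parametrization ::
    "nat \<Rightarrow> nat \<Rightarrow> (nat \<Rightarrow> complex) \<Rightarrow> (complex \<times> complex) set \<Rightarrow> bool"
  where "puiseux_parametrization n m a \<Gamma> \<longleftrightarrow>
    conv_radius a > 0 \<and> parametrizes (puiseux n m a) \<Gamma>"


section \<open>Semigroup, contact orders and the Zariski invariant\<close>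

definition branch_semigroup :: "(complex \<Rightarrow> complex \<times> complex) \<Rightarrow> nat set"
  where "branch_semigroup \<phi> =
    {nat (zorder (\<lambda>t. f (\<phi> t)) 0) | f.
       holomorphic2_germ f \<and> \<not> (\<forall>\<^sub>F t in nhds 0. f (\<phi> t) = 0)}"

text \<open>The function \<open>h\<close> with \<open>\<phi>\<^sup>*(A dx + B dy) = h(t) dt\<close>.\<close>

definition form_pullback ::
    "(complex \<Rightarrow> complex \<times> complex) \<Rightarrow> (complex \<times> complex \<Rightarrow> complex) \<Rightarrow>
     (complex \<times> complex \<Rightarrow> complex) \<Rightarrow> complex \<Rightarrow> complex"
  where "form_pullback \<phi> A B t =
    A (\<phi> t) * deriv (\<lambda>u. fst (\<phi> u)) t + B (\<phi> t) * deriv (\<lambda>u. snd (\<phi> u)) t"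

definition contact_orders :: "(complex \<Rightarrow> complex \<times> complex) \<Rightarrow> nat set"
  where "contact_orders \<phi> =
    {nat (zorder (form_pullback \<phi> A B) 0) + 1 | A B.
       holomorphic2_germ A \<and> holomorphic2_germ B \<and>
       \<not> (\<forall>\<^sub>F t in nhds 0. form_pullback \<phi> A B t = 0)}"

definition zariski_invariant :: "nat \<Rightarrow> (complex \<Rightarrow> complex \<times> complex) \<Rightarrow> enat"
  where "zariski_invariant n \<phi> =
    (if contact_orders \<phi> - branch_semigroup \<phi> = {} then \<infinity>
     else enat ((LEAST i. i \<in> contact_orders \<phi> \<and> i \<notin> branch_semigroup \<phi>) - n))"


section \<open>Elimination of terms\<close>

text \<open>The exponents above \<open>m\<close> which may occur in the final form attached to a set \<open>\<Lambda>\<close> of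
  contact orders and a Zariski invariant \<open>l\<close>. None is allowed if \<open>l = \<infinity>\<close>.\<close>

definition allowed_exponent :: "nat \<Rightarrow> nat set \<Rightarrow> enat \<Rightarrow> nat \<Rightarrow> bool"
  where "allowed_exponent n \<Lambda> l i \<longleftrightarrow> enat i = l \<or> (enat i > l \<and> i + n \<notin> \<Lambda>)"

text \<open>The branch \<open>\<Gamma>\<close> with Puiseux coefficients \<open>a\<close> is sent by the flow of a holomorphic vector
  field to the branch \<open>\<Gamma>'\<close> with Puiseux coefficients \<open>a'\<close>; the term of exponent \<open>k\<close>
  disappears, and the terms of lower exponent do not change.\<close>

definition flow_eliminates ::
    "nat \<Rightarrow> nat \<Rightarrow> nat \<Rightarrow> (nat \<Rightarrow> complex) \<Rightarrow> (complex \<times> complex) set \<Rightarrow>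
     (nat \<Rightarrow> complex) \<Rightarrow> (complex \<times> complex) set \<Rightarrow> bool"
  where "flow_eliminates n m k a \<Gamma> a' \<Gamma>' \<longleftrightarrow>
    puiseux_parametrization n m a \<Gamma> \<and> puiseux_parametrization n m a' \<Gamma>' \<and>
    (\<forall>i. m < i \<and> i < k \<longrightarrow> a' i = a i) \<and> a' k = 0 \<and>
    (\<exists>X s F. is_time_flow X s F \<and> sends_branch F \<Gamma> \<Gamma>')"

text \<open>Successive elimination: \<open>c k\<close> and \<open>B k\<close> are the Puiseux coefficients and the branch after
  the exponents \<open>m+1, \<dots>, k\<close> have been treated. As the coefficient of exponent \<open>i\<close> no longer
  changes after stage \<open>i\<close>, the process leads to the coefficients \<open>a' i = c i i\<close>.\<close>

definition flow_reduction ::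
    "nat \<Rightarrow> nat \<Rightarrow> (nat \<Rightarrow> bool) \<Rightarrow> (nat \<Rightarrow> complex) \<Rightarrow> (complex \<times> complex) set \<Rightarrow>
     (nat \<Rightarrow> complex) \<Rightarrow> bool"
  where "flow_reduction n m allowed a \<Gamma> a' \<longleftrightarrow>
    (\<exists>c B. c m = a \<and> B m = \<Gamma> \<and>
      (\<forall>k>m. if allowed k \<or> c (k - 1) k = 0
              then c k = c (k - 1) \<and> B k = B (k - 1)
              else flow_eliminates n m k (c (k - 1)) (B (k - 1)) (c k) (B k)) \<and>
      (\<forall>i>m. a' i = c i i))"

end

theory Submission
  imports Defs
begin

text \<open>A vector field \<open>P \<partial>\<^sub>x + Q \<partial>\<^sub>y\<close> moves the branch \<open>(t\<^sup>n, y(t))\<close>, to first order and in terms of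
  \<open>x = t\<^sup>n\<close>, in the vertical direction by \<open>Q - P dy/dx\<close>, which is the pullback of the form
  \<open>Q dx - P dy\<close> divided by \<open>dx\<close>. If this form has contact order \<open>k + n\<close>, the flow changes the Puiseux series
  by \<open>c s t\<^sup>k + \<dots>\<close> at time \<open>s\<close>, provided that the linear part of the field is
  \<open>\<beta> y \<partial>\<^sub>x\<close>, and a suitable \<open>s\<close> eliminates the term of exponent \<open>k\<close>. The diagonal linear part can be avoided
  because the only forms with a contact order up to \<open>\<lambda> + n\<close> that is not the order of a monomial are those with a
  nonzero multiple of the Euler form \<open>m y dx - n x dy\<close>, whose contact order is \<open>\<lambda> + n\<close>. As the semigroup
  contains all large integers, the process stops after finitely many steps, up to a remainder of large
  order, which is a function \<open>h\<close> on the branch and is removed by the shear \<open>(x, y - h)\<close>.\<close>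

section \<open>Holomorphic functions of two variables\<close>

text \<open>A diagonal linear part would make the flow rescale the leading term and act through
  exponentials of \<open>s\<close>. With linear part \<open>\<beta> y \<partial>\<^sub>x\<close> the
  first coordinate moves only by \<open>O(t^(n+1))\<close>, so the new parameter is tangent to
  \<open>t\<close> and the coefficient of exponent \<open>k\<close> becomes exactly an affine
  function of \<open>s\<close>. Since the semigroup and \<Lambda> are analytic invariants, the
  allowed exponents are fixed once and for all. The infinite composition of flows need not converge
  to a biholomorphism. It is cut off at a finite stage: every large exponent \<open>i\<close> has
  \<open>i + n\<close> in \<Lambda> and is not allowed, so the limiting series is a polynomial, and
  late stages agree with it to any prescribed order. The closing shear needs an order of agreement
  that depends on the late branch, whereas the bound for the conductor comes from the initial one.
  An element of the semigroup congruent to 1 modulo \<open>n\<close> bridges the two: it bounds the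
  contact between the conjugates of every stage.\<close>

lemma holomorphic2_on_subset: "holomorphic2_on f U \<Longrightarrow> V \<subseteq> U \<Longrightarrow> holomorphic2_on f V"
  unfolding holomorphic2_on_def by blast

lemma holomorphic2_on_const: "holomorphic2_on (\<lambda>p. c) U"
  unfolding holomorphic2_on_def
  by (intro ballI exI[of _ 0]) (auto intro!: derivative_eq_intros)

lemma holomorphic2_on_fst: "holomorphic2_on fst U"
  unfolding holomorphic2_on_def
proof (intro ballI exI)
  show "(fst has_derivative (\<lambda>h. 1 * fst h + 0 * snd h)) (at p)" for p :: "complex \<times> complex"
    by (auto intro!: derivative_eq_intros)
qed

lemma holomorphic2_on_snd: "holomorphic2_on snd U"
  unfolding holomorphic2_on_def
proof (intro ballI exI)
  show "(snd has_derivative (\<lambda>h. 0 * fst h + 1 * snd h)) (at p)" for p :: "complex \<times> complex"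
    by (auto intro!: derivative_eq_intros)
qed

lemma holomorphic2_on_add:
  assumes "holomorphic2_on f U" "holomorphic2_on g U"
  shows "holomorphic2_on (\<lambda>p. f p + g p) U"
  unfolding holomorphic2_on_def
proof
  fix p assume "p \<in> U"
  then obtain a b c d where "(f has_derivative (\<lambda>h. a * fst h + b * snd h)) (at p)"
    "(g has_derivative (\<lambda>h. c * fst h + d * snd h)) (at p)"
    using assms unfolding holomorphic2_on_def by blast
  from has_derivative_add[OF this]
  have "((\<lambda>p. f p + g p) has_derivative (\<lambda>h. (a + c) * fst h + (b + d) * snd h)) (at p)"
    by (simp add: algebra_simps)
  then show "\<exists>a b. ((\<lambda>p. f p + g p) has_derivative (\<lambda>h. a * fst h + b * snd h)) (at p)"
    by blast
qed

lemma holomorphic2_on_mult: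
  assumes "holomorphic2_on f U" "holomorphic2_on g U"
  shows "holomorphic2_on (\<lambda>p. f p * g p) U"
  unfolding holomorphic2_on_def
proof
  fix p assume "p \<in> U"
  then obtain a b c d where "(f has_derivative (\<lambda>h. a * fst h + b * snd h)) (at p)"
    "(g has_derivative (\<lambda>h. c * fst h + d * snd h)) (at p)"
    using assms unfolding holomorphic2_on_def by blast
  from has_derivative_mult[OF this]
  have "((\<lambda>p. f p * g p) has_derivative
    (\<lambda>h. (f p * c + a * g p) * fst h + (f p * d + b * g p) * snd h)) (at p)"
    by (simp add: algebra_simps)
  then show "\<exists>a b. ((\<lambda>p. f p * g p) has_derivative (\<lambda>h. a * fst h + b * snd h)) (at p)"
    by blast
qed

lemma holomorphic2_on_minus: "holomorphic2_on f U \<Longrightarrow> holomorphic2_on (\<lambda>p. - f p) U"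
  using holomorphic2_on_mult[OF holomorphic2_on_const[of "-1"]] by fastforce

lemma holomorphic2_on_diff:
  "holomorphic2_on f U \<Longrightarrow> holomorphic2_on g U \<Longrightarrow> holomorphic2_on (\<lambda>p. f p - g p) U"
  using holomorphic2_on_add[of f U "\<lambda>p. - g p"] holomorphic2_on_minus by simp

lemma holomorphic2_on_sum:
  "(\<And>i. i \<in> I \<Longrightarrow> holomorphic2_on (f i) U) \<Longrightarrow> holomorphic2_on (\<lambda>p. \<Sum>i\<in>I. f i p) U"
proof (induction I rule: infinite_finite_induct)
  case (insert x F)
  then show ?case using holomorphic2_on_add[of "f x" U "\<lambda>p. \<Sum>i\<in>F. f i p"] by simp
qed (auto intro: holomorphic2_on_const)

lemma holomorphic2_on_power: "holomorphic2_on f U \<Longrightarrow> holomorphic2_on (\<lambda>p. f p ^ n) U"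
  by (induction n) (auto intro: holomorphic2_on_const holomorphic2_on_mult)

lemmas holomorphic2_intros = holomorphic2_on_const holomorphic2_on_fst holomorphic2_on_snd
  holomorphic2_on_add holomorphic2_on_mult holomorphic2_on_minus holomorphic2_on_diff
  holomorphic2_on_sum holomorphic2_on_power

lemma holomorphic2_on_imp_continuous_on: "holomorphic2_on f U \<Longrightarrow> continuous_on U f"
  unfolding holomorphic2_on_def
  by (meson continuous_at_imp_continuous_on has_derivative_continuous)

lemma holomorphic2_on_compose:
  assumes "holomorphic2_on f V" "holomorphic2_on u U" "holomorphic2_on v U"
    "\<And>p. p \<in> U \<Longrightarrow> (u p, v p) \<in> V"
  shows "holomorphic2_on (\<lambda>p. f (u p, v p)) U"
  unfolding holomorphic2_on_def
proof
  fix p assume p: "p \<in> U"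
  then obtain a b c d where uv: "(u has_derivative (\<lambda>h. a * fst h + b * snd h)) (at p)"
    "(v has_derivative (\<lambda>h. c * fst h + d * snd h)) (at p)"
    using assms unfolding holomorphic2_on_def by blast
  obtain k l where f: "(f has_derivative (\<lambda>h. k * fst h + l * snd h)) (at (u p, v p))"
    using assms(1,4) p unfolding holomorphic2_on_def by blast
  from has_derivative_compose[OF has_derivative_Pair[OF uv] f]
  have "((\<lambda>p. f (u p, v p)) has_derivative
     (\<lambda>h. (k * a + l * c) * fst h + (k * b + l * d) * snd h)) (at p)"
    by (simp add: algebra_simps)
  then show "\<exists>a b. ((\<lambda>p. f (u p, v p)) has_derivative (\<lambda>h. a * fst h + b * snd h)) (at p)"
    by blast
qed

lemma has_field_derivative_compose_curve:
  assumes "(f has_derivative (\<lambda>h. a * fst h + b * snd h)) (at (u t, v t))"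
    "(u has_field_derivative u') (at t)" "(v has_field_derivative v') (at t)"
  shows "((\<lambda>t. f (u t, v t)) has_field_derivative (a * u' + b * v')) (at t)"
proof -
  have "(\<lambda>x. a * (u' * x) + b * (v' * x)) = (*) (a * u' + b * v')"
    by (auto simp: algebra_simps)
  then show ?thesis
    using has_derivative_compose[OF has_derivative_Pair[OF assms(2,3)[unfolded has_field_derivative_def]] assms(1)]
    by (simp add: has_field_derivative_def)
qed

lemma holomorphic2_on_compose_curve:
  assumes "holomorphic2_on f V" "u holomorphic_on S" "v holomorphic_on S" "open S"
    "\<And>t. t \<in> S \<Longrightarrow> (u t, v t) \<in> V"
  shows "(\<lambda>t. f (u t, v t)) holomorphic_on S"
proof -
  have "\<exists>D. ((\<lambda>t. f (u t, v t)) has_field_derivative D) (at t)" if t: "t \<in> S" for t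
  proof -
    obtain u' v' where "(u has_field_derivative u') (at t)" "(v has_field_derivative v') (at t)"
      using assms(2,3,4) t holomorphic_on_open by metis
    moreover obtain a b where "(f has_derivative (\<lambda>h. a * fst h + b * snd h)) (at (u t, v t))"
      using assms(1,5) t unfolding holomorphic2_on_def by blast
    ultimately show ?thesis using has_field_derivative_compose_curve by blast
  qed
  then show ?thesis using assms(4) by (simp add: holomorphic_on_open)
qed

lemma holomorphic2_on_compose_left:
  assumes "g holomorphic_on T" "open T" "holomorphic2_on u U" "\<And>p. p \<in> U \<Longrightarrow> u p \<in> T"
  shows "holomorphic2_on (\<lambda>p. g (u p)) U"
  unfolding holomorphic2_on_def
proof
  fix p assume p: "p \<in> U"
  then obtain a b where u: "(u has_derivative (\<lambda>h. a * fst h + b * snd h)) (at p)"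
    using assms unfolding holomorphic2_on_def by blast
  obtain d where "(g has_field_derivative d) (at (u p))"
    using assms(1,2,4) p holomorphic_on_open by metis
  then have "(g has_derivative (\<lambda>x. d * x)) (at (u p))"
    by (simp add: has_field_derivative_def)
  from has_derivative_compose[OF u this]
  have "((\<lambda>p. g (u p)) has_derivative (\<lambda>h. (d * a) * fst h + (d * b) * snd h)) (at p)"
    by (simp add: algebra_simps)
  then show "\<exists>a b. ((\<lambda>p. g (u p)) has_derivative (\<lambda>h. a * fst h + b * snd h)) (at p)" by blast
qed

section \<open>Partial derivatives, Cauchy estimates and Weierstrass convergence\<close>

definition partial1 :: "(complex \<times> complex \<Rightarrow> complex) \<Rightarrow> complex \<times> complex \<Rightarrow> complex"
  where "partial1 f p = deriv (\<lambda>x. f (x, snd p)) (fst p)"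

definition partial2 :: "(complex \<times> complex \<Rightarrow> complex) \<Rightarrow> complex \<times> complex \<Rightarrow> complex"
  where "partial2 f p = deriv (\<lambda>y. f (fst p, y)) (snd p)"

lemma norm_fst_le': "norm (fst p) \<le> norm p"
  by (metis norm_fst_le prod.collapse)

lemma norm_snd_le': "norm (snd p) \<le> norm p"
  by (metis norm_snd_le prod.collapse)

lemma has_derivative_partials:
  assumes "(f has_derivative (\<lambda>h. a * fst h + b * snd h)) (at p)"
  shows "((\<lambda>x. f (x, snd p)) has_field_derivative a) (at (fst p))"
    and "((\<lambda>y. f (fst p, y)) has_field_derivative b) (at (snd p))"
    and "partial1 f p = a" "partial2 f p = b"
proof -
  have p: "(f has_derivative (\<lambda>h. a * fst h + b * snd h)) (at (fst p, snd p))" using assms by simp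
  show *: "((\<lambda>x. f (x, snd p)) has_field_derivative a) (at (fst p))"
    using has_field_derivative_compose_curve[of f a b "\<lambda>x. x" "fst p" "\<lambda>x. snd p" 1 0] p
    by simp
  show **: "((\<lambda>y. f (fst p, y)) has_field_derivative b) (at (snd p))"
    using has_field_derivative_compose_curve[of f a b "\<lambda>x. fst p" "snd p" "\<lambda>x. x" 0 1] p
    by simp
  show "partial1 f p = a" "partial2 f p = b"
    unfolding partial1_def partial2_def using * ** by (auto intro: DERIV_imp_deriv)
qed

lemma holomorphic2_on_has_derivative:
  assumes "holomorphic2_on f U" "p \<in> U"
  shows "(f has_derivative (\<lambda>h. partial1 f p * fst h + partial2 f p * snd h)) (at p)"
proof -
  obtain a b where f: "(f has_derivative (\<lambda>h. a * fst h + b * snd h)) (at p)"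
    using assms unfolding holomorphic2_on_def by blast
  then show ?thesis using has_derivative_partials(3,4)[OF f] by simp
qed

lemma holomorphic2_on_slices:
  assumes "holomorphic2_on f U" "open S"
  shows "(\<And>x. x \<in> S \<Longrightarrow> (x, y) \<in> U) \<Longrightarrow> (\<lambda>x. f (x, y)) holomorphic_on S"
    and "(\<And>y. y \<in> S \<Longrightarrow> (x, y) \<in> U) \<Longrightarrow> (\<lambda>y. f (x, y)) holomorphic_on S"
  using holomorphic2_on_compose_curve[OF assms(1) _ _ assms(2), of "\<lambda>x. x" "\<lambda>x. y"]
    holomorphic2_on_compose_curve[OF assms(1) _ _ assms(2), of "\<lambda>y. x" "\<lambda>y. y"]
  by auto

text \<open>Cauchy's inequality on the circle of radius \<open>r / 2\<close> bounds the
  \<open>l\<close>-th coefficient by \<open>M * (2 / r)^l\<close>, and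
  \<open>norm z \<le> r / 4\<close> makes the tail geometric with ratio at most 1/2, whence the
  factor 2. The bound sees the function only through \<open>M\<close>, so it is uniform over all
  slices of a bounded function of two variables.\<close>

lemma taylor_remainder_bound:
  fixes f :: "complex \<Rightarrow> complex"
  assumes "f holomorphic_on ball w r" "0 < r" "\<And>z. z \<in> ball w r \<Longrightarrow> norm (f z) \<le> M"
    and z: "norm z \<le> r / 4"
  shows "norm (f (w + z) - (\<Sum>l<N. (deriv ^^ l) f w / fact l * z ^ l)) \<le> 2 * M * (2 / r) ^ N * norm z ^ N"
proof -
  let ?c = "\<lambda>l. (deriv ^^ l) f w / fact l"
  let ?q = "2 / r * norm z"
  have M: "0 \<le> M" using assms(3)[of w] assms(2) norm_ge_zero order_trans
    by (metis centre_in_ball)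
  have c: "norm (?c l) \<le> M * (2 / r) ^ l" for l
  proof -
    have sub: "cball w (r/2) \<subseteq> ball w r" using assms(2) by auto
    have "norm ((deriv ^^ l) f w) \<le> fact l * M / (r / 2) ^ l"
    proof (rule Cauchy_inequality)
      show "f holomorphic_on ball w (r/2)" using assms(1) by (rule holomorphic_on_subset) (use assms(2) in auto)
      show "continuous_on (cball w (r/2)) f"
        using assms(1) sub holomorphic_on_imp_continuous_on continuous_on_subset by blast
      show "0 < r / 2" using assms(2) by simp
      show "norm (f x) \<le> M" if "norm (w - x) = r / 2" for x
        using assms(3)[of x] that assms(2) by (simp add: dist_norm)
    qed
    then have "norm ((deriv ^^ l) f w) / fact l \<le> M / (r / 2) ^ l"
      by (simp add: field_simps)
    also have "M / (r / 2) ^ l = M * (2 / r) ^ l" by (simp add: power_divide)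
    finally show ?thesis by (simp add: norm_divide)
  qed
  have q: "0 \<le> ?q" "?q \<le> 1/2" using z assms(2) by (auto simp: field_simps)
  have "w + z \<in> ball w r" using z assms(2) by (simp add: dist_norm)
  from holomorphic_power_series[OF assms(1) this]
  have s: "(\<lambda>l. ?c l * z ^ l) sums f (w + z)" by simp
  have tail: "(\<lambda>l. ?c (l + N) * z ^ (l + N)) sums (f (w + z) - (\<Sum>l<N. ?c l * z ^ l))"
    using sums_split_initial_segment[OF s, of N] by simp
  have b: "norm (?c (l + N) * z ^ (l + N)) \<le> M * ?q ^ N * (1/2) ^ l" for l
  proof -
    have "norm (?c (l + N) * z ^ (l + N)) \<le> M * (2 / r) ^ (l + N) * norm z ^ (l + N)"
      unfolding norm_mult norm_power by (intro mult_right_mono c) simp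
    also have "\<dots> = M * ?q ^ N * ?q ^ l" by (simp add: power_add power_mult_distrib power_divide mult_ac)
    also have "\<dots> \<le> M * ?q ^ N * (1/2) ^ l"
      by (intro mult_left_mono power_mono) (use q M in auto)
    finally show ?thesis .
  qed
  have g: "(\<lambda>l. M * ?q ^ N * (1/2) ^ l) sums (M * ?q ^ N * 2)"
    using sums_mult[OF geometric_sums[of "1/2 :: real"], of "M * ?q ^ N"] by simp
  have "norm (\<Sum>l. ?c (l + N) * z ^ (l + N)) \<le> (\<Sum>l. M * ?q ^ N * (1/2) ^ l)"
    by (rule norm_suminf_le[OF b]) (use g sums_summable in blast)
  then show ?thesis using tail g by (simp add: sums_iff power_mult_distrib power_divide mult_ac)
qed

lemma dist_le_slices:
  fixes p :: "complex \<times> complex"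
  shows "q \<in> ball p r \<Longrightarrow> norm h < r \<Longrightarrow> (fst q + h, snd q) \<in> ball p (2 * r)"
    and "q \<in> ball p r \<Longrightarrow> norm h < r \<Longrightarrow> (fst q, snd q + h) \<in> ball p (2 * r)"
proof -
  assume q: "q \<in> ball p r" "norm h < r"
  have "norm ((fst q + h, snd q) - q) = norm h" "norm ((fst q, snd q + h) - q) = norm h"
    by (simp_all add: norm_prod_def minus_prod_def)
  then have "dist (fst q + h, snd q) q < r" "dist (fst q, snd q + h) q < r"
    using q by (auto simp: dist_norm)
  then show "(fst q + h, snd q) \<in> ball p (2 * r)" "(fst q, snd q + h) \<in> ball p (2 * r)"
    using q dist_triangle[of p "(fst q + h, snd q)" q] dist_triangle[of p "(fst q, snd q + h)" q]
    by (auto simp: dist_commute)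
qed

text \<open>The slices through a point of the smaller ball contain discs of radius \<open>r\<close>
  inside the larger one; the one-variable inequality is taken on the circle of radius
  \<open>r / 2\<close>. Applied to differences \<open>f m - f n\<close>, it turns uniform
  convergence of functions into uniform convergence of their partial derivatives.\<close>

lemma Cauchy_inequality_partials:
  assumes f: "holomorphic2_on f (ball p (2 * r))" "\<And>q. q \<in> ball p (2 * r) \<Longrightarrow> norm (f q) \<le> B"
    and "0 < r" "q \<in> ball p r"
  shows "norm (partial1 f q) \<le> 2 * B / r" "norm (partial2 f q) \<le> 2 * B / r"
proof -
  have sl: "(fst q + h, snd q) \<in> ball p (2 * r)" "(fst q, snd q + h) \<in> ball p (2 * r)"
    if "norm h < r" for h
    using dist_le_slices assms(4) that by blast+
  have sl1: "(z, snd q) \<in> ball p (2 * r)" if "z \<in> ball (fst q) r" for z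
    using sl(1)[of "z - fst q"] that by (simp add: dist_norm norm_minus_commute)
  have sl2: "(fst q, z) \<in> ball p (2 * r)" if "z \<in> ball (snd q) r" for z
    using sl(2)[of "z - snd q"] that by (simp add: dist_norm norm_minus_commute)
  have h1: "(\<lambda>x. f (x, snd q)) holomorphic_on ball (fst q) r"
    by (rule holomorphic2_on_slices[OF f(1)]) (use sl1 in auto)
  have h2: "(\<lambda>y. f (fst q, y)) holomorphic_on ball (snd q) r"
    by (rule holomorphic2_on_slices[OF f(1)]) (use sl2 in auto)
  have gen: "norm ((deriv ^^ 1) g w) \<le> fact 1 * B / (r / 2) ^ 1"
    if "g holomorphic_on ball w r" "\<And>z. z \<in> ball w r \<Longrightarrow> norm (g z) \<le> B" for g w
  proof (rule Cauchy_inequality)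
    have sub: "cball w (r/2) \<subseteq> ball w r" using assms(3) by auto
    show "g holomorphic_on ball w (r/2)" using that(1) by (rule holomorphic_on_subset) (use assms in auto)
    show "continuous_on (cball w (r/2)) g"
      using that(1) sub holomorphic_on_imp_continuous_on continuous_on_subset by blast
    show "0 < r / 2" using assms by simp
    show "norm (g x) \<le> B" if "norm (w - x) = r / 2" for x
      using \<open>\<And>z. z \<in> ball w r \<Longrightarrow> norm (g z) \<le> B\<close>[of x] that assms by (simp add: dist_norm)
  qed
  show "norm (partial1 f q) \<le> 2 * B / r"
    using gen[OF h1] f(2) sl1 by (simp add: partial1_def mult.commute)
  show "norm (partial2 f q) \<le> 2 * B / r"
    using gen[OF h2] f(2) sl2 by (simp add: partial2_def mult.commute)
qed

lemma partials_diff: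
  assumes "holomorphic2_on f U" "holomorphic2_on g U" "p \<in> U"
  shows "partial1 (\<lambda>p. f p - g p) p = partial1 f p - partial1 g p"
    "partial2 (\<lambda>p. f p - g p) p = partial2 f p - partial2 g p"
proof -
  have "((\<lambda>p. f p - g p) has_derivative
     (\<lambda>h. (partial1 f p - partial1 g p) * fst h + (partial2 f p - partial2 g p) * snd h)) (at p)"
    using has_derivative_diff[OF holomorphic2_on_has_derivative[OF assms(1,3)]
      holomorphic2_on_has_derivative[OF assms(2,3)]] by (simp add: algebra_simps)
  from has_derivative_partials(3,4)[OF this]
  show "partial1 (\<lambda>p. f p - g p) p = partial1 f p - partial1 g p"
    "partial2 (\<lambda>p. f p - g p) p = partial2 f p - partial2 g p" by auto
qed

text \<open>Weierstrass' theorem in two variables. The Cauchy inequality makes the partial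
  derivatives uniformly Cauchy near each point, and then differentiation passes to the limit. It
  serves twice: for difference quotients and for Picard iterates.\<close>

lemma holomorphic2_uniform_limit:
  assumes U: "open U" and f: "\<And>n. holomorphic2_on (f n) U"
    and lim: "uniform_limit U f g sequentially"
  shows "holomorphic2_on g U"
  unfolding holomorphic2_on_def
proof
  fix p assume "p \<in> U"
  with openE[OF U] obtain r0 where "0 < r0" "ball p r0 \<subseteq> U" by metis
  then obtain r where r: "0 < r" "ball p (2 * r) \<subseteq> U" by (intro that[of "r0/2"]) auto
  have fr: "holomorphic2_on (f n) (ball p (2 * r))" for n
    using f r(2) holomorphic2_on_subset by blast
  have S: "ball p r \<subseteq> ball p (2 * r)" using r(1) by auto
  have cauchy: "\<exists>N. \<forall>m\<ge>N. \<forall>n\<ge>N. \<forall>q\<in>ball p r.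
      norm (partial1 (f m) q - partial1 (f n) q) \<le> e \<and>
      norm (partial2 (f m) q - partial2 (f n) q) \<le> e" if "e > 0" for e
  proof -
    \<comment> \<open>Two members within \<open>e * r / 4\<close> of \<open>g\<close> differ by at
      most \<open>e * r / 2\<close>, which the Cauchy factor \<open>2 / r\<close> turns into
      \<open>e\<close>.\<close>
    have "e * r / 4 > 0" using that r by simp
    then have "\<forall>\<^sub>F n in sequentially. \<forall>q\<in>U. dist (f n q) (g q) < e * r / 4"
      using uniform_limitD[OF lim] by blast
    then obtain N where N: "\<And>n q. n \<ge> N \<Longrightarrow> q \<in> U \<Longrightarrow> dist (f n q) (g q) < e * r / 4"
      unfolding eventually_sequentially by blast
    show ?thesis
    proof (intro exI[of _ N] allI impI ballI)
      fix m n q assume mn: "N \<le> m" "N \<le> n" and q: "q \<in> ball p r"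
      have b: "norm (f m x - f n x) \<le> e * r / 2" if "x \<in> ball p (2 * r)" for x
        using N[OF mn(1), of x] N[OF mn(2), of x] that r(2) dist_triangle2[of "f m x" "f n x" "g x"]
        by (fastforce simp: dist_norm)
      have qq: "q \<in> ball p (2 * r)" using q S by blast
      have *: "2 * (e * r / 2) / r = e" using r by simp
      show "norm (partial1 (f m) q - partial1 (f n) q) \<le> e \<and>
        norm (partial2 (f m) q - partial2 (f n) q) \<le> e"
        using Cauchy_inequality_partials[OF holomorphic2_on_diff[OF fr[of m] fr[of n]] b r(1) q]
        unfolding partials_diff[OF fr fr qq] * by simp
    qed
  qed
  define A where "A = (\<lambda>q. lim (\<lambda>n. partial1 (f n) q))"
  define B where "B = (\<lambda>q. lim (\<lambda>n. partial2 (f n) q))"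
  have "Cauchy (\<lambda>n. partial1 (f n) q) \<and> Cauchy (\<lambda>n. partial2 (f n) q)" if "q \<in> ball p r" for q
    unfolding Cauchy_def
  proof (intro conjI allI impI)
    fix e :: real assume "e > 0"
    then obtain N where "\<forall>m\<ge>N. \<forall>n\<ge>N. \<forall>q\<in>ball p r.
      norm (partial1 (f m) q - partial1 (f n) q) \<le> e/2 \<and>
      norm (partial2 (f m) q - partial2 (f n) q) \<le> e/2" using cauchy[of "e/2"] by auto
    with that \<open>e > 0\<close> show "\<exists>M. \<forall>m\<ge>M. \<forall>n\<ge>M. dist (partial1 (f m) q) (partial1 (f n) q) < e"
      "\<exists>M. \<forall>m\<ge>M. \<forall>n\<ge>M. dist (partial2 (f m) q) (partial2 (f n) q) < e"
      by (force intro!: exI[of _ N] simp: dist_norm)+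
  qed
  then have AB: "(\<lambda>n. partial1 (f n) q) \<longlonglongrightarrow> A q" "(\<lambda>n. partial2 (f n) q) \<longlonglongrightarrow> B q"
    if "q \<in> ball p r" for q
    unfolding A_def B_def using that Cauchy_convergent convergent_LIMSEQ_iff by blast+
  have unif: "\<exists>N. \<forall>n\<ge>N. \<forall>q\<in>ball p r. norm (partial1 (f n) q - A q) \<le> e \<and>
      norm (partial2 (f n) q - B q) \<le> e" if e: "e > 0" for e
  proof -
    obtain N where N: "\<And>m n q. m\<ge>N \<Longrightarrow> n\<ge>N \<Longrightarrow> q\<in>ball p r \<Longrightarrow>
      norm (partial1 (f m) q - partial1 (f n) q) \<le> e \<and>
      norm (partial2 (f m) q - partial2 (f n) q) \<le> e" using cauchy[OF e] by blast
    show ?thesis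
    proof (intro exI[of _ N] allI impI ballI conjI)
      fix n q assume n: "N \<le> n" and q: "q \<in> ball p r"
      have ev: "\<forall>\<^sub>F m in sequentially. norm (partial1 (f n) q - partial1 (f m) q) \<le> e"
        "\<forall>\<^sub>F m in sequentially. norm (partial2 (f n) q - partial2 (f m) q) \<le> e"
        using N[OF n _ q] by (blast intro: eventually_sequentiallyI)+
      show "norm (partial1 (f n) q - A q) \<le> e"
        by (rule tendsto_upperbound[OF tendsto_norm[OF tendsto_diff[OF tendsto_const AB(1)[OF q]]] ev(1)]) simp
      show "norm (partial2 (f n) q - B q) \<le> e"
        by (rule tendsto_upperbound[OF tendsto_norm[OF tendsto_diff[OF tendsto_const AB(2)[OF q]]] ev(2)]) simp
    qed
  qed
  have "\<exists>G. \<forall>x\<in>ball p r. (\<lambda>n. f n x) \<longlonglongrightarrow> G x \<and>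
      (G has_derivative (\<lambda>h. A x * fst h + B x * snd h)) (at x within ball p r)"
  proof (rule has_derivative_sequence)
    show "convex (ball p r)" by simp
    show "(f n has_derivative (\<lambda>h. partial1 (f n) x * fst h + partial2 (f n) x * snd h)) (at x within ball p r)"
      if "x \<in> ball p r" for n x
      using holomorphic2_on_has_derivative[OF fr] that S has_derivative_at_withinI by blast
    show "p \<in> ball p r" using r by simp
    show "(\<lambda>n. f n p) \<longlonglongrightarrow> g p"
      using tendsto_uniform_limitI[OF lim \<open>p \<in> U\<close>] .
    fix e :: real assume "e > 0"
    then obtain N where N: "\<And>n q. n \<ge> N \<Longrightarrow> q\<in>ball p r \<Longrightarrow> norm (partial1 (f n) q - A q) \<le> e/2 \<and>
      norm (partial2 (f n) q - B q) \<le> e/2" using unif[of "e/2"] by (meson half_gt_zero)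
    have "norm (partial1 (f n) x * fst h + partial2 (f n) x * snd h - (A x * fst h + B x * snd h)) \<le> e * norm h"
      if "N \<le> n" "x \<in> ball p r" for n x h
    proof -
      have "partial1 (f n) x * fst h + partial2 (f n) x * snd h - (A x * fst h + B x * snd h)
        = (partial1 (f n) x - A x) * fst h + (partial2 (f n) x - B x) * snd h" by (simp add: algebra_simps)
      also have "norm \<dots> \<le> e/2 * norm h + e/2 * norm h"
      proof (intro norm_triangle_le add_mono)
        show "norm ((partial1 (f n) x - A x) * fst h) \<le> e/2 * norm h"
          unfolding norm_mult
          by (rule mult_mono) (use N[OF that] \<open>e > 0\<close> norm_fst_le'[of h] in auto)
        show "norm ((partial2 (f n) x - B x) * snd h) \<le> e/2 * norm h"
          unfolding norm_mult
          by (rule mult_mono) (use N[OF that] \<open>e > 0\<close> norm_snd_le'[of h] in auto)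
      qed
      finally show ?thesis by simp
    qed
    then show "\<forall>\<^sub>F n in sequentially. \<forall>x\<in>ball p r. \<forall>h.
      norm (partial1 (f n) x * fst h + partial2 (f n) x * snd h - (A x * fst h + B x * snd h)) \<le> e * norm h"
      unfolding eventually_sequentially by blast
  qed
  then obtain G where G: "\<And>x. x\<in>ball p r \<Longrightarrow> (\<lambda>n. f n x) \<longlonglongrightarrow> G x"
      "\<And>x. x\<in>ball p r \<Longrightarrow> (G has_derivative (\<lambda>h. A x * fst h + B x * snd h)) (at x within ball p r)"
    by blast
  have eq: "G x = g x" if "x \<in> ball p r" for x
    using G(1)[OF that] tendsto_uniform_limitI[OF lim, of x] that r(2) S LIMSEQ_unique by blast
  have pb: "p \<in> ball p r" using r by simp
  have "(G has_derivative (\<lambda>h. A p * fst h + B p * snd h)) (at p)"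
    using G(2)[OF pb] at_within_open[OF pb open_ball] by simp
  then have "(g has_derivative (\<lambda>h. A p * fst h + B p * snd h)) (at p)"
    by (rule has_derivative_transform_within_open[OF _ open_ball pb]) (use eq in auto)
  then show "\<exists>a b. (g has_derivative (\<lambda>h. a * fst h + b * snd h)) (at p)" by blast
qed


lemma holomorphic2_on_locally_bounded:
  assumes "open U" "holomorphic2_on f U" "p \<in> U"
  obtains r M where "0 < r" "ball p (2 * r) \<subseteq> U" "\<And>q. q \<in> ball p (2 * r) \<Longrightarrow> norm (f q) \<le> M"
proof -
  obtain r0 where r0: "0 < r0" "cball p r0 \<subseteq> U" using assms(1,3) open_contains_cball_eq by metis
  have "compact (f ` cball p r0)"
    using holomorphic2_on_imp_continuous_on[OF assms(2)] r0(2)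
    by (intro compact_continuous_image) (auto intro: continuous_on_subset)
  then obtain M where "\<And>q. q \<in> cball p r0 \<Longrightarrow> norm (f q) \<le> M"
    using compact_imp_bounded bounded_iff by (metis imageI)
  then show thesis using r0 by (intro that[of "r0/2" M]) auto
qed

lemma holomorphic2_on_locally:
  assumes "\<And>p. p \<in> U \<Longrightarrow> \<exists>V. open V \<and> p \<in> V \<and> holomorphic2_on f V"
  shows "holomorphic2_on f U"
  using assms unfolding holomorphic2_on_def by blast

lemma holomorphic2_on_swap:
  assumes "holomorphic2_on f U"
  shows "holomorphic2_on (\<lambda>p. f (snd p, fst p)) (prod.swap -` U)"
  by (rule holomorphic2_on_compose[OF assms holomorphic2_on_snd holomorphic2_on_fst]) auto

text \<open>\<open>holomorphic2_on\<close> only asks for differentiability at each point. The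
  difference quotients in the first variable are holomorphic and, by the Taylor remainder of order
  2, converge uniformly on a small ball, so their limit inherits holomorphy.\<close>

lemma holomorphic2_on_partial1:
  assumes U: "open U" and f: "holomorphic2_on f U"
  shows "holomorphic2_on (partial1 f) U"
proof (rule holomorphic2_on_locally)
  fix p assume "p \<in> U"
  from holomorphic2_on_locally_bounded[OF U f this]
  obtain r M where r: "0 < r" "ball p (2 * r) \<subseteq> U"
    and M: "\<And>q. q \<in> ball p (2 * r) \<Longrightarrow> norm (f q) \<le> M" by blast
  have fr: "holomorphic2_on f (ball p (2 * r))" using f r(2) holomorphic2_on_subset by blast
  \<comment> \<open>Increments of norm at most \<open>r / 4\<close> stay in the range of
    \<open>taylor_remainder_bound\<close>.\<close>
  define h where "h = (\<lambda>n::nat. complex_of_real (r / 4 / real (Suc n)))"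
  have h0: "h n \<noteq> 0" and hn: "norm (h n) = r / 4 / real (Suc n)" for n
    using r unfolding h_def by (auto simp del: of_nat_Suc simp: norm_divide)
  have hr: "norm (h n) \<le> r / 4" for n
    unfolding hn using r by (simp add: divide_simps)
  define g where "g = (\<lambda>n q. (f (fst q + h n, snd q) - f q) * (1 / h n))"
  define C where "C = 2 * M * (2 / r) ^ 2"
  have S: "ball p r \<subseteq> ball p (2 * r)" using r(1) by auto
  have "holomorphic2_on (partial1 f) (ball p r)"
  proof (rule holomorphic2_uniform_limit[OF open_ball])
    have 1: "holomorphic2_on (\<lambda>q. f (fst q + h n, snd q)) (ball p r)" for n
    proof (rule holomorphic2_on_compose[OF fr])
      show "holomorphic2_on (\<lambda>p. fst p + h n) (ball p r)" "holomorphic2_on snd (ball p r)"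
        by (intro holomorphic2_intros)+
      have "norm (h n) < r" using hr[of n] r(1) by linarith
      then show "(fst q + h n, snd q) \<in> ball p (2 * r)" if "q \<in> ball p r" for q
        using dist_le_slices(1)[OF that] by blast
    qed
    have 2: "holomorphic2_on (\<lambda>q. f q) (ball p r)" by (rule holomorphic2_on_subset[OF fr S])
    show "holomorphic2_on (g n) (ball p r)" for n
      unfolding g_def by (intro holomorphic2_on_mult holomorphic2_on_diff holomorphic2_on_const 1 2)
    have est: "norm (g n q - partial1 f q) \<le> C * (r / 4 / real (Suc n))" if q: "q \<in> ball p r" for n q
    proof -
      have sl1: "(z, snd q) \<in> ball p (2 * r)" if "z \<in> ball (fst q) r" for z
        using dist_le_slices(1)[OF q, of "z - fst q"] that by (simp add: dist_norm norm_minus_commute)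
      have "(\<lambda>x. f (x, snd q)) holomorphic_on ball (fst q) r"
        by (rule holomorphic2_on_slices[OF fr]) (use sl1 in auto)
      from taylor_remainder_bound[OF this r(1) M[OF sl1] hr[of n], of 2]
      have "norm (f (fst q + h n, snd q) - (f q + partial1 f q * h n)) \<le> C * norm (h n) ^ 2"
        by (simp add: C_def partial1_def numeral_2_eq_2)
      moreover have "g n q - partial1 f q = (f (fst q + h n, snd q) - (f q + partial1 f q * h n)) / h n"
        using h0[of n] by (simp add: g_def field_simps)
      ultimately have "norm (g n q - partial1 f q) \<le> C * norm (h n) ^ 2 / norm (h n)"
        by (simp add: norm_divide divide_right_mono)
      also have "\<dots> = C * norm (h n)" using h0[of n] by (simp add: power2_eq_square)
      finally show ?thesis by (simp only: hn)
    qed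
    have lim: "(\<lambda>n. C * (r / 4 / real (Suc n))) \<longlonglongrightarrow> 0"
      by (rule tendsto_mult_right_zero, rule tendsto_divide_0[OF tendsto_const])
        (simp add: filterlim_at_infinity_conv_norm_at_top filterlim_compose[OF filterlim_real_sequentially filterlim_Suc] del: of_nat_Suc)
    show "uniform_limit (ball p r) g (partial1 f) sequentially"
    proof (rule uniform_limitI)
      fix e :: real assume "e > 0"
      then have "\<forall>\<^sub>F n in sequentially. C * (r / 4 / real (Suc n)) < e"
        using order_tendstoD(2)[OF lim] by blast
      then show "\<forall>\<^sub>F n in sequentially. \<forall>x\<in>ball p r. dist (g n x) (partial1 f x) < e"
      proof eventually_elim
        case (elim n)
        then show ?case using est[of _ n] unfolding dist_norm by (meson le_less_trans)
      qed
    qed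
  qed
  then show "\<exists>V. open V \<and> p \<in> V \<and> holomorphic2_on (partial1 f) V"
    using r(1) by (intro exI[of _ "ball p r"]) auto
qed

lemma holomorphic2_on_partial2:
  assumes U: "open U" and f: "holomorphic2_on f U"
  shows "holomorphic2_on (partial2 f) U"
proof -
  let ?V = "prod.swap -` U"
  have V: "open ?V" using U by (intro open_vimage) (auto intro: continuous_on_swap)
  have "holomorphic2_on (partial1 (\<lambda>p. f (snd p, fst p))) ?V"
    by (rule holomorphic2_on_partial1[OF V holomorphic2_on_swap[OF f]])
  from holomorphic2_on_swap[OF this] have
    "holomorphic2_on (\<lambda>p. partial1 (\<lambda>p. f (snd p, fst p)) (snd p, fst p)) U"
    by (simp add: vimage_comp)
  then show ?thesis by (simp add: partial1_def partial2_def [abs_def])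
qed

section \<open>Taylor polynomials in two variables\<close>

definition poly2 :: "nat \<Rightarrow> (nat \<Rightarrow> nat \<Rightarrow> complex) \<Rightarrow> complex \<times> complex \<Rightarrow> complex"
  where "poly2 N c p = (\<Sum>i<N. \<Sum>j<N. c i j * (fst p ^ i * snd p ^ j))"

lemma holomorphic2_on_poly2: "holomorphic2_on (poly2 N c) U"
  unfolding poly2_def[abs_def] by (intro holomorphic2_intros)

lemma eventually_ball_prod:
  assumes "0 < r"
  shows "\<forall>\<^sub>F p in nhds (0::complex, 0::complex). norm (fst p) < r \<and> norm (snd p) < r \<and> norm p < r"
proof -
  have "\<forall>\<^sub>F p in nhds (0::complex, 0::complex). p \<in> ball 0 r"
    using assms by (intro eventually_nhds_in_open) (auto simp: zero_prod_def)
  then show ?thesis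
  proof (rule eventually_mono)
    fix p :: "complex \<times> complex" assume "p \<in> ball 0 r"
    then have "norm p < r" by (simp only: mem_ball_0)
    then show "norm (fst p) < r \<and> norm (snd p) < r \<and> norm p < r"
      using norm_fst_le'[of p] norm_snd_le'[of p] by linarith
  qed
qed

text \<open>The one-variable expansion is iterated: first in \<open>x\<close> with coefficients
  \<open>A i y\<close>, which are holomorphic in \<open>y\<close> because the iterates of
  \<open>partial1\<close> preserve holomorphy, then each coefficient in \<open>y\<close>. This
  produces a truncation by a box of exponents rather than by total degree; later only the size of
  the error matters.\<close>

lemma holomorphic2_germ_taylor:
  assumes "holomorphic2_germ f"
  shows "\<exists>c C. 0 \<le> C \<and> (\<forall>\<^sub>F p in nhds (0,0). norm (f p - poly2 N c p) \<le> C * norm p ^ N)"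
proof -
  obtain U where U: "open U" "(0,0) \<in> U" "holomorphic2_on f U"
    using assms unfolding holomorphic2_germ_def by blast
  from holomorphic2_on_locally_bounded[OF U(1,3,2)]
  obtain r M where r: "0 < r" "ball (0,0) (2 * r) \<subseteq> U"
    and M: "\<And>q. q \<in> ball (0,0) (2 * r) \<Longrightarrow> norm (f q) \<le> M" by blast
  have box: "(x, y) \<in> ball (0,0) (2 * r)" if "norm x < r" "norm y < r" for x y :: complex
    using that norm_Pair_le[of x y] mem_ball_0[of "(x, y)" "2 * r"] by (simp add: zero_prod_def)
  define g where "g = (\<lambda>i. (partial1 ^^ i) f)"
  have gh: "holomorphic2_on (g i) U" for i
    unfolding g_def by (induction i) (use U holomorphic2_on_partial1 in auto)
  have gd: "(deriv ^^ i) (\<lambda>x. f (x, y)) x = g i (x, y)" for i x y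
    unfolding g_def
  proof (induction i arbitrary: x)
    case (Suc i)
    have "(deriv ^^ i) (\<lambda>x. f (x, y)) = (\<lambda>x. (partial1 ^^ i) f (x, y))" using Suc by blast
    then show ?case by (simp add: partial1_def[where f = "(partial1 ^^ i) f"])
  qed simp
  define A where "A = (\<lambda>i y. g i (0, y) / fact i)"
  have Ahol: "A i holomorphic_on ball 0 r" for i
    unfolding A_def using r box
    by (intro holomorphic_intros holomorphic2_on_slices(2)[OF gh]) (auto simp: dist_norm)
  define B where "B = (\<lambda>i j. (deriv ^^ j) (A i) 0 / fact j)"
  \<comment> \<open>A bound for \<open>A i\<close> is obtained on a compact disc, so the radius is
    halved; a quarter of \<open>r / 2\<close> is the bound \<open>r / 8\<close>.\<close>
  have "\<exists>K. \<forall>y. norm y \<le> r/8 \<longrightarrow> norm (A i y - (\<Sum>j<N. B i j * y ^ j)) \<le> K * norm y ^ N" for i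
  proof -
    have "compact (A i ` cball 0 (r/2))"
      by (intro compact_continuous_image holomorphic_on_imp_continuous_on holomorphic_on_subset[OF Ahol])
        (use r in auto)
    then obtain K where "\<And>q. q \<in> cball 0 (r/2) \<Longrightarrow> norm (A i q) \<le> K"
      using compact_imp_bounded bounded_iff by (metis imageI)
    then have *: "norm (A i z) \<le> K" if "z \<in> ball 0 (r/2)" for z using that by auto
    have "A i holomorphic_on ball 0 (r/2)" by (rule holomorphic_on_subset[OF Ahol]) (use r in auto)
    from taylor_remainder_bound[OF this _ *, of _ N] show ?thesis
      unfolding B_def using r by (intro exI[of _ "2 * K * (2 / (r/2)) ^ N"]) auto
  qed
  then obtain K where K: "\<And>i y. norm y \<le> r/8 \<Longrightarrow> norm (A i y - (\<Sum>j<N. B i j * y ^ j)) \<le> K i * norm y ^ N"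
    by metis
  define L where "L = 2 * M * (2 / r) ^ N"
  have f1: "norm (f (x, y) - (\<Sum>i<N. A i y * x ^ i)) \<le> L * norm x ^ N" if "norm x \<le> r/8" "norm y \<le> r/8" for x y
  proof -
    have "(\<lambda>x. f (x, y)) holomorphic_on ball 0 r"
      by (rule holomorphic2_on_slices(1)[OF U(3)]) (use box that r in \<open>auto\<close>)
    from taylor_remainder_bound[OF this r(1), of M x N] show ?thesis
      unfolding L_def A_def gd using that box M r by auto
  qed
  define C where "C = \<bar>L\<bar> + (\<Sum>i<N. \<bar>K i\<bar>)"
  have "norm (f p - poly2 N B p) \<le> C * norm p ^ N"
    if p: "norm (fst p) < min 1 (r/8)" "norm (snd p) < min 1 (r/8)" for p
  proof -
    obtain x y where [simp]: "p = (x, y)" by fastforce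
    have xy: "norm x \<le> norm p" "norm y \<le> norm p" using norm_fst_le'[of p] norm_snd_le'[of p] by auto
    have "f p - poly2 N B p = (f (x, y) - (\<Sum>i<N. A i y * x ^ i))
        + (\<Sum>i<N. (A i y - (\<Sum>j<N. B i j * y ^ j)) * x ^ i)"
      by (simp add: poly2_def sum_subtractf algebra_simps sum_distrib_left)
    also have "norm \<dots> \<le> L * norm x ^ N + (\<Sum>i<N. K i * norm y ^ N * norm x ^ i)"
      by (intro norm_triangle_le add_mono f1 sum_norm_le)
        (use p K in \<open>auto simp: norm_mult norm_power intro!: mult_right_mono\<close>)
    also have "\<dots> \<le> \<bar>L\<bar> * norm p ^ N + (\<Sum>i<N. \<bar>K i\<bar> * norm p ^ N * 1)"
      using p xy by (intro add_mono sum_mono mult_mono power_mono power_le_one) auto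
    also have "\<dots> = C * norm p ^ N" by (simp add: C_def algebra_simps sum_distrib_left)
    finally show ?thesis .
  qed
  then have "\<forall>\<^sub>F p in nhds (0,0). norm (f p - poly2 N B p) \<le> C * norm p ^ N"
    using eventually_ball_prod[of "min 1 (r/8)"] r(1) by (auto elim: eventually_mono)
  moreover have "0 \<le> C" unfolding C_def by (auto intro: sum_nonneg)
  ultimately show ?thesis by blast
qed

section \<open>Orders of monomials along a branch\<close>

text \<open>\<open>Y\<close> is the series of the second coordinate. All exponents strictly between
  \<open>m\<close> and \<open>i0\<close> are absent, while the coefficient at \<open>i0\<close>
  itself is left open. The choice \<open>i0 = Suc m\<close> fits an arbitrary branch; larger values
  of \<open>i0\<close> record which terms are already gone.\<close>

locale puiseux_fps =
  fixes n m i0 :: nat and Y :: "complex fps"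
  assumes n: "0 < n" and nm: "n < m" and ndvd: "\<not> n dvd m" and mi: "m < i0"
    and Y_low: "\<And>i. i < m \<Longrightarrow> fps_nth Y i = 0" and Y_m: "fps_nth Y m = 1"
    and Y_gap: "\<And>i. m < i \<Longrightarrow> i < i0 \<Longrightarrow> fps_nth Y i = 0"
begin

lemma Y_nonzero: "fps_nth Y w \<noteq> 0 \<Longrightarrow> w = m \<or> i0 \<le> w"
  using Y_low Y_gap by (metis linorder_neqE_nat not_le)

text \<open>In a product of \<open>j\<close> factors either every factor contributes its leading
  term \<open>t^m\<close>, or some factor contributes an exponent at least \<open>i0\<close> and the
  remaining \<open>j'\<close> at least \<open>m\<close> each. This dichotomy between leading
  exponent and tail governs all order computations below.\<close>

lemma Y_power_nonzero:
  "fps_nth (Y ^ j) w \<noteq> 0 \<Longrightarrow> w = j * m \<or> (\<exists>j'. j = Suc j' \<and> j' * m + i0 \<le> w)"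
proof (induction j arbitrary: w)
  case 0
  then show ?case by (auto split: if_splits)
next
  case (Suc j)
  then have "(\<Sum>i=0..w. fps_nth Y i * fps_nth (Y ^ j) (w - i)) \<noteq> 0"
    by (simp add: fps_mult_nth)
  then obtain i where i: "i \<le> w" "fps_nth Y i \<noteq> 0" "fps_nth (Y ^ j) (w - i) \<noteq> 0"
    by (metis (mono_tags, lifting) atLeastAtMost_iff mult_eq_0_iff sum.neutral)
  from Y_nonzero[OF i(2)] Suc.IH[OF i(3)] i(1) mi show ?case by auto
qed

lemma Y_power_lead: "fps_nth (Y ^ j) (j * m) = 1"
proof -
  have sd: "subdegree Y = m" using Y_m Y_low by (intro subdegreeI) auto
  show ?thesis
  proof (induction j)
    case (Suc j)
    then show ?case using nth_subdegree_mult[of Y "Y ^ j"] sd Y_m by simp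
  qed simp
qed

text \<open>With \<open>t^w dt/t\<close> as basis the index is the contact order itself, without a
  shift by one. As \<open>dx = n t^n dt/t\<close>, the factor \<open>x^i dx\<close> supplies the
  exponent \<open>n * Suc i\<close>; its constant \<open>n\<close> is put into
  \<open>form_coeff\<close>. In the companion \<open>dy_coeff\<close>, \<open>fps_XD\<close> is
  \<open>t d/dt\<close>.\<close>

definition dx_coeff :: "nat \<Rightarrow> nat \<Rightarrow> nat \<Rightarrow> complex"
  where "dx_coeff i j w = fps_nth (fps_X ^ (n * Suc i) * Y ^ j) w"

definition dy_coeff :: "nat \<Rightarrow> nat \<Rightarrow> nat \<Rightarrow> complex"
  where "dy_coeff i j w = fps_nth (fps_X ^ (n * i) * (Y ^ j * fps_XD Y)) w"

lemma dx_coeff_nonzero: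
  assumes "dx_coeff i j w \<noteq> 0"
  shows "w = Suc i * n + j * m \<or> (\<exists>j'. j = Suc j' \<and> Suc i * n + j' * m + i0 \<le> w)"
proof -
  from assms have "n * Suc i \<le> w" "fps_nth (Y ^ j) (w - n * Suc i) \<noteq> 0"
    unfolding dx_coeff_def fps_X_power_mult_nth by (auto split: if_splits)
  with Y_power_nonzero[OF this(2)] show ?thesis by (auto simp: mult.commute)
qed

lemma dx_coeff_lead: "dx_coeff i j (Suc i * n + j * m) = 1"
  unfolding dx_coeff_def fps_X_power_mult_nth
  using Y_power_lead[of j] by (simp add: mult.commute)

text \<open>Since \<open>(j + 1) y^j (t dy/dt)\<close> is \<open>t d/dt\<close> of
  \<open>y^(j+1)\<close>, the coefficients of \<open>y^j dy\<close> are read off from powers of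
  \<open>y\<close>, to which the dichotomy applies.\<close>

lemma Y_power_XD: "fps_nth (Y ^ j * fps_XD Y) w = of_nat w / of_nat (Suc j) * fps_nth (Y ^ Suc j) w"
proof -
  have "of_nat (Suc j) * (Y ^ j * fps_XD Y) = fps_XD (Y ^ Suc j)"
    by (simp only: fps_XD_def fps_deriv_power o_def diff_Suc_1 mult_ac fps_of_nat)
  then have "of_nat (Suc j) * fps_nth (Y ^ j * fps_XD Y) w = of_nat w * fps_nth (Y ^ Suc j) w"
    by (metis fps_mult_of_nat_nth(1) fps_XD_nth)
  then show ?thesis by (simp add: field_simps del: of_nat_Suc)
qed

lemma dy_coeff_nonzero:
  assumes "dy_coeff i j w \<noteq> 0"
  shows "w = i * n + Suc j * m \<or> i * n + j * m + i0 \<le> w"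
proof -
  from assms have "n * i \<le> w" "fps_nth (Y ^ Suc j) (w - n * i) \<noteq> 0"
    unfolding dy_coeff_def fps_X_power_mult_nth Y_power_XD by (auto split: if_splits)
  with Y_power_nonzero[OF this(2)] show ?thesis by (auto simp: mult.commute)
qed

lemma dy_coeff_lead: "dy_coeff i j (i * n + Suc j * m) = of_nat m"
proof -
  have "dy_coeff i j (i * n + Suc j * m)
      = of_nat (Suc j * m) / of_nat (Suc j) * fps_nth (Y ^ Suc j) (Suc j * m)"
    unfolding dy_coeff_def fps_X_power_mult_nth Y_power_XD
    by (simp add: mult.commute del: power_Suc of_nat_Suc mult_Suc)
  then show ?thesis unfolding Y_power_lead by (simp del: of_nat_Suc mult_Suc)
qed

text \<open>The coefficient of \<open>t\<^sup>w dt/t\<close> in the pullback of \<open>A dx + B dy\<close>, for polynomials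
  \<open>A\<close> and \<open>B\<close> with the given coefficients.\<close>

definition form_coeff :: "nat \<Rightarrow> (nat \<Rightarrow> nat \<Rightarrow> complex) \<Rightarrow> (nat \<Rightarrow> nat \<Rightarrow> complex) \<Rightarrow> nat \<Rightarrow> complex"
  where "form_coeff N A B w = (\<Sum>(i,j)\<in>{..<N} \<times> {..<N}.
    of_nat n * A i j * dx_coeff i j w + B i j * dy_coeff i j w)"

definition fun_coeff :: "nat \<Rightarrow> (nat \<Rightarrow> nat \<Rightarrow> complex) \<Rightarrow> nat \<Rightarrow> complex"
  where "fun_coeff N c w = (\<Sum>(i,j)\<in>{..<N} \<times> {..<N}. c i j * fps_nth (fps_X ^ (n * i) * Y ^ j) w)"

lemma mono_coeff_nonzero:
  assumes "fps_nth (fps_X ^ (n * i) * Y ^ j) w \<noteq> 0"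
  shows "w = i * n + j * m \<or> (\<exists>j'. j = Suc j' \<and> i * n + j' * m + i0 \<le> w)"
proof -
  from assms have "n * i \<le> w" "fps_nth (Y ^ j) (w - n * i) \<noteq> 0"
    unfolding fps_X_power_mult_nth by (auto split: if_splits)
  with Y_power_nonzero[OF this(2)] show ?thesis by (auto simp: mult.commute)
qed

lemma mono_coeff_lead: "fps_nth (fps_X ^ (n * i) * Y ^ j) (i * n + j * m) = 1"
  unfolding fps_X_power_mult_nth using Y_power_lead[of j] by (simp add: mult.commute)

lemma form_coeff_single:
  assumes "P \<subseteq> {..<N} \<times> {..<N}"
    "\<And>i j. (i, j) \<notin> P \<Longrightarrow> A i j * dx_coeff i j w = 0 \<and> B i j * dy_coeff i j w = 0"
  shows "form_coeff N A B w = (\<Sum>(i,j)\<in>P. of_nat n * A i j * dx_coeff i j w + B i j * dy_coeff i j w)"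
  unfolding form_coeff_def by (intro sum.mono_neutral_right) (use assms in \<open>fastforce simp: mult.assoc\<close>)+

lemma fun_coeff_single:
  assumes "P \<subseteq> {..<N} \<times> {..<N}" "\<And>i j. (i, j) \<notin> P \<Longrightarrow> c i j * fps_nth (fps_X ^ (n * i) * Y ^ j) w = 0"
  shows "fun_coeff N c w = (\<Sum>(i,j)\<in>P. c i j * fps_nth (fps_X ^ (n * i) * Y ^ j) w)"
  unfolding fun_coeff_def by (intro sum.mono_neutral_right) (use assms in auto)

lemma not_multiple: "m \<noteq> i * n" "m \<noteq> n * i"
  using ndvd by auto

text \<open>The forms \<open>x^i dx\<close> have orders divisible by \<open>n\<close>, and
  \<open>m\<close> is not; every other monomial form except \<open>dy\<close> starts beyond
  \<open>m\<close>.\<close>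

lemma form_coeff_m:
  assumes "0 < N"
  shows "form_coeff N A B m = of_nat m * B 0 0"
proof -
  have dx: "dx_coeff i j m = 0" for i j
  proof (rule ccontr)
    assume "dx_coeff i j m \<noteq> 0"
    from dx_coeff_nonzero[OF this] mi not_multiple[of "Suc i"] n show False
      by (cases j) auto
  qed
  have "dy_coeff i j m = 0" if "(i, j) \<noteq> (0, 0)" for i j
  proof (rule ccontr)
    assume "dy_coeff i j m \<noteq> 0"
    from dy_coeff_nonzero[OF this] mi n nm that show False
      by (cases i; cases j) auto
  qed
  then have "form_coeff N A B m = (\<Sum>(i,j)\<in>{(0,0)}. of_nat n * A i j * dx_coeff i j m + B i j * dy_coeff i j m)"
    by (intro form_coeff_single) (use assms dx in auto)
  then show ?thesis using dx dy_coeff_lead[of 0 0] by simp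
qed

text \<open>The exponents \<open>m\<close>, \<open>n\<close>, \<open>2 * n\<close> and
  \<open>n + m\<close> isolate in turn the terms \<open>dy\<close>, \<open>dx\<close>,
  \<open>x dx\<close> and the pair \<open>y dx\<close>, \<open>x dy\<close>. For the dual field
  \<open>-B \<partial>\<^sub>x + A \<partial>\<^sub>y\<close> this means that it vanishes at the
  origin and that its linear part is a combination of
  \<open>n x \<partial>\<^sub>x + m y \<partial>\<^sub>y\<close> and
  \<open>y \<partial>\<^sub>x\<close>.\<close>

lemma form_coeff_low:
  assumes N: "2 \<le> N" and zero: "\<And>w. w \<le> n + m \<Longrightarrow> form_coeff N A B w = 0"
  shows "A 0 0 = 0" "A 1 0 = 0" "B 0 0 = 0" "of_nat n * A 0 1 + of_nat m * B 1 0 = 0"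
proof -
  show B0: "B 0 0 = 0" using form_coeff_m[of N A B] zero[of m] N n nm by simp
  have dx: "dx_coeff i j n = 0" if "(i, j) \<noteq> (0, 0)" for i j
  proof (rule ccontr)
    assume "dx_coeff i j n \<noteq> 0"
    from dx_coeff_nonzero[OF this] mi n nm that show False by (cases i; cases j) auto
  qed
  have dy: "dy_coeff i j n = 0" for i j
  proof (rule ccontr)
    assume "dy_coeff i j n \<noteq> 0"
    from dy_coeff_nonzero[OF this] mi n nm show False by auto
  qed
  have "form_coeff N A B n = (\<Sum>(i,j)\<in>{(0,0)}. of_nat n * A i j * dx_coeff i j n + B i j * dy_coeff i j n)"
    by (intro form_coeff_single) (use N dx dy in auto)
  then show A0: "A 0 0 = 0" using zero[of n] dx_coeff_lead[of 0 0] dy n by simp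
  have dx: "dx_coeff i j (2*n) = 0" if "(i, j) \<noteq> (1, 0)" for i j
  proof (rule ccontr)
    assume "dx_coeff i j (2*n) \<noteq> 0"
    from dx_coeff_nonzero[OF this] mi n nm that show False
      by (cases i; cases "i - 1"; cases j; cases "j - 1") auto
  qed
  \<comment> \<open>The tail of \<open>dy\<close> may already reach \<open>2 * n\<close> and
    \<open>n + m\<close>, so the computations at these two exponents rely on
    \<open>B 0 0 = 0\<close>.\<close>
  have dy: "dy_coeff i j (2*n) = 0" if "(i, j) \<noteq> (0, 0)" for i j
  proof (rule ccontr)
    assume "dy_coeff i j (2*n) \<noteq> 0"
    from dy_coeff_nonzero[OF this] mi n nm that not_multiple(1)[of 2] show False
      by (cases i; cases "i - 1"; cases j; cases "j - 1") auto
  qed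
  have "B i j * dy_coeff i j (2*n) = 0" for i j
    using dy[of i j] B0 by (cases "(i, j) = (0, 0)") auto
  then have "form_coeff N A B (2*n) = (\<Sum>(i,j)\<in>{(1,0)}. of_nat n * A i j * dx_coeff i j (2*n) + B i j * dy_coeff i j (2*n))"
    by (intro form_coeff_single) (use N dx in auto)
  then show A1: "A 1 0 = 0" using zero[of "2*n"] dx_coeff_lead[of 1 0] dy[of 1 0] n nm
    by (simp add: numeral_2_eq_2)
  have dx: "dx_coeff i j (n+m) = 0" if "(i, j) \<noteq> (0, 1)" for i j
  proof (rule ccontr)
    assume "dx_coeff i j (n+m) \<noteq> 0"
    from dx_coeff_nonzero[OF this] mi n nm that not_multiple(1)[of i] show False
      by (cases i; cases j; cases "j - 1") auto
  qed
  have dy: "dy_coeff i j (n+m) = 0" if "(i, j) \<noteq> (1, 0)" "(i, j) \<noteq> (0, 0)" for i j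
  proof (rule ccontr)
    assume "dy_coeff i j (n+m) \<noteq> 0"
    from dy_coeff_nonzero[OF this] mi n nm that show False
      by (cases i; cases "i - 1"; cases j; cases "j - 1") auto
  qed
  have "B i j * dy_coeff i j (n+m) = 0" if "(i, j) \<noteq> (1, 0)" for i j
    using dy[of i j] B0 that by (cases "(i, j) = (0, 0)") auto
  then have "form_coeff N A B (n+m) = (\<Sum>(i,j)\<in>{(0,1),(1,0)}. of_nat n * A i j * dx_coeff i j (n+m) + B i j * dy_coeff i j (n+m))"
    by (intro form_coeff_single) (use N dx in auto)
  then show "of_nat n * A 0 1 + of_nat m * B 1 0 = 0"
    using zero[of "n+m"] dx_coeff_lead[of 0 1] dy_coeff_lead[of 1 0] dx[of 1 0] dy[of 0 1]
    by (simp add: mult.commute)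
qed

lemma form_coeff_nonzeroE:
  assumes "form_coeff N A B w \<noteq> 0"
  obtains i j where "A i j \<noteq> 0" "dx_coeff i j w \<noteq> 0" | i j where "B i j \<noteq> 0" "dy_coeff i j w \<noteq> 0"
proof -
  have "\<exists>i j. (A i j \<noteq> 0 \<and> dx_coeff i j w \<noteq> 0) \<or> (B i j \<noteq> 0 \<and> dy_coeff i j w \<noteq> 0)"
  proof (rule ccontr)
    assume "\<not> ?thesis"
    then have "of_nat n * A i j * dx_coeff i j w + B i j * dy_coeff i j w = 0" for i j
      by (cases "A i j = 0"; cases "B i j = 0"; force)
    then have "form_coeff N A B w = 0" unfolding form_coeff_def
      by (intro sum.neutral ballI) (simp only: split_beta)
    with assms show False by simp
  qed
  with that show thesis by blast
qed

text \<open>Only \<open>dy\<close> and the Euler form can have a contact order below or equal to \<open>i0 + n\<close> that is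
  not a sum of multiples of \<open>n\<close> and \<open>m\<close>.\<close>

lemma contact_order_below:
  assumes w: "form_coeff N A B w \<noteq> 0" "\<And>u. u < w \<Longrightarrow> form_coeff N A B u = 0" "w < i0 + n" and N: "0 < N"
  shows "\<exists>i j. w = i * n + j * m"
  using w(1)
proof (cases rule: form_coeff_nonzeroE)
  case (1 i j)
  then have "w = Suc i * n + j * m" using dx_coeff_nonzero[OF 1(2)] w(3) by auto
  then show ?thesis by blast
next
  case (2 i j)
  have "\<not> i * n + j * m + i0 \<le> w"
  proof
    assume *: "i * n + j * m + i0 \<le> w"
    with w(3) nm have "i * n + j * m < n" by simp
    then have "i = 0" "j = 0" using nm by (cases i; cases j; auto)+
    with * 2(1) mi w(2)[of m] form_coeff_m[OF N, of A B] n nm show False by auto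
  qed
  with dy_coeff_nonzero[OF 2(2)] show ?thesis by blast
qed

text \<open>Among the monomial forms only \<open>y dx\<close>, \<open>dy\<close> and
  \<open>x dy\<close> have tails that can reach \<open>i0 + n\<close>; once their coefficients
  vanish, this exponent can only be a leading one.\<close>

lemma contact_order_at:
  assumes "form_coeff N A B (i0 + n) \<noteq> 0" "A 0 1 = 0" "B 0 0 = 0" "B 1 0 = 0"
  shows "\<exists>i j. i0 + n = i * n + j * m"
  using assms(1)
proof (cases rule: form_coeff_nonzeroE)
  case (1 i j)
  have "\<not> (\<exists>j'. j = Suc j' \<and> Suc i * n + j' * m + i0 \<le> i0 + n)"
  proof
    assume "\<exists>j'. j = Suc j' \<and> Suc i * n + j' * m + i0 \<le> i0 + n"
    then obtain j' where "j = Suc j'" "i * n + j' * m \<le> 0" by auto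
    then have "i = 0" "j = 1" using n nm by auto
    with 1(1) assms(2) show False by simp
  qed
  with dx_coeff_nonzero[OF 1(2)] have "i0 + n = Suc i * n + j * m" by blast
  then show ?thesis by blast
next
  case (2 i j)
  have "\<not> i * n + j * m + i0 \<le> i0 + n"
  proof
    assume "i * n + j * m + i0 \<le> i0 + n"
    then have "j = 0" "i = 0 \<or> i = 1" using n nm by (cases i; cases "i - 1"; cases j; auto)+
    with 2(1) assms show False by auto
  qed
  with dy_coeff_nonzero[OF 2(2)] show ?thesis by blast
qed

text \<open>Only \<open>y\<close> and \<open>x y\<close> have tails that can reach
  \<open>i0 + n\<close>. Their leading exponents \<open>m\<close> and \<open>n + m\<close> lie
  strictly below, where the function has no terms, so both coefficients are zero.\<close>

lemma function_order_at:
  assumes w: "fun_coeff N c (i0 + n) \<noteq> 0" "\<And>u. u < i0 + n \<Longrightarrow> fun_coeff N c u = 0" and N: "2 \<le> N"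
  shows "\<exists>i j. i0 + n = i * n + j * m"
proof (rule ccontr)
  assume no: "\<nexists>i j. i0 + n = i * n + j * m"
  have z: "fps_nth (fps_X ^ (n * i) * Y ^ j) m = 0" if "(i, j) \<noteq> (0, 1)" for i j
  proof (rule ccontr)
    assume "fps_nth (fps_X ^ (n * i) * Y ^ j) m \<noteq> 0"
    from mono_coeff_nonzero[OF this] mi n nm that not_multiple(1)[of i] show False
      by (cases i; cases j; cases "j - 1") auto
  qed
  have "fun_coeff N c m = (\<Sum>(i,j)\<in>{(0,1)}. c i j * fps_nth (fps_X ^ (n * i) * Y ^ j) m)"
    by (intro fun_coeff_single) (use N z in auto)
  then have c01: "c 0 1 = 0" using w(2)[of m] mono_coeff_lead[of 0 1] mi by simp
  have z: "c i j * fps_nth (fps_X ^ (n * i) * Y ^ j) (n+m) = 0" if "(i, j) \<noteq> (1, 1)" for i j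
  proof (rule ccontr)
    assume *: "c i j * fps_nth (fps_X ^ (n * i) * Y ^ j) (n+m) \<noteq> 0"
    then have "fps_nth (fps_X ^ (n * i) * Y ^ j) (n+m) \<noteq> 0" by auto
    from mono_coeff_nonzero[OF this] mi n nm that not_multiple(1)[of "i - 1"] * c01 show False
      by (cases i; cases "i - 1"; cases j; cases "j - 1") auto
  qed
  have "fun_coeff N c (n+m) = (\<Sum>(i,j)\<in>{(1,1)}. c i j * fps_nth (fps_X ^ (n * i) * Y ^ j) (n+m))"
    by (intro fun_coeff_single) (use N z in auto)
  then have c11: "c 1 1 = 0" using w(2)[of "n+m"] mono_coeff_lead[of 1 1] mi by simp
  have "c i j * fps_nth (fps_X ^ (n * i) * Y ^ j) (i0+n) = 0" for i j
  proof (rule ccontr)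
    assume *: "c i j * fps_nth (fps_X ^ (n * i) * Y ^ j) (i0+n) \<noteq> 0"
    then have "fps_nth (fps_X ^ (n * i) * Y ^ j) (i0+n) \<noteq> 0" by auto
    from mono_coeff_nonzero[OF this] no obtain j' where "j = Suc j'" "i * n + j' * m \<le> n" by auto
    then have "j = 1" "i = 0 \<or> i = 1" using n nm by (cases i; cases "i - 1"; cases j'; auto)+
    with c01 c11 * show False by auto
  qed
  then have "fun_coeff N c (i0+n) = 0" unfolding fun_coeff_def by (intro sum.neutral) auto
  with w(1) show False by simp
qed

text \<open>The exponent is the leading one of \<open>x^(i-1) y^j dx\<close> if \<open>i > 0\<close>
  and of \<open>y^(j-1) dy\<close> otherwise. Neither form is \<open>x dy\<close>, so the dual field
  has no term \<open>x \<partial>\<^sub>x\<close>.\<close>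

lemma form_of_weight:
  assumes "w = i * n + j * m" "w > 0"
  shows "\<exists>N A B. 2 \<le> N \<and> form_coeff N A B w \<noteq> 0 \<and> (\<forall>u<w. form_coeff N A B u = 0) \<and> B 1 0 = 0"
proof (cases i)
  case (Suc k)
  define A where "A = (\<lambda>i' j'. if i' = k \<and> j' = j then (1::complex) else 0)"
  let ?N = "k + j + 2"
  have e: "form_coeff ?N A (\<lambda>_ _. 0) u = of_nat n * dx_coeff k j u" for u
    by (subst form_coeff_single[where P = "{(k, j)}"]) (auto simp: A_def)
  have "dx_coeff k j u = 0" if "u < w" for u
  proof (rule ccontr)
    assume "dx_coeff k j u \<noteq> 0"
    from dx_coeff_nonzero[OF this] that assms Suc mi show False by auto
  qed
  moreover have "dx_coeff k j w = 1" using dx_coeff_lead assms Suc by simp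
  ultimately show ?thesis using e n
    by (intro exI[of _ ?N] exI[of _ A] exI[of _ "\<lambda>_ _. 0"]) auto
next
  case 0
  with assms obtain l where l: "j = Suc l" by (cases j) auto
  define B where "B = (\<lambda>(i'::nat) j'. if i' = 0 \<and> j' = l then (1::complex) else 0)"
  let ?N = "l + 2"
  have e: "form_coeff ?N (\<lambda>_ _. 0) B u = dy_coeff 0 l u" for u
    by (subst form_coeff_single[where P = "{(0, l)}"]) (auto simp: B_def)
  have "dy_coeff 0 l u = 0" if "u < w" for u
  proof (rule ccontr)
    assume "dy_coeff 0 l u \<noteq> 0"
    from dy_coeff_nonzero[OF this] that assms 0 l mi show False by auto
  qed
  moreover have "dy_coeff 0 l w = of_nat m" using dy_coeff_lead[of 0 l] assms 0 l by simp
  ultimately show ?thesis using e n nm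
    by (intro exI[of _ ?N] exI[of _ "\<lambda>_ _. 0"] exI[of _ B]) (auto simp: B_def)
qed

lemma form_coeff_add:
  "form_coeff N (\<lambda>i j. A i j + A' i j) (\<lambda>i j. B i j + B' i j) w = form_coeff N A B w + form_coeff N A' B' w"
  unfolding form_coeff_def sum.distrib[symmetric] by (intro sum.cong) (auto simp: algebra_simps)

text \<open>The Euler form \<open>m y dx - n x dy\<close>.\<close>

lemma form_coeff_euler:
  assumes "2 \<le> N"
  shows "form_coeff N (\<lambda>i j. if i = 0 \<and> j = 1 then c * of_nat m else 0)
    (\<lambda>i j. if i = 1 \<and> j = 0 then - c * of_nat n else 0) w
    = (if w < n then 0 else c * of_nat n * (of_nat m - of_nat (w - n)) * fps_nth Y (w - n))"
proof -
  have *: "dx_coeff 0 (Suc 0) w = (if w < n then 0 else fps_nth Y (w - n))"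
    "dy_coeff (Suc 0) 0 w = (if w < n then 0 else of_nat (w - n) * fps_nth Y (w - n))"
    by (simp_all add: dx_coeff_def dy_coeff_def fps_X_power_mult_nth)
  show ?thesis
    by (subst form_coeff_single[where P = "{(0,1),(1,0)}"]) (use assms in \<open>auto simp: * algebra_simps\<close>)
qed

text \<open>Otherwise subtracting a multiple of the Euler form would yield the contact order \<open>i0 + n\<close> without
  an Euler part.\<close>

lemma no_euler_part:
  assumes k: "i0 < k" "\<And>u. u < k + n \<Longrightarrow> form_coeff N A B u = 0" and N: "2 \<le> N"
    and i0: "fps_nth Y i0 \<noteq> 0" "\<nexists>i j. i0 + n = i * n + j * m"
  shows "B 1 0 = 0"
proof (rule ccontr)
  assume B: "B 1 0 \<noteq> 0"
  have low: "A 0 0 = 0" "A 1 0 = 0" "B 0 0 = 0" "of_nat n * A 0 1 + of_nat m * B 1 0 = 0"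
    using form_coeff_low[OF N, of A B] k mi by auto
  \<comment> \<open>This multiple of the Euler form cancels \<open>x dy\<close> and, by the last
    relation in \<open>low\<close>, also \<open>y dx\<close>. At \<open>i0 + n\<close>, where the
    original form has no term because \<open>i0 < k\<close>, the Euler form contributes a nonzero
    coefficient, since \<open>i0 \<noteq> m\<close>.\<close>
  define c where "c = B 1 0 / of_nat n"
  define A' where "A' = (\<lambda>i j. A i j + (if i = 0 \<and> j = 1 then c * of_nat m else 0))"
  define B' where "B' = (\<lambda>i j. B i j + (if i = 1 \<and> j = 0 then - c * of_nat n else 0))"
  have "form_coeff N A' B' (i0 + n) = c * of_nat n * (of_nat m - of_nat i0) * fps_nth Y i0"
    unfolding A'_def B'_def form_coeff_add form_coeff_euler[OF N] using k by simp
  moreover have "(of_nat m - of_nat i0 :: complex) \<noteq> 0" using mi by simp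
  ultimately have "form_coeff N A' B' (i0 + n) \<noteq> 0" using i0 B n by (simp add: c_def)
  moreover have "A' 0 1 = 0" using low(4) n by (simp add: A'_def c_def field_simps)
  moreover have "B' 0 0 = 0" "B' 1 0 = 0" using low n by (auto simp: B'_def c_def)
  ultimately show False using contact_order_at i0(2) by blast
qed

end

section \<open>Germs of curves and power series\<close>

lemma isCont_tendsto_nhds: "isCont f a \<Longrightarrow> (f \<longlongrightarrow> f a) (nhds a)"
  unfolding isCont_def tendsto_at_iff_tendsto_nhds .

lemma has_fps_expansion_unique:
  fixes f :: "complex \<Rightarrow> complex"
  assumes "f has_fps_expansion F" "f has_fps_expansion G"
  shows "F = G"
  by (rule fps_ext) (simp add: fps_nth_fps_expansion[OF assms(1)] fps_nth_fps_expansion[OF assms(2)])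

lemma has_fps_expansion_transfer:
  fixes f g :: "complex \<Rightarrow> complex"
  assumes "f has_fps_expansion F" "\<forall>\<^sub>F t in nhds 0. f t = g t"
  shows "g has_fps_expansion F"
  using has_fps_expansion_cong[OF assms(2) refl] assms(1) by simp

lemma has_fps_expansion_nth_0: "f has_fps_expansion F \<Longrightarrow> fps_nth F 0 = (f 0 :: complex)"
  using has_fps_expansion_to_laurent by metis

text \<open>The quotient by \<open>t^N\<close> has a removable singularity, hence is bounded near
  0.\<close>

lemma has_fps_expansion_bigoI:
  fixes f :: "complex \<Rightarrow> complex"
  assumes "f has_fps_expansion F" "\<And>i. i < N \<Longrightarrow> fps_nth F i = 0"
  obtains C where "0 < C" "\<forall>\<^sub>F t in nhds 0. norm (f t) \<le> C * norm t ^ N"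
proof -
  let ?g = "\<lambda>x. if x = 0 then fps_nth F N else f x / x ^ N"
  have "?g has_fps_expansion fps_shift N F"
  proof (cases "F = 0")
    case True
    have "\<forall>\<^sub>F x in nhds 0. f x = 0" using assms(1) True by (simp add: has_fps_expansion_0_iff)
    then have "\<forall>\<^sub>F x in nhds 0. ?g x = 0" by eventually_elim (auto simp: True)
    then show ?thesis by (simp add: True has_fps_expansion_0_iff)
  next
    case False
    then show ?thesis using assms by (intro has_fps_expansion_shift) (auto intro!: subdegree_geI)
  qed
  then have "isCont ?g 0" using has_fps_expansion_imp_continuous[of ?g _ UNIV] by simp
  then have "(?g \<longlongrightarrow> ?g 0) (nhds 0)" by (rule isCont_tendsto_nhds)
  then have "((\<lambda>x. norm (?g x)) \<longlongrightarrow> norm (?g 0)) (nhds 0)" by (rule tendsto_norm)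
  then have "\<forall>\<^sub>F x in nhds 0. norm (?g x) < norm (?g 0) + 1"
    by (rule order_tendstoD(2)) simp
  then have "\<forall>\<^sub>F t in nhds 0. norm (f t) \<le> (norm (?g 0) + 1) * norm t ^ N"
  proof eventually_elim
    case (elim x)
    show ?case
    proof (cases "x = 0")
      case True
      have "f 0 = fps_nth F 0" using assms(1) has_fps_expansion_nth_0 by metis
      then show ?thesis using True assms(2)[of 0] by (cases N) auto
    next
      case False
      then show ?thesis using elim by (simp add: norm_divide norm_power field_simps)
    qed
  qed
  then show thesis by (intro that[of "norm (?g 0) + 1"]) (auto intro: add_nonneg_pos)
qed

text \<open>If some coefficient below \<open>N\<close> were nonzero, dividing by the lowest power
  \<open>t^d\<close> would give a nonzero limit at 0, whereas the estimate forces the limit 0. The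
  estimate is stated on punctured neighbourhoods because those for flows divide by powers of
  \<open>t\<close>.\<close>

lemma has_fps_expansion_bigoD:
  fixes f :: "complex \<Rightarrow> complex"
  assumes f: "f has_fps_expansion F" and C: "\<forall>\<^sub>F t in at 0. norm (f t) \<le> C * norm t ^ N" and "i < N"
  shows "fps_nth F i = 0"
proof (rule ccontr)
  assume "fps_nth F i \<noteq> 0"
  define d where "d = subdegree F"
  have F: "F \<noteq> 0" using \<open>fps_nth F i \<noteq> 0\<close> by auto
  have d: "d < N" "fps_nth F d \<noteq> 0"
    using \<open>fps_nth F i \<noteq> 0\<close> \<open>i < N\<close> subdegree_leI[of F i] F unfolding d_def by auto
  let ?g = "\<lambda>x. if x = 0 then fps_nth F d else f x / x ^ d"
  have "?g has_fps_expansion fps_shift d F"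
    by (rule has_fps_expansion_shift[OF f]) (auto simp: d_def)
  then have "isCont ?g 0" using has_fps_expansion_imp_continuous[of ?g _ UNIV] by simp
  then have lim: "((\<lambda>x. norm (?g x)) \<longlongrightarrow> norm (fps_nth F d)) (at 0)"
    by (auto simp: isCont_def intro: tendsto_norm)
  have "((\<lambda>x::complex. C * norm x ^ (N - d)) \<longlongrightarrow> C * norm (0::complex) ^ (N - d)) (at 0)"
    by (intro tendsto_intros)
  moreover have "C * norm (0::complex) ^ (N - d) = 0" using d by simp
  ultimately have lim0: "((\<lambda>x::complex. C * norm x ^ (N - d)) \<longlongrightarrow> 0) (at 0)" by metis
  have "\<forall>\<^sub>F x in at 0. norm (?g x) \<le> C * norm x ^ (N - d)"
    using C eventually_at_filter[of "\<lambda>x. x \<noteq> 0" 0 UNIV, simplified] 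
  proof eventually_elim
    case (elim x)
    then have "norm (?g x) \<le> C * norm x ^ N / norm x ^ d"
      by (simp add: norm_divide norm_power divide_right_mono)
    also have "\<dots> = C * norm x ^ (N - d)" using elim d by (simp add: power_diff)
    finally show ?case .
  qed
  from tendsto_le[OF _ lim0 lim this] d show False by simp
qed

definition curve_germ :: "(complex \<Rightarrow> complex \<times> complex) \<Rightarrow> bool"
  where "curve_germ \<phi> \<longleftrightarrow> (\<lambda>t. fst (\<phi> t)) analytic_on {0} \<and> (\<lambda>t. snd (\<phi> t)) analytic_on {0} \<and> \<phi> 0 = (0, 0)"

lemma analytic_at_0_ball:
  assumes "f analytic_on {0 :: complex}"
  obtains r where "0 < r" "f holomorphic_on ball 0 r"
  using assms unfolding analytic_on_def by auto

lemma curve_germ_eventually: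
  assumes "curve_germ \<phi>" "\<forall>\<^sub>F p in nhds (0, 0). P p"
  shows "\<forall>\<^sub>F t in nhds 0. P (\<phi> t)"
proof -
  have "isCont (\<lambda>t. fst (\<phi> t)) 0" "isCont (\<lambda>t. snd (\<phi> t)) 0"
    using assms(1) unfolding curve_germ_def by (auto intro: analytic_at_imp_isCont)
  then have "isCont (\<lambda>t. (fst (\<phi> t), snd (\<phi> t))) 0" by (intro isCont_Pair)
  then have "isCont \<phi> 0" by simp
  from isCont_tendsto_nhds[OF this] show ?thesis using assms unfolding curve_germ_def by (simp add: filterlim_iff)
qed

lemma holomorphic2_germ_curve_analytic:
  assumes f: "holomorphic2_germ f" and \<phi>: "curve_germ \<phi>"
  shows "(\<lambda>t. f (\<phi> t)) analytic_on {0}"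
proof -
  obtain U where U: "open U" "(0,0) \<in> U" "holomorphic2_on f U"
    using f unfolding holomorphic2_germ_def by blast
  have "\<forall>\<^sub>F t in nhds 0. \<phi> t \<in> U"
    by (rule curve_germ_eventually[OF \<phi> eventually_nhds_in_open[OF U(1,2)]])
  then obtain S where S: "open S" "0 \<in> S" "\<And>t. t \<in> S \<Longrightarrow> \<phi> t \<in> U"
    unfolding eventually_nhds by blast
  obtain r1 where r1: "0 < r1" "(\<lambda>t. fst (\<phi> t)) holomorphic_on ball 0 r1"
    using \<phi> unfolding curve_germ_def by (auto elim: analytic_at_0_ball)
  obtain r2 where r2: "0 < r2" "(\<lambda>t. snd (\<phi> t)) holomorphic_on ball 0 r2"
    using \<phi> unfolding curve_germ_def by (auto elim: analytic_at_0_ball)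
  let ?T = "S \<inter> ball 0 r1 \<inter> ball 0 r2"
  have "(\<lambda>t. f (fst (\<phi> t), snd (\<phi> t))) holomorphic_on ?T"
    by (rule holomorphic2_on_compose_curve[OF U(3)])
      (use S r1 r2 in \<open>auto intro: holomorphic_on_subset\<close>)
  then show ?thesis using S r1 r2 by (auto simp: analytic_at intro!: exI[of _ ?T])
qed

lemma holomorphic2_germ_poly2: "holomorphic2_germ (poly2 N c)"
  unfolding holomorphic2_germ_def using holomorphic2_on_poly2 by (intro exI[of _ UNIV]) auto

lemma curve_germ_fps:
  assumes "curve_germ \<phi>"
  obtains U V where "(\<lambda>t. fst (\<phi> t)) has_fps_expansion U" "(\<lambda>t. snd (\<phi> t)) has_fps_expansion V"
    "fps_nth U 0 = 0" "fps_nth V 0 = 0"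
proof -
  have *: "(\<lambda>t. fst (\<phi> t)) has_fps_expansion fps_expansion (\<lambda>t. fst (\<phi> t)) 0"
    "(\<lambda>t. snd (\<phi> t)) has_fps_expansion fps_expansion (\<lambda>t. snd (\<phi> t)) 0"
    using assms analytic_at_imp_has_fps_expansion_0 unfolding curve_germ_def by blast+
  show thesis
    by (rule that[OF *]) (use has_fps_expansion_nth_0[OF *(1)] has_fps_expansion_nth_0[OF *(2)] assms
      in \<open>auto simp: curve_germ_def\<close>)
qed

lemma form_pullback_fps:
  assumes "(\<lambda>t. A (\<phi> t)) has_fps_expansion FA" "(\<lambda>t. B (\<phi> t)) has_fps_expansion FB"
    "(\<lambda>t. fst (\<phi> t)) has_fps_expansion U" "(\<lambda>t. snd (\<phi> t)) has_fps_expansion V"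
  shows "form_pullback \<phi> A B has_fps_expansion FA * fps_deriv U + FB * fps_deriv V"
  unfolding form_pullback_def[abs_def] by (intro fps_expansion_intros assms)

lemma zorder_subdegree:
  assumes "f has_fps_expansion F"
  shows "(\<forall>\<^sub>F t in nhds 0. f t = 0) \<longleftrightarrow> F = 0" "F \<noteq> 0 \<Longrightarrow> nat (zorder f 0) = subdegree F"
  using assms has_fps_expansion_unique[OF assms, of 0] has_fps_expansion_zorder_0[OF assms]
  by (auto simp: has_fps_expansion_0_iff)

lemma branch_semigroup_iff:
  assumes "curve_germ \<phi>"
  shows "e \<in> branch_semigroup \<phi> \<longleftrightarrow>
    (\<exists>f F. holomorphic2_germ f \<and> (\<lambda>t. f (\<phi> t)) has_fps_expansion F \<and> F \<noteq> 0 \<and> subdegree F = e)"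
proof
  assume "e \<in> branch_semigroup \<phi>"
  then obtain f where f: "holomorphic2_germ f" "\<not> (\<forall>\<^sub>F t in nhds 0. f (\<phi> t) = 0)"
    "e = nat (zorder (\<lambda>t. f (\<phi> t)) 0)" unfolding branch_semigroup_def by blast
  have F: "(\<lambda>t. f (\<phi> t)) has_fps_expansion fps_expansion (\<lambda>t. f (\<phi> t)) 0"
    by (rule analytic_at_imp_has_fps_expansion_0[OF holomorphic2_germ_curve_analytic[OF f(1) assms]])
  show "\<exists>f F. holomorphic2_germ f \<and> (\<lambda>t. f (\<phi> t)) has_fps_expansion F \<and> F \<noteq> 0 \<and> subdegree F = e"
    using f F zorder_subdegree[OF F] by metis
next
  assume "\<exists>f F. holomorphic2_germ f \<and> (\<lambda>t. f (\<phi> t)) has_fps_expansion F \<and> F \<noteq> 0 \<and> subdegree F = e"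
  then obtain f F where f: "holomorphic2_germ f" "(\<lambda>t. f (\<phi> t)) has_fps_expansion F" "F \<noteq> 0" "subdegree F = e"
    by blast
  then show "e \<in> branch_semigroup \<phi>"
    unfolding branch_semigroup_def mem_Collect_eq
    using zorder_subdegree[OF f(2)] by (intro exI[of _ f]) auto
qed

lemma contact_orders_iff:
  assumes \<phi>: "curve_germ \<phi>"
  shows "w \<in> contact_orders \<phi> \<longleftrightarrow>
    (\<exists>A B F. holomorphic2_germ A \<and> holomorphic2_germ B \<and> form_pullback \<phi> A B has_fps_expansion F \<and>
      F \<noteq> 0 \<and> subdegree F + 1 = w)"
proof
  assume "w \<in> contact_orders \<phi>"
  then obtain A B where f: "holomorphic2_germ A" "holomorphic2_germ B"
    "\<not> (\<forall>\<^sub>F t in nhds 0. form_pullback \<phi> A B t = 0)"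
    "w = nat (zorder (form_pullback \<phi> A B) 0) + 1" unfolding contact_orders_def by blast
  obtain U V where UV: "(\<lambda>t. fst (\<phi> t)) has_fps_expansion U" "(\<lambda>t. snd (\<phi> t)) has_fps_expansion V"
    by (rule curve_germ_fps[OF \<phi>])
  have F: "\<exists>F. form_pullback \<phi> A B has_fps_expansion F"
    using form_pullback_fps[OF analytic_at_imp_has_fps_expansion_0[OF holomorphic2_germ_curve_analytic[OF f(1) \<phi>]]
      analytic_at_imp_has_fps_expansion_0[OF holomorphic2_germ_curve_analytic[OF f(2) \<phi>]] UV] by blast
  then obtain F where F: "form_pullback \<phi> A B has_fps_expansion F" by blast
  show "\<exists>A B F. holomorphic2_germ A \<and> holomorphic2_germ B \<and> form_pullback \<phi> A B has_fps_expansion F \<and>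
      F \<noteq> 0 \<and> subdegree F + 1 = w"
    using f F zorder_subdegree[OF F] by metis
next
  assume "\<exists>A B F. holomorphic2_germ A \<and> holomorphic2_germ B \<and> form_pullback \<phi> A B has_fps_expansion F \<and>
      F \<noteq> 0 \<and> subdegree F + 1 = w"
  then obtain A B F where f: "holomorphic2_germ A" "holomorphic2_germ B"
    "form_pullback \<phi> A B has_fps_expansion F" "F \<noteq> 0" "subdegree F + 1 = w"
    by blast
  then show "w \<in> contact_orders \<phi>"
    unfolding contact_orders_def mem_Collect_eq
    using zorder_subdegree[OF f(3)] by (intro exI[of _ A] exI[of _ B]) auto
qed

section \<open>Germs of biholomorphisms\<close>

lemma holomorphic2_map_continuous_on: "holomorphic2_map_on F U \<Longrightarrow> continuous_on U F"
  unfolding holomorphic2_map_on_def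
  using continuous_on_Pair[of U "\<lambda>p. fst (F p)" "\<lambda>p. snd (F p)"]
  by (simp add: holomorphic2_on_imp_continuous_on)

lemma holomorphic2_map_on_subset: "holomorphic2_map_on F U \<Longrightarrow> V \<subseteq> U \<Longrightarrow> holomorphic2_map_on F V"
  unfolding holomorphic2_map_on_def using holomorphic2_on_subset by blast

lemma holomorphic2_on_compose_map:
  assumes "holomorphic2_on f V" "holomorphic2_map_on G U" "\<And>p. p \<in> U \<Longrightarrow> G p \<in> V"
  shows "holomorphic2_on (\<lambda>p. f (G p)) U"
  using holomorphic2_on_compose[OF assms(1), of "\<lambda>p. fst (G p)" U "\<lambda>p. snd (G p)"] assms(2,3)
  unfolding holomorphic2_map_on_def by simp

text \<open>The two maps are inverse to each other only near the origin. Restricting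
  \<open>F\<close> to points whose image lies in the domain kept for \<open>G\<close>, and
  symmetrically, yields open sets that are exchanged by both maps.\<close>

lemma biholomorphism_germI:
  assumes F: "open U0" "(0,0) \<in> U0" "holomorphic2_map_on F U0" "F (0,0) = (0,0)"
    and G: "open V0" "(0,0) \<in> V0" "holomorphic2_map_on G V0" "G (0,0) = (0,0)"
    and GF: "\<forall>\<^sub>F p in nhds (0,0). G (F p) = p" and FG: "\<forall>\<^sub>F p in nhds (0,0). F (G p) = p"
  shows "biholomorphism_germ F"
proof -
  obtain U' where U': "open U'" "(0,0) \<in> U'" "\<And>p. p \<in> U' \<Longrightarrow> G (F p) = p"
    using GF unfolding eventually_nhds by blast
  obtain V' where V': "open V'" "(0,0) \<in> V'" "\<And>p. p \<in> V' \<Longrightarrow> F (G p) = p"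
    using FG unfolding eventually_nhds by blast
  define U1 where "U1 = U0 \<inter> U'"
  define V1 where "V1 = V0 \<inter> V'"
  have o: "open U1" "open V1" "(0,0) \<in> U1" "(0,0) \<in> V1" using F G U' V' by (auto simp: U1_def V1_def)
  have h: "holomorphic2_map_on F U1" "holomorphic2_map_on G V1"
    using holomorphic2_map_on_subset F(3) G(3) unfolding U1_def V1_def by (metis Int_lower1)+
  define U where "U = F -` V1 \<inter> U1"
  define V where "V = G -` U1 \<inter> V1"
  have oUV: "open U" "open V" unfolding U_def V_def
    using continuous_open_preimage[OF holomorphic2_map_continuous_on[OF h(1)] o(1,2)]
      continuous_open_preimage[OF holomorphic2_map_continuous_on[OF h(2)] o(2,1)]
    by (simp_all add: Int_commute)
  have FU: "F p \<in> V" "G (F p) = p" if "p \<in> U" for p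
    using that U'(3) by (auto simp: U_def V_def U1_def)
  have GV: "G q \<in> U" "F (G q) = q" if "q \<in> V" for q
    using that V'(3) by (auto simp: U_def V_def V1_def)
  have hUV: "holomorphic2_map_on F U" "holomorphic2_map_on G V"
    using h holomorphic2_map_on_subset unfolding U_def V_def by (metis Int_lower2)+
  have "homeomorphism U V F G"
    unfolding homeomorphism_def
  proof (intro conjI ballI)
    show "F ` U = V" using FU GV by (metis image_eqI subsetI subset_antisym image_subset_iff)
    show "G ` V = U" using FU GV by (metis image_eqI subsetI subset_antisym image_subset_iff)
  qed (use FU GV hUV in \<open>auto intro: holomorphic2_map_continuous_on\<close>)
  moreover have "(0,0) \<in> U" using o F(4) by (simp add: U_def)
  ultimately show ?thesis unfolding biholomorphism_germ_def using F(4) oUV hUV by blast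
qed

lemma holomorphic2_map_eventually:
  assumes "open U" "(0,0) \<in> U" "holomorphic2_map_on F U" "F (0,0) = (0,0)" "\<forall>\<^sub>F p in nhds (0,0). P p"
  shows "\<forall>\<^sub>F p in nhds (0,0). P (F p)"
proof -
  have "isCont F (0,0)"
    using holomorphic2_map_continuous_on[OF assms(3)] assms(1,2) continuous_on_eq_continuous_at by blast
  from isCont_tendsto_nhds[OF this] have "filterlim F (nhds (0,0)) (nhds (0,0))"
    using assms(4) by simp
  then show ?thesis using assms(5) by (simp add: filterlim_iff)
qed

lemma biholomorphism_germ_map:
  assumes "biholomorphism_germ F"
  shows "\<exists>U. open U \<and> (0,0) \<in> U \<and> holomorphic2_map_on F U" "F (0,0) = (0,0)"
  using assms unfolding biholomorphism_germ_def by blast+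

lemma biholomorphism_germ_eventually:
  assumes "biholomorphism_germ F" "\<forall>\<^sub>F p in nhds (0,0). P p"
  shows "\<forall>\<^sub>F p in nhds (0,0). P (F p)"
proof -
  obtain U where "open U" "(0,0) \<in> U" "holomorphic2_map_on F U"
    using biholomorphism_germ_map(1)[OF assms(1)] by blast
  then show ?thesis using holomorphic2_map_eventually biholomorphism_germ_map(2)[OF assms(1)] assms(2) by blast
qed

lemma biholomorphism_germ_inverse:
  assumes "biholomorphism_germ F"
  obtains G where "biholomorphism_germ G" "\<forall>\<^sub>F p in nhds (0,0). G (F p) = p"
    "\<forall>\<^sub>F p in nhds (0,0). F (G p) = p"
proof -
  obtain U V G where *: "F (0,0) = (0,0)" "open U" "open V" "(0,0) \<in> U" "homeomorphism U V F G"
    "holomorphic2_map_on F U" "holomorphic2_map_on G V"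
    using assms unfolding biholomorphism_germ_def by blast
  have inv: "\<And>p. p \<in> U \<Longrightarrow> G (F p) = p" "\<And>p. p \<in> V \<Longrightarrow> F (G p) = p" "F ` U = V"
    using *(5) unfolding homeomorphism_def by auto
  have V0: "(0,0) \<in> V" "G (0,0) = (0,0)" using *(1,4) inv(1)[of "(0,0)"] inv(3) by force+
  have ev: "\<forall>\<^sub>F p in nhds (0,0). G (F p) = p" "\<forall>\<^sub>F p in nhds (0,0). F (G p) = p"
    using * V0 inv(1,2) eventually_nhds by blast+
  show thesis
    by (rule that[OF biholomorphism_germI[OF *(3) V0(1) *(7) V0(2) *(2,4,6,1) ev(2,1)] ev])
qed

lemma holomorphic2_map_compose_germ:
  assumes F: "open U" "(0,0) \<in> U" "holomorphic2_map_on F U" "F (0,0) = (0,0)"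
    and H: "open U'" "(0,0) \<in> U'" "holomorphic2_map_on H U'"
  obtains W where "open W" "(0,0) \<in> W" "holomorphic2_map_on (\<lambda>p. H (F p)) W" "W \<subseteq> U" "F ` W \<subseteq> U'"
proof -
  have "\<forall>\<^sub>F p in nhds (0,0). p \<in> U \<and> F p \<in> U'"
    by (intro eventually_conj eventually_nhds_in_open[OF F(1,2)]
        holomorphic2_map_eventually[OF F eventually_nhds_in_open[OF H(1,2)]])
  then obtain W where W: "open W" "(0,0) \<in> W" "\<And>p. p \<in> W \<Longrightarrow> p \<in> U \<and> F p \<in> U'"
    unfolding eventually_nhds by blast
  have FW: "holomorphic2_map_on F W" using F(3) W(3) holomorphic2_map_on_subset by blast
  have "holomorphic2_map_on (\<lambda>p. H (F p)) W"
    using holomorphic2_on_compose_map[OF _ FW, of _ U'] H(3) W(3) unfolding holomorphic2_map_on_def by blast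
  then show thesis using that W by blast
qed

lemma biholomorphism_germ_compose:
  assumes F: "biholomorphism_germ F" and H: "biholomorphism_germ H"
  shows "biholomorphism_germ (\<lambda>p. H (F p))"
proof -
  obtain F' where F': "biholomorphism_germ F'" "\<forall>\<^sub>F p in nhds (0,0). F' (F p) = p" "\<forall>\<^sub>F p in nhds (0,0). F (F' p) = p"
    by (rule biholomorphism_germ_inverse[OF F])
  obtain H' where H': "biholomorphism_germ H'" "\<forall>\<^sub>F p in nhds (0,0). H' (H p) = p" "\<forall>\<^sub>F p in nhds (0,0). H (H' p) = p"
    by (rule biholomorphism_germ_inverse[OF H])
  have comp: "\<exists>W. open W \<and> (0,0) \<in> W \<and> holomorphic2_map_on (\<lambda>p. K (J p)) W" "J (0,0) = (0,0)"
    if J: "biholomorphism_germ J" and K: "biholomorphism_germ K" for J K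
  proof -
    obtain U where U: "open U" "(0,0) \<in> U" "holomorphic2_map_on J U"
      using biholomorphism_germ_map(1)[OF J] by blast
    obtain U' where U': "open U'" "(0,0) \<in> U'" "holomorphic2_map_on K U'"
      using biholomorphism_germ_map(1)[OF K] by blast
    show J0: "J (0,0) = (0,0)" by (rule biholomorphism_germ_map(2)[OF J])
    show "\<exists>W. open W \<and> (0,0) \<in> W \<and> holomorphic2_map_on (\<lambda>p. K (J p)) W"
      by (rule holomorphic2_map_compose_germ[OF U J0 U']) blast
  qed
  obtain W W' where "open W" "(0,0) \<in> W" "holomorphic2_map_on (\<lambda>p. H (F p)) W"
    "open W'" "(0,0) \<in> W'" "holomorphic2_map_on (\<lambda>p. F' (H' p)) W'"
    using comp(1)[OF F H] comp(1)[OF H'(1) F'(1)] by blast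
  moreover have "\<forall>\<^sub>F p in nhds (0,0). F' (H' (H (F p))) = p"
    using biholomorphism_germ_eventually[OF F H'(2)] F'(2) by eventually_elim simp
  moreover have "\<forall>\<^sub>F p in nhds (0,0). H (F (F' (H' p))) = p"
    using biholomorphism_germ_eventually[OF H'(1) F'(3)] H'(3) by eventually_elim simp
  ultimately show ?thesis
    using comp(2)[OF F F] comp(2)[OF H H] comp(2)[OF F'(1) F] comp(2)[OF H'(1) F]
    by (intro biholomorphism_germI[of W _ W' "\<lambda>p. F' (H' p)"]) auto
qed

lemma analytically_equivalent_trans:
  assumes "analytically_equivalent A B" "analytically_equivalent B C"
  shows "analytically_equivalent A C"
proof -
  obtain F H where F: "biholomorphism_germ F" "\<forall>\<^sub>F p in nhds (0, 0). p \<in> A \<longleftrightarrow> F p \<in> B"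
    and H: "biholomorphism_germ H" "\<forall>\<^sub>F p in nhds (0, 0). p \<in> B \<longleftrightarrow> H p \<in> C"
    using assms unfolding analytically_equivalent_def sends_branch_def by blast
  have "\<forall>\<^sub>F p in nhds (0, 0). p \<in> A \<longleftrightarrow> H (F p) \<in> C"
    using F(2) biholomorphism_germ_eventually[OF F(1) H(2)] by eventually_elim simp
  then show ?thesis
    unfolding analytically_equivalent_def sends_branch_def
    using biholomorphism_germ_compose[OF F(1) H(1)] by blast
qed

lemma analytically_equivalent_refl: "analytically_equivalent A A"
proof -
  have "holomorphic2_map_on (\<lambda>p. p) UNIV"
    unfolding holomorphic2_map_on_def using holomorphic2_on_fst holomorphic2_on_snd by simp
  then have "biholomorphism_germ (\<lambda>p. p)"
    by (intro biholomorphism_germI[of UNIV _ UNIV "\<lambda>p. p"]) auto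
  then show ?thesis unfolding analytically_equivalent_def sends_branch_def by auto
qed

section \<open>Invariance of the semigroup and of the contact orders\<close>

text \<open>Functions and forms pull back along \<open>G\<close>, and on the curves this amounts to
  the substitution of \<open>\<rho>\<close>. As \<open>\<rho>\<close> has order 1, the substitution
  preserves orders, and the extra factor \<open>deriv \<rho>\<close> for forms does not vanish at 0.
  The opposite inclusion comes from the inverse germ.\<close>

lemma invariants_subset:
  assumes \<phi>: "curve_germ \<phi>" and \<psi>: "curve_germ \<psi>" and G: "biholomorphism_germ G"
    and \<rho>: "\<rho> analytic_on {0}" "\<rho> 0 = 0" "deriv \<rho> 0 \<noteq> 0"
    and eq: "\<forall>\<^sub>F t in nhds 0. G (\<psi> t) = \<phi> (\<rho> t)"
  shows "branch_semigroup \<phi> \<subseteq> branch_semigroup \<psi>" "contact_orders \<phi> \<subseteq> contact_orders \<psi>"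
proof -
  obtain U where U: "open U" "(0,0) \<in> U" "holomorphic2_map_on G U"
    using biholomorphism_germ_map(1)[OF G] by blast
  note U = U biholomorphism_germ_map(2)[OF G]
  define R where "R = fps_expansion \<rho> 0"
  have R: "\<rho> has_fps_expansion R" unfolding R_def by (rule analytic_at_imp_has_fps_expansion_0[OF \<rho>(1)])
  have R0: "fps_nth R 0 = 0" using has_fps_expansion_nth_0[OF R] \<rho>(2) by simp
  have R1: "fps_nth R 1 \<noteq> 0" using fps_nth_fps_expansion[OF R, of 1] \<rho>(3) by simp
  have Rn: "R \<noteq> 0" using R1 by auto
  have sR: "subdegree R = 1" using R0 R1 by (intro subdegreeI) auto
  have Gc: "\<exists>W. open W \<and> (0,0) \<in> W \<and> W \<subseteq> U \<and> holomorphic2_on (\<lambda>p. f (G p)) W" if f: "holomorphic2_germ f" for f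
  proof -
    obtain V where V: "open V" "(0,0) \<in> V" "holomorphic2_on f V" using f unfolding holomorphic2_germ_def by blast
    have "\<forall>\<^sub>F p in nhds (0,0). p \<in> U \<and> G p \<in> V"
      by (intro eventually_conj eventually_nhds_in_open[OF U(1,2)]
        holomorphic2_map_eventually[OF U eventually_nhds_in_open[OF V(1,2)]])
    then obtain W where W: "open W" "(0,0) \<in> W" "\<And>p. p \<in> W \<Longrightarrow> p \<in> U \<and> G p \<in> V"
      unfolding eventually_nhds by blast
    have GW: "holomorphic2_map_on G W" using U(3) W(3) holomorphic2_map_on_subset by blast
    show ?thesis
      using holomorphic2_on_compose_map[OF V(3) GW] W by blast
  qed
  have Rto0: "\<forall>\<^sub>F t in nhds 0. P (\<rho> t)" if "\<forall>\<^sub>F t in nhds 0. P t" for P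
  proof -
    have "filterlim \<rho> (nhds 0) (nhds 0)"
      using isCont_tendsto_nhds[OF analytic_at_imp_isCont[OF \<rho>(1)]] \<rho>(2) by simp
    then show ?thesis using that by (simp add: filterlim_iff)
  qed
  show "branch_semigroup \<phi> \<subseteq> branch_semigroup \<psi>"
  proof
    fix e assume "e \<in> branch_semigroup \<phi>"
    then obtain f F where f: "holomorphic2_germ f" "(\<lambda>t. f (\<phi> t)) has_fps_expansion F" "F \<noteq> 0" "subdegree F = e"
      unfolding branch_semigroup_iff[OF \<phi>] by blast
    have "((\<lambda>t. f (\<phi> t)) \<circ> \<rho>) has_fps_expansion (F oo R)"
      by (rule has_fps_expansion_compose[OF f(2) R R0])
    moreover have "\<forall>\<^sub>F t in nhds 0. ((\<lambda>t. f (\<phi> t)) \<circ> \<rho>) t = f (G (\<psi> t))"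
      using eq by eventually_elim simp
    ultimately have "(\<lambda>t. f (G (\<psi> t))) has_fps_expansion (F oo R)" by (rule has_fps_expansion_transfer)
    moreover have "subdegree (F oo R) = e" using sR R0 f(4) by simp
    moreover have "F oo R \<noteq> 0" using f(3) Rn R0 by (simp add: fps_compose_eq_0_iff) 
    moreover have "holomorphic2_germ (\<lambda>p. f (G p))" using Gc[OF f(1)] unfolding holomorphic2_germ_def by blast
    ultimately show "e \<in> branch_semigroup \<psi>" unfolding branch_semigroup_iff[OF \<psi>] by blast
  qed
  show "contact_orders \<phi> \<subseteq> contact_orders \<psi>"
  proof
    fix w assume "w \<in> contact_orders \<phi>"
    then obtain A B F where f: "holomorphic2_germ A" "holomorphic2_germ B"
      "form_pullback \<phi> A B has_fps_expansion F" "F \<noteq> 0" "subdegree F + 1 = w"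
      unfolding contact_orders_iff[OF \<phi>] by blast
    let ?G1 = "\<lambda>p. fst (G p)" let ?G2 = "\<lambda>p. snd (G p)"
    have G12: "holomorphic2_on ?G1 U" "holomorphic2_on ?G2 U" using U(3) unfolding holomorphic2_map_on_def by auto
    \<comment> \<open>\<open>A' dx + B' dy\<close> is the pullback of \<open>A dx + B dy\<close> by
      \<open>G\<close>.\<close>
    define A' where "A' = (\<lambda>p. A (G p) * partial1 ?G1 p + B (G p) * partial1 ?G2 p)"
    define B' where "B' = (\<lambda>p. A (G p) * partial2 ?G1 p + B (G p) * partial2 ?G2 p)"
    obtain W1 where W1: "open W1" "(0,0) \<in> W1" "W1 \<subseteq> U" "holomorphic2_on (\<lambda>p. A (G p)) W1" using Gc[OF f(1)] by blast
    obtain W2 where W2: "open W2" "(0,0) \<in> W2" "W2 \<subseteq> U" "holomorphic2_on (\<lambda>p. B (G p)) W2" using Gc[OF f(2)] by blast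
    have sub: "holomorphic2_on g (W1 \<inter> W2)" if "holomorphic2_on g W1 \<or> holomorphic2_on g W2 \<or> holomorphic2_on g U" for g
      using that W1 W2 holomorphic2_on_subset by (meson Int_lower1 Int_lower2 subset_trans)
    have "holomorphic2_on A' (W1 \<inter> W2)" "holomorphic2_on B' (W1 \<inter> W2)"
      unfolding A'_def B'_def
      by (intro holomorphic2_on_add holomorphic2_on_mult;
          rule sub; use W1 W2 holomorphic2_on_partial1[OF U(1)] holomorphic2_on_partial2[OF U(1)] G12 in blast)+
    then have AB': "holomorphic2_germ A'" "holomorphic2_germ B'"
      unfolding holomorphic2_germ_def using W1 W2 by (intro exI[of _ "W1 \<inter> W2"]; auto)+
    obtain r1 where r1: "0 < r1" "(\<lambda>t. fst (\<psi> t)) holomorphic_on ball 0 r1"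
      using \<psi> unfolding curve_germ_def by (auto elim: analytic_at_0_ball)
    obtain r2 where r2: "0 < r2" "(\<lambda>t. snd (\<psi> t)) holomorphic_on ball 0 r2"
      using \<psi> unfolding curve_germ_def by (auto elim: analytic_at_0_ball)
    obtain r3 where r3: "0 < r3" "(\<lambda>t. fst (\<phi> t)) holomorphic_on ball 0 r3"
      using \<phi> unfolding curve_germ_def by (auto elim: analytic_at_0_ball)
    obtain r4 where r4: "0 < r4" "(\<lambda>t. snd (\<phi> t)) holomorphic_on ball 0 r4"
      using \<phi> unfolding curve_germ_def by (auto elim: analytic_at_0_ball)
    obtain r5 where r5: "0 < r5" "\<rho> holomorphic_on ball 0 r5" using \<rho>(1) by (rule analytic_at_0_ball)
    have "\<forall>\<^sub>F t in nhds 0. t \<in> ball 0 r1 \<and> t \<in> ball 0 r2 \<and> t \<in> ball 0 r5 \<and> \<rho> t \<in> ball 0 r3 \<and> \<rho> t \<in> ball 0 r4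
        \<and> \<psi> t \<in> U"
      by (intro eventually_conj Rto0 curve_germ_eventually[OF \<psi> eventually_nhds_in_open[OF U(1,2)]]
        eventually_nhds_in_open) (use r1 r2 r3 r4 r5 in auto)
    \<comment> \<open>Differentiating the identity at \<open>t\<close> requires it in a
      neighbourhood of \<open>t\<close>, not only at \<open>t\<close>.\<close>
    moreover have "\<forall>\<^sub>F t in nhds 0. \<forall>\<^sub>F u in nhds t. G (\<psi> u) = \<phi> (\<rho> u)"
      using eq by (simp add: eventually_eventually)
    ultimately have pb: "\<forall>\<^sub>F t in nhds 0. form_pullback \<psi> A' B' t = form_pullback \<phi> A B (\<rho> t) * deriv \<rho> t"
    proof eventually_elim
      case (elim t)
      define u' v' x' y' d where "u' = deriv (\<lambda>t. fst (\<psi> t)) t" "v' = deriv (\<lambda>t. snd (\<psi> t)) t"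
        "x' = deriv (\<lambda>t. fst (\<phi> t)) (\<rho> t)" "y' = deriv (\<lambda>t. snd (\<phi> t)) (\<rho> t)" "d = deriv \<rho> t"
      note defs = this
      have du: "((\<lambda>t. fst (\<psi> t)) has_field_derivative u') (at t)" "((\<lambda>t. snd (\<psi> t)) has_field_derivative v') (at t)"
        "((\<lambda>t. fst (\<phi> t)) has_field_derivative x') (at (\<rho> t))" "((\<lambda>t. snd (\<phi> t)) has_field_derivative y') (at (\<rho> t))"
        "(\<rho> has_field_derivative d) (at t)"
        unfolding defs using elim r1(2) r2(2) r3(2) r4(2) r5(2) by (auto intro: holomorphic_derivI)
      have ev: "\<forall>\<^sub>F u in nhds t. G (\<psi> u) = \<phi> (\<rho> u)" using elim by blast
      have Gp: "(?G1 has_derivative (\<lambda>h. partial1 ?G1 (\<psi> t) * fst h + partial2 ?G1 (\<psi> t) * snd h)) (at (fst (\<psi> t), snd (\<psi> t)))"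
        "(?G2 has_derivative (\<lambda>h. partial1 ?G2 (\<psi> t) * fst h + partial2 ?G2 (\<psi> t) * snd h)) (at (fst (\<psi> t), snd (\<psi> t)))"
        using holomorphic2_on_has_derivative[OF G12(1)] holomorphic2_on_has_derivative[OF G12(2)] elim by auto
      have 1: "((\<lambda>u. fst (G (\<psi> u))) has_field_derivative partial1 ?G1 (\<psi> t) * u' + partial2 ?G1 (\<psi> t) * v') (at t)"
        "((\<lambda>u. snd (G (\<psi> u))) has_field_derivative partial1 ?G2 (\<psi> t) * u' + partial2 ?G2 (\<psi> t) * v') (at t)"
        using has_field_derivative_compose_curve[OF Gp(1) du(1,2)] has_field_derivative_compose_curve[OF Gp(2) du(1,2)] by simp_all
      have 2: "((\<lambda>u. fst (\<phi> (\<rho> u))) has_field_derivative x' * d) (at t)"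
        "((\<lambda>u. snd (\<phi> (\<rho> u))) has_field_derivative y' * d) (at t)"
        using DERIV_chain2[OF du(3,5)] DERIV_chain2[OF du(4,5)] by simp_all
      have ev12: "\<forall>\<^sub>F u in nhds t. fst (G (\<psi> u)) = fst (\<phi> (\<rho> u))" "\<forall>\<^sub>F u in nhds t. snd (G (\<psi> u)) = snd (\<phi> (\<rho> u))"
        using ev by (auto elim: eventually_mono)
      have "((\<lambda>u. fst (G (\<psi> u))) has_field_derivative x' * d) (at t)"
        "((\<lambda>u. snd (G (\<psi> u))) has_field_derivative y' * d) (at t)"
        using 2 DERIV_cong_ev[OF refl ev12(1) refl] DERIV_cong_ev[OF refl ev12(2) refl] by simp_all
      with 1 have e: "partial1 ?G1 (\<psi> t) * u' + partial2 ?G1 (\<psi> t) * v' = x' * d"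
        "partial1 ?G2 (\<psi> t) * u' + partial2 ?G2 (\<psi> t) * v' = y' * d" by (blast intro: DERIV_unique)+
      have "G (\<psi> t) = \<phi> (\<rho> t)" using ev eventually_nhds_x_imp_x by blast
      moreover have "form_pullback \<psi> A' B' t = A (G (\<psi> t)) * (partial1 ?G1 (\<psi> t) * u' + partial2 ?G1 (\<psi> t) * v')
         + B (G (\<psi> t)) * (partial1 ?G2 (\<psi> t) * u' + partial2 ?G2 (\<psi> t) * v')"
        by (simp add: form_pullback_def A'_def B'_def defs algebra_simps)
      ultimately show ?case unfolding e by (simp add: form_pullback_def defs algebra_simps)
    qed
    have "(\<lambda>t. (form_pullback \<phi> A B \<circ> \<rho>) t * deriv \<rho> t) has_fps_expansion (F oo R) * fps_deriv R"
      by (intro has_fps_expansion_mult has_fps_expansion_compose[OF f(3) R R0] has_fps_expansion_deriv R)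
    moreover have "\<forall>\<^sub>F t in nhds 0. (form_pullback \<phi> A B \<circ> \<rho>) t * deriv \<rho> t = form_pullback \<psi> A' B' t"
      using pb by eventually_elim simp
    ultimately have fp: "form_pullback \<psi> A' B' has_fps_expansion (F oo R) * fps_deriv R"
      by (rule has_fps_expansion_transfer)
    have FR: "F oo R \<noteq> 0" using f(4) Rn R0 by (simp add: fps_compose_eq_0_iff)
    have dR: "fps_nth (fps_deriv R) 0 \<noteq> 0" using R1 by simp
    then have dR': "fps_deriv R \<noteq> 0" "subdegree (fps_deriv R) = 0" by (metis fps_zero_nth, simp add: subdegree_eq_0)
    have "subdegree ((F oo R) * fps_deriv R) + 1 = w" using FR dR' sR R0 f(5) by simp
    then show "w \<in> contact_orders \<psi>"
      unfolding contact_orders_iff[OF \<psi>] using AB' fp FR dR'(1) by (metis mult_eq_0_iff)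
  qed
qed

section \<open>Flows of polynomial vector fields\<close>

lemma monomial_lipschitz:
  fixes x x' y y' :: complex
  assumes "norm x \<le> r" "norm x' \<le> r" "norm y \<le> r" "norm y' \<le> r" "norm (x - x') \<le> D" "norm (y - y') \<le> D"
  shows "norm (x ^ i * y ^ j - x' ^ i * y' ^ j) \<le> real (i + j) * r ^ (i + j - 1) * D"
proof -
  have r: "0 \<le> r" using assms(1) norm_ge_zero order_trans by blast
  have D: "0 \<le> D" using assms(5) norm_ge_zero order_trans by blast
  have step: "norm (u * M - u' * M') \<le> real (Suc d) * r ^ d * D"
    if "norm u \<le> r" "norm (u - u') \<le> D" "norm M' \<le> r ^ d" "norm (M - M') \<le> real d * r ^ (d - 1) * D"
    for u u' M M' :: complex and d
  proof -
    have "u * M - u' * M' = u * (M - M') + (u - u') * M'" by (simp add: algebra_simps)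
    also have "norm \<dots> \<le> r * (real d * r ^ (d - 1) * D) + D * r ^ d"
      using that r D by (intro norm_triangle_le add_mono) (auto simp: norm_mult intro!: mult_mono)
    also have "\<dots> = real (Suc d) * r ^ d * D" by (cases d) (auto simp: algebra_simps)
    finally show ?thesis .
  qed
  have nm: "norm (x' ^ i * y' ^ j) \<le> r ^ (i + j)" for i j
    unfolding norm_mult norm_power power_add using assms r by (intro mult_mono power_mono) auto
  have y: "norm (y ^ j - y' ^ j) \<le> real j * r ^ (j - 1) * D"
  proof (induction j)
    case (Suc j)
    show ?case using step[OF assms(3,6) _ Suc] nm[of 0 j] by simp
  qed simp
  show ?thesis
  proof (induction i)
    case 0
    then show ?case using y by simp
  next
    case (Suc i)
    show ?case using step[OF assms(1,5) nm Suc] by (simp add: mult.assoc)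
  qed
qed

definition poly2_lip :: "nat \<Rightarrow> (nat \<Rightarrow> nat \<Rightarrow> complex) \<Rightarrow> real"
  where "poly2_lip N c = (\<Sum>i<N. \<Sum>j<N. norm (c i j) * real (i + j))"

lemma poly2_lip_nonneg: "0 \<le> poly2_lip N c"
  unfolding poly2_lip_def by (intro sum_nonneg) auto

text \<open>One estimate for two purposes: \<open>l = 1\<close> on the unit ball, and
  \<open>l = r\<close> for a polynomial without linear terms, where the gained factor
  \<open>r\<close> reflects the second order of vanishing.\<close>

lemma poly2_lipschitz_gen:
  assumes pq: "norm p \<le> r" "norm q \<le> r"
    and l: "\<And>i j. c i j \<noteq> 0 \<Longrightarrow> 1 \<le> i + j \<Longrightarrow> r ^ (i + j - 1) \<le> l" and "0 \<le> l"
  shows "norm (poly2 N c p - poly2 N c q) \<le> poly2_lip N c * l * norm (p - q)"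
proof -
  have "norm (fst p) \<le> r" "norm (snd p) \<le> r" "norm (fst q) \<le> r" "norm (snd q) \<le> r"
    using pq norm_fst_le' norm_snd_le' order_trans by blast+
  moreover have "norm (fst p - fst q) \<le> norm (p - q)" "norm (snd p - snd q) \<le> norm (p - q)"
    using norm_fst_le'[of "p - q"] norm_snd_le'[of "p - q"] by auto
  ultimately have m: "norm (fst p ^ i * snd p ^ j - fst q ^ i * snd q ^ j)
      \<le> real (i + j) * r ^ (i + j - 1) * norm (p - q)" for i j
    by (intro monomial_lipschitz)
  have t: "norm (c i j * (fst p ^ i * snd p ^ j - fst q ^ i * snd q ^ j)) \<le> norm (c i j) * real (i + j) * l * norm (p - q)" for i j
  proof (cases "c i j = 0 \<or> i + j = 0")
    case False
    have "norm (c i j * (fst p ^ i * snd p ^ j - fst q ^ i * snd q ^ j)) \<le> norm (c i j) * (real (i + j) * r ^ (i + j - 1) * norm (p - q))"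
      unfolding norm_mult by (intro mult_left_mono m) auto
    also have "\<dots> \<le> norm (c i j) * (real (i + j) * l * norm (p - q))"
      using False l by (intro mult_left_mono mult_right_mono) auto
    finally show ?thesis by (simp add: mult_ac)
  qed auto
  have "poly2 N c p - poly2 N c q = (\<Sum>i<N. \<Sum>j<N. c i j * (fst p ^ i * snd p ^ j - fst q ^ i * snd q ^ j))"
    unfolding poly2_def by (simp add: sum_subtractf right_diff_distrib)
  also have "norm \<dots> \<le> (\<Sum>i<N. \<Sum>j<N. norm (c i j) * real (i + j) * l * norm (p - q))"
    by (intro sum_norm_le t)
  also have "\<dots> = poly2_lip N c * l * norm (p - q)"
    unfolding poly2_lip_def by (simp add: sum_distrib_right)
  finally show ?thesis .
qed

lemma poly2_lipschitz:
  assumes "norm p \<le> 1" "norm q \<le> 1"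
  shows "norm (poly2 N c p - poly2 N c q) \<le> poly2_lip N c * norm (p - q)"
  using poly2_lipschitz_gen[of p 1 q c 1] assms by simp

lemma poly2_lipschitz_order2:
  assumes "norm p \<le> r" "norm q \<le> r" "r \<le> 1" "c 0 1 = 0" "c 1 0 = 0"
  shows "norm (poly2 N c p - poly2 N c q) \<le> poly2_lip N c * r * norm (p - q)"
proof -
  have r: "0 \<le> r" using assms(1) norm_ge_zero order_trans by blast
  show ?thesis
  proof (rule poly2_lipschitz_gen[OF assms(1,2) _ r])
    fix i j assume c: "c i j \<noteq> 0" "1 \<le> i + j"
    have "i + j \<noteq> 1"
    proof
      assume "i + j = 1"
      then have "(i = 0 \<and> j = 1) \<or> (i = 1 \<and> j = 0)" by auto
      with c(1) assms(4,5) show False by auto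
    qed
    with c obtain d where "i + j - 1 = Suc d" by (cases "i + j - 1") auto
    then show "r ^ (i + j - 1) \<le> r" using r assms(3) by (simp add: mult_left_le power_le_one)
  qed
qed

lemma poly2_at_0: "0 < N \<Longrightarrow> poly2 N c (0, 0) = c 0 0"
proof -
  assume "0 < N"
  have "poly2 N c (0,0) = (\<Sum>i<N. \<Sum>j<N. if j = 0 then (if i = 0 then c 0 0 else 0) else 0)"
    unfolding poly2_def by (intro sum.cong) (auto simp: power_0_left)
  also have "\<dots> = c 0 0" using \<open>0 < N\<close> by simp
  finally show ?thesis .
qed

text \<open>The bound on the velocity is integrated along the segment from 0 to \<open>z\<close>.
  Each application raises the exponent by one and divides by the new exponent, which is where the
  factorials in the Picard and uniqueness estimates arise.\<close>

lemma norm_integral_curve_le: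
  fixes f v :: "complex \<Rightarrow> complex \<times> complex"
  assumes der: "\<And>z. z \<in> ball 0 R \<Longrightarrow> ((\<lambda>w. fst (f w)) has_field_derivative fst (v z)) (at z)"
      "\<And>z. z \<in> ball 0 R \<Longrightarrow> ((\<lambda>w. snd (f w)) has_field_derivative snd (v z)) (at z)"
    and 0: "f 0 = 0" and bound: "\<And>z. z \<in> ball 0 R \<Longrightarrow> norm (v z) \<le> C * norm z ^ j"
    and z: "z \<in> ball 0 R"
  shows "norm (f z) \<le> C * norm z ^ Suc j / real (Suc j)"
proof -
  let ?z = "\<lambda>u::real. complex_of_real u * z"
  have inb: "?z u \<in> ball 0 R" if "0 \<le> u" "u \<le> 1" for u
    using that z mult_left_le_one_le[of "norm z" u] by (simp add: norm_mult)
  have line: "(?z has_vector_derivative z) (at u)" for u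
    by (auto intro!: derivative_eq_intros simp: has_vector_derivative_def scaleR_conv_of_real)
  have g: "((\<lambda>u. f (?z u)) has_vector_derivative (z * fst (v (?z u)), z * snd (v (?z u)))) (at u)"
    if u: "0 \<le> u" "u \<le> 1" for u
  proof -
    have "((\<lambda>u. fst (f (?z u))) has_vector_derivative (z * fst (v (?z u)))) (at u)"
      "((\<lambda>u. snd (f (?z u))) has_vector_derivative (z * snd (v (?z u)))) (at u)"
      using field_vector_diff_chain_at[OF line der(1)[OF inb[OF u]]]
        field_vector_diff_chain_at[OF line der(2)[OF inb[OF u]]] by (simp_all add: o_def)
    from has_vector_derivative_Pair[OF this] show ?thesis by simp
  qed
  define \<phi> where "\<phi> = (\<lambda>u::real. C * norm z ^ Suc j / real (Suc j) * u ^ Suc j)"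
  have "norm (f (?z 1) - f (?z 0)) \<le> \<phi> 1 - \<phi> 0"
  proof (rule differentiable_bound_general[where f' = "\<lambda>u. (z * fst (v (?z u)), z * snd (v (?z u)))"
        and \<phi>' = "\<lambda>u. C * norm z ^ Suc j * u ^ j"])
    show "continuous_on {0..1} (\<lambda>u. f (?z u))"
      by (intro continuous_at_imp_continuous_on ballI has_vector_derivative_continuous[OF g]) auto
    show "continuous_on {0..1} \<phi>" unfolding \<phi>_def by (intro continuous_intros)
    fix u :: real assume u: "0 < u" "u < 1"
    then show "((\<lambda>u. f (?z u)) has_vector_derivative (z * fst (v (?z u)), z * snd (v (?z u)))) (at u)"
      by (intro g) auto
    have "(\<phi> has_real_derivative C * norm z ^ Suc j * u ^ j) (at u)"
      unfolding \<phi>_def by (auto intro!: derivative_eq_intros simp del: of_nat_Suc power_Suc)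
    then show "(\<phi> has_vector_derivative C * norm z ^ Suc j * u ^ j) (at u)"
      by (simp add: has_real_derivative_iff_has_vector_derivative)
    have "norm (z * fst (v (?z u)), z * snd (v (?z u))) = norm z * norm (v (?z u))"
      by (simp add: norm_prod_def norm_mult power_mult_distrib flip: distrib_left real_sqrt_mult)
        (metis abs_norm_cancel norm_mult real_sqrt_abs real_sqrt_mult norm_ge_zero)
    also have "\<dots> \<le> norm z * (C * norm (?z u) ^ j)"
      using u by (intro mult_left_mono bound inb) auto
    also have "\<dots> = C * norm z ^ Suc j * u ^ j"
      using u by (simp add: norm_mult power_mult_distrib)
    finally show "norm (z * fst (v (?z u)), z * snd (v (?z u))) \<le> C * norm z ^ Suc j * u ^ j" .
  qed auto
  then show ?thesis by (simp add: \<phi>_def 0)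
qed

text \<open>Polynomials in the time with entire coefficients. The Picard iterates of a polynomial vector
  field are of this form, so that their primitives are explicit.\<close>

inductive time_poly :: "(complex \<times> complex \<Rightarrow> complex \<Rightarrow> complex) \<Rightarrow> bool" where
  monom: "holomorphic2_on c UNIV \<Longrightarrow> time_poly (\<lambda>p z. c p * z ^ e)"
| add: "time_poly f \<Longrightarrow> time_poly g \<Longrightarrow> time_poly (\<lambda>p z. f p z + g p z)"

lemma time_poly_const: "holomorphic2_on c UNIV \<Longrightarrow> time_poly (\<lambda>p z. c p)"
  using time_poly.monom[of c 0] by simp

lemma time_poly_mult:
  assumes "time_poly f" "time_poly g"
  shows "time_poly (\<lambda>p z. f p z * g p z)"
  using assms
proof (induction rule: time_poly.induct)
  case (monom c e)
  from monom(2) monom(1) show ?case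
  proof (induction rule: time_poly.induct)
    case (monom c' e')
    have "time_poly (\<lambda>p z. (c p * c' p) * z ^ (e + e'))"
      by (intro time_poly.monom holomorphic2_on_mult monom)
    then show ?case by (simp add: power_add mult_ac)
  next
    case (add f g)
    then show ?case using time_poly.add[of "\<lambda>p z. c p * z ^ e * f p z" "\<lambda>p z. c p * z ^ e * g p z"]
      by (simp add: distrib_left)
  qed
next
  case (add f h)
  then show ?case using time_poly.add[of "\<lambda>p z. f p z * g p z" "\<lambda>p z. h p z * g p z"]
    by (simp add: distrib_right)
qed

lemma time_poly_power: "time_poly f \<Longrightarrow> time_poly (\<lambda>p z. f p z ^ i)"
  by (induction i) (auto intro: time_poly_mult time_poly_const holomorphic2_on_const)

lemma time_poly_sum: "finite I \<Longrightarrow> (\<And>i. i \<in> I \<Longrightarrow> time_poly (f i)) \<Longrightarrow> time_poly (\<lambda>p z. \<Sum>i\<in>I. f i p z)"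
proof (induction I rule: finite_induct)
  case (insert x F)
  then show ?case using time_poly.add[of "f x" "\<lambda>p z. \<Sum>i\<in>F. f i p z"] by simp
qed (auto intro: time_poly_const holomorphic2_on_const)

lemma time_poly_poly2:
  assumes "time_poly (\<lambda>p z. fst (\<gamma> p z))" "time_poly (\<lambda>p z. snd (\<gamma> p z))"
  shows "time_poly (\<lambda>p z. poly2 N c (\<gamma> p z))"
  unfolding poly2_def
  by (intro time_poly_sum time_poly_mult time_poly_power assms)
    (auto intro: time_poly_const holomorphic2_on_const)

lemma time_poly_primitive:
  assumes "time_poly f"
  shows "\<exists>F. time_poly F \<and> (\<forall>p. F p 0 = 0) \<and> (\<forall>p z. (F p has_field_derivative f p z) (at z))"
  using assms
proof (induction rule: time_poly.induct)
  case (monom c e)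
  let ?F = "\<lambda>p z. (c p * (1 / of_nat (Suc e))) * z ^ Suc e"
  have "time_poly ?F" by (intro time_poly.monom holomorphic2_on_mult monom holomorphic2_on_const)
  moreover have "(?F p has_field_derivative c p * z ^ e) (at z)" for p z
    by (auto intro!: derivative_eq_intros simp del: of_nat_Suc power_Suc)
  ultimately show ?case by (intro exI[of _ ?F]) simp
next
  case (add f g)
  then obtain F G where "time_poly F" "\<forall>p. F p 0 = 0" "\<forall>p z. (F p has_field_derivative f p z) (at z)"
    "time_poly G" "\<forall>p. G p 0 = 0" "\<forall>p z. (G p has_field_derivative g p z) (at z)" by blast
  then show ?case
    by (intro exI[of _ "\<lambda>p z. F p z + G p z"]) (auto intro!: time_poly.add DERIV_add)
qed

lemma time_poly_holomorphic2: "time_poly f \<Longrightarrow> holomorphic2_on (\<lambda>p. f p z) U"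
proof (induction rule: time_poly.induct)
  case (monom c e)
  then show ?case by (intro holomorphic2_on_mult holomorphic2_on_const) (blast intro: holomorphic2_on_subset)
qed (intro holomorphic2_on_add)

definition solves_on :: "(complex \<times> complex \<Rightarrow> complex \<times> complex) \<Rightarrow> (complex \<Rightarrow> complex \<times> complex) \<Rightarrow> complex set \<Rightarrow> bool"
  where "solves_on X \<gamma> S \<longleftrightarrow> (\<forall>z\<in>S. ((\<lambda>w. fst (\<gamma> w)) has_field_derivative fst (X (\<gamma> z))) (at z) \<and>
    ((\<lambda>w. snd (\<gamma> w)) has_field_derivative snd (X (\<gamma> z))) (at z))"

text \<open>The origin is an equilibrium. Hence orbits of sufficiently small points exist on a time
  disc of any prescribed radius and stay small, so that the time-\<open>s\<close> map is a germ at
  the origin for every \<open>s\<close>.\<close>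

locale poly_field =
  fixes N :: nat and a b :: "nat \<Rightarrow> nat \<Rightarrow> complex"
  assumes N: "0 < N" and a0: "a 0 0 = 0" and b0: "b 0 0 = 0"
begin

definition X :: "complex \<times> complex \<Rightarrow> complex \<times> complex"
  where "X p = (poly2 N a p, poly2 N b p)"

definition L :: real where "L = poly2_lip N a + poly2_lip N b"

lemma L_nonneg: "0 \<le> L"
  unfolding L_def using poly2_lip_nonneg by (simp add: add_nonneg_nonneg)

lemma X_lipschitz:
  assumes "norm p \<le> 1" "norm q \<le> 1"
  shows "norm (X p - X q) \<le> L * norm (p - q)"
proof -
  have "norm (X p - X q) \<le> norm (poly2 N a p - poly2 N a q) + norm (poly2 N b p - poly2 N b q)"
    using norm_Pair_le[of "poly2 N a p - poly2 N a q" "poly2 N b p - poly2 N b q"] by (simp add: X_def)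
  also have "\<dots> \<le> L * norm (p - q)"
    unfolding L_def distrib_right by (intro add_mono poly2_lipschitz assms)
  finally show ?thesis .
qed

lemma X_0: "X 0 = 0"
  using N a0 b0 poly2_at_0[of N a] poly2_at_0[of N b] by (simp add: X_def zero_prod_def)

lemma holomorphic2_X: "holomorphic2_map_on X U"
  unfolding holomorphic2_map_on_def X_def by (simp add: holomorphic2_on_poly2)

lemma isCont_X: "isCont (\<lambda>p. fst (X p)) p" "isCont (\<lambda>p. snd (X p)) p"
  using holomorphic2_X[of UNIV] holomorphic2_on_imp_continuous_on[of "\<lambda>p. fst (X p)" UNIV]
    holomorphic2_on_imp_continuous_on[of "\<lambda>p. snd (X p)" UNIV]
    continuous_on_eq_continuous_at[OF open_UNIV]
  unfolding holomorphic2_map_on_def by blast+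

text \<open>Starting from the trivial bound 2, the Lipschitz inequality is integrated repeatedly;
  the resulting bounds \<open>2 * (L * norm z)^j / fact j\<close> tend to 0. Both solutions are
  confined to the unit ball, where \<open>L\<close> is a Lipschitz constant.\<close>

lemma flow_unique:
  assumes s: "solves_on X \<gamma>1 (ball 0 R)" "solves_on X \<gamma>2 (ball 0 R)" and 0: "\<gamma>1 0 = \<gamma>2 0"
    and b: "\<And>z. z \<in> ball 0 R \<Longrightarrow> norm (\<gamma>1 z) \<le> 1" "\<And>z. z \<in> ball 0 R \<Longrightarrow> norm (\<gamma>2 z) \<le> 1"
    and z: "z \<in> ball 0 R"
  shows "\<gamma>1 z = \<gamma>2 z"
proof -
  have est: "norm (\<gamma>1 z - \<gamma>2 z) \<le> 2 * L ^ j / fact j * norm z ^ j" if "z \<in> ball 0 R" for z j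
    using that
  proof (induction j arbitrary: z)
    case 0
    then show ?case using b[of z] norm_triangle_ineq4[of "\<gamma>1 z" "\<gamma>2 z"] by simp
  next
    case (Suc j)
    have "norm (\<gamma>1 z - \<gamma>2 z) \<le> (L * (2 * L ^ j / fact j)) * norm z ^ Suc j / real (Suc j)"
    proof (rule norm_integral_curve_le[where v = "\<lambda>z. X (\<gamma>1 z) - X (\<gamma>2 z)" and f = "\<lambda>z. \<gamma>1 z - \<gamma>2 z"])
      fix w :: complex assume w: "w \<in> ball 0 R"
      show "((\<lambda>w. fst (\<gamma>1 w - \<gamma>2 w)) has_field_derivative fst (X (\<gamma>1 w) - X (\<gamma>2 w))) (at w)"
        "((\<lambda>w. snd (\<gamma>1 w - \<gamma>2 w)) has_field_derivative snd (X (\<gamma>1 w) - X (\<gamma>2 w))) (at w)"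
        using s w unfolding solves_on_def by (auto intro!: DERIV_diff)
      have "norm (X (\<gamma>1 w) - X (\<gamma>2 w)) \<le> L * norm (\<gamma>1 w - \<gamma>2 w)" by (intro X_lipschitz b w)
      also have "\<dots> \<le> L * (2 * L ^ j / fact j * norm w ^ j)" by (intro mult_left_mono Suc.IH w L_nonneg)
      finally show "norm (X (\<gamma>1 w) - X (\<gamma>2 w)) \<le> L * (2 * L ^ j / fact j) * norm w ^ j" by (simp add: mult_ac)
    qed (use 0 Suc.prems in auto)
    also have "\<dots> = 2 * L ^ Suc j / fact (Suc j) * norm z ^ Suc j" by (simp add: field_simps)
    finally show ?case .
  qed
  have "(\<lambda>j. 2 * ((L * norm z) ^ j /\<^sub>R fact j)) \<longlonglongrightarrow> 2 * 0"
    by (intro tendsto_mult tendsto_const summable_LIMSEQ_zero summable_exp_generic)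
  then have lim: "(\<lambda>j. 2 * L ^ j / fact j * norm z ^ j) \<longlonglongrightarrow> 0"
    by (simp add: power_mult_distrib divide_inverse mult_ac)
  have "norm (\<gamma>1 z - \<gamma>2 z) \<le> 0"
    by (rule tendsto_lowerbound[OF lim]) (use est[OF z] in auto)
  then show ?thesis by simp
qed

text \<open>The iterates are entire in the time and in the initial point, so no domains have to be
  tracked during the construction; smallness enters only in the estimates of
  \<open>flow_exists\<close>.\<close>

lemma picard_iterates:
  obtains \<gamma> :: "nat \<Rightarrow> complex \<times> complex \<Rightarrow> complex \<Rightarrow> complex \<times> complex"
  where "\<And>p z. \<gamma> 0 p z = p" "\<And>j p. \<gamma> j p 0 = p"
    "\<And>j. time_poly (\<lambda>p z. fst (\<gamma> j p z))" "\<And>j. time_poly (\<lambda>p z. snd (\<gamma> j p z))"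
    "\<And>j p z. ((\<lambda>w. fst (\<gamma> (Suc j) p w)) has_field_derivative fst (X (\<gamma> j p z))) (at z)"
    "\<And>j p z. ((\<lambda>w. snd (\<gamma> (Suc j) p w)) has_field_derivative snd (X (\<gamma> j p z))) (at z)"
proof -
  define good where "good = (\<lambda>j (g :: complex \<times> complex \<Rightarrow> complex \<Rightarrow> complex \<times> complex).
    (j = (0::nat) \<longrightarrow> g = (\<lambda>p z. p)) \<and> (\<forall>p. g p 0 = p) \<and>
    time_poly (\<lambda>p z. fst (g p z)) \<and> time_poly (\<lambda>p z. snd (g p z)))"
  define step where "step = (\<lambda>(j::nat) g h :: complex \<times> complex \<Rightarrow> complex \<Rightarrow> complex \<times> complex.
    \<forall>p z. ((\<lambda>w. fst (h p w)) has_field_derivative fst (X (g p z))) (at z) \<and>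
      ((\<lambda>w. snd (h p w)) has_field_derivative snd (X (g p z))) (at z))"
  have "\<exists>\<gamma>. \<forall>j. good j (\<gamma> j) \<and> step j (\<gamma> j) (\<gamma> (Suc j))"
  proof (rule dependent_nat_choice)
    show "\<exists>g. good 0 g"
      unfolding good_def by (intro exI[of _ "\<lambda>p z. p"]) (auto intro: time_poly_const holomorphic2_on_fst holomorphic2_on_snd)
    fix g j assume g: "good j g"
    have "time_poly (\<lambda>p z. fst (X (g p z)))" "time_poly (\<lambda>p z. snd (X (g p z)))"
      using g time_poly_poly2[of g] unfolding good_def X_def by auto
    then obtain F G where F: "time_poly F" "\<And>p. F p 0 = 0" "\<And>p z. (F p has_field_derivative fst (X (g p z))) (at z)"
      and G: "time_poly G" "\<And>p. G p 0 = 0" "\<And>p z. (G p has_field_derivative snd (X (g p z))) (at z)"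
      using time_poly_primitive by meson
    let ?h = "\<lambda>p z. (fst p + F p z, snd p + G p z)"
    have "good (Suc j) ?h"
      unfolding good_def using F G
      by (auto intro!: time_poly.add time_poly_const holomorphic2_on_fst holomorphic2_on_snd)
    moreover have "step j g ?h"
      unfolding step_def using F(3) G(3) by (auto intro!: derivative_eq_intros)
    ultimately show "\<exists>h. good (Suc j) h \<and> step j g h" by blast
  qed
  then obtain \<gamma> where "\<And>j. good j (\<gamma> j)" "\<And>j. step j (\<gamma> j) (\<gamma> (Suc j))" by blast
  then show thesis by (intro that[of \<gamma>]) (auto simp: good_def step_def)
qed

lemma flow_exists:
  assumes R: "0 < R"
  obtains \<delta> K g where "0 < \<delta>" "1 \<le> K" "\<delta> * K \<le> 1"
    "\<And>p. norm p < \<delta> \<Longrightarrow> g p 0 = p" "\<And>p. norm p < \<delta> \<Longrightarrow> solves_on X (g p) (ball 0 R)"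
    "\<And>p z. norm p < \<delta> \<Longrightarrow> z \<in> ball 0 R \<Longrightarrow> norm (g p z) \<le> K * norm p"
    "\<And>z. z \<in> ball 0 R \<Longrightarrow> holomorphic2_map_on (\<lambda>p. g p z) (ball 0 \<delta>)"
proof -
  obtain \<gamma> :: "nat \<Rightarrow> complex \<times> complex \<Rightarrow> complex \<Rightarrow> complex \<times> complex"
    where \<gamma>0: "\<And>p z. \<gamma> 0 p z = p" and \<gamma>init: "\<And>j p. \<gamma> j p 0 = p"
      and tp: "\<And>j. time_poly (\<lambda>p z. fst (\<gamma> j p z))" "\<And>j. time_poly (\<lambda>p z. snd (\<gamma> j p z))"
      and der: "\<And>j p z. ((\<lambda>w. fst (\<gamma> (Suc j) p w)) has_field_derivative fst (X (\<gamma> j p z))) (at z)"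
      "\<And>j p z. ((\<lambda>w. snd (\<gamma> (Suc j) p w)) has_field_derivative snd (X (\<gamma> j p z))) (at z)"
    using picard_iterates by blast
  \<comment> \<open>\<open>K\<close> bounds the partial sums of \<open>exp (L * norm z)\<close> on
    the time disc. With \<open>\<delta> = 1 / K\<close> all iterates that start below norm
    \<open>\<delta>\<close> stay in the unit ball, where \<open>L\<close> applies.\<close>
  define K where "K = exp (L * R)"
  define \<delta> where "\<delta> = 1 / K"
  have K: "1 \<le> K" using L_nonneg R by (simp add: K_def)
  have \<delta>: "0 < \<delta>" "\<delta> * K \<le> 1" "\<delta> \<le> 1" using K by (auto simp: \<delta>_def)
  have partial: "(\<Sum>i\<le>j. (L * norm z) ^ i / fact i) \<le> K" if "z \<in> ball 0 R" for z :: complex and j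
  proof -
    have "(\<Sum>i\<le>j. (L * norm z) ^ i / fact i) \<le> (\<Sum>i. (L * norm z) ^ i / fact i)"
      using L_nonneg summable_exp[of "L * norm z"] by (intro sum_le_suminf) (auto simp: divide_inverse mult.commute)
    also have "\<dots> = exp (L * norm z)" by (simp add: exp_def divide_inverse mult.commute scaleR_conv_of_real)
    also have "\<dots> \<le> K" unfolding K_def using that L_nonneg by (simp add: mult_left_mono)
    finally show ?thesis .
  qed
  \<comment> \<open>The two bounds are proved together: the bound on the iterates keeps them in the
    unit ball, which the Lipschitz estimate of the increments needs.\<close>
  have est: "norm (\<gamma> j p z) \<le> norm p * (\<Sum>i\<le>j. (L * norm z) ^ i / fact i) \<and>
      norm (\<gamma> (Suc j) p z - \<gamma> j p z) \<le> norm p * (L * norm z) ^ Suc j / fact (Suc j)"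
    if p: "norm p < \<delta>" and z: "z \<in> ball 0 R" for j p z
    using z
  proof (induction j arbitrary: z)
    case 0
    have p1: "norm p \<le> 1" using p \<delta> by simp
    have "norm (\<gamma> 1 p z - p) \<le> (L * norm p) * norm z ^ Suc 0 / real (Suc 0)"
    proof (rule norm_integral_curve_le[where v = "\<lambda>z. X p" and f = "\<lambda>z. \<gamma> 1 p z - p"])
      show "((\<lambda>w. fst (\<gamma> 1 p w - p)) has_field_derivative fst (X p)) (at z)"
        "((\<lambda>w. snd (\<gamma> 1 p w - p)) has_field_derivative snd (X p)) (at z)" for z
        using der[of 0 p z] by (auto simp: \<gamma>0 intro!: derivative_eq_intros)
      show "norm (X p) \<le> L * norm p * norm z ^ 0" for z
        using X_lipschitz[OF p1, of 0] by (simp add: X_0)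
    qed (use 0 \<gamma>init in auto)
    then show ?case by (simp add: \<gamma>0 mult_ac)
  next
    case (Suc j)
    have nb: "norm (\<gamma> j p z) \<le> 1" "norm (\<gamma> (Suc j) p z) \<le> 1"
      "norm (\<gamma> (Suc j) p z) \<le> norm p * (\<Sum>i\<le>Suc j. (L * norm z) ^ i / fact i)" if "z \<in> ball 0 R" for z
    proof -
      have s: "norm p * (\<Sum>i\<le>k. (L * norm z) ^ i / fact i) \<le> 1" for k
      proof -
        have "norm p * (\<Sum>i\<le>k. (L * norm z) ^ i / fact i) \<le> \<delta> * K"
          using p partial[OF that, of k] L_nonneg \<delta> by (intro mult_mono sum_nonneg) auto
        then show ?thesis using \<delta> by simp
      qed
      show 1: "norm (\<gamma> j p z) \<le> 1" using Suc.IH[OF that] s[of j] by linarith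
      have "norm (\<gamma> (Suc j) p z) \<le> norm (\<gamma> j p z) + norm (\<gamma> (Suc j) p z - \<gamma> j p z)"
        by (metis add.commute diff_add_cancel norm_triangle_ineq)
      also have "\<dots> \<le> norm p * (\<Sum>i\<le>j. (L * norm z) ^ i / fact i) + norm p * (L * norm z) ^ Suc j / fact (Suc j)"
        using Suc.IH[OF that] by (intro add_mono) auto
      also have "\<dots> = norm p * (\<Sum>i\<le>Suc j. (L * norm z) ^ i / fact i)" by (simp add: distrib_left)
      finally show 2: "norm (\<gamma> (Suc j) p z) \<le> norm p * (\<Sum>i\<le>Suc j. (L * norm z) ^ i / fact i)" .
      then show "norm (\<gamma> (Suc j) p z) \<le> 1" using s[of "Suc j"] by linarith
    qed
    have "norm (\<gamma> (Suc (Suc j)) p z - \<gamma> (Suc j) p z) \<le> (L * (norm p * L ^ Suc j / fact (Suc j))) * norm z ^ Suc (Suc j) / real (Suc (Suc j))"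
    proof (rule norm_integral_curve_le[where v = "\<lambda>z. X (\<gamma> (Suc j) p z) - X (\<gamma> j p z)" and f = "\<lambda>z. \<gamma> (Suc (Suc j)) p z - \<gamma> (Suc j) p z"])
      fix w :: complex assume w: "w \<in> ball 0 R"
      show "((\<lambda>w. fst (\<gamma> (Suc (Suc j)) p w - \<gamma> (Suc j) p w)) has_field_derivative fst (X (\<gamma> (Suc j) p w) - X (\<gamma> j p w))) (at w)"
        "((\<lambda>w. snd (\<gamma> (Suc (Suc j)) p w - \<gamma> (Suc j) p w)) has_field_derivative snd (X (\<gamma> (Suc j) p w) - X (\<gamma> j p w))) (at w)"
        using DERIV_diff[OF der(1)[of "Suc j" p w] der(1)[of j p w]] DERIV_diff[OF der(2)[of "Suc j" p w] der(2)[of j p w]] by simp_all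
      have "norm (X (\<gamma> (Suc j) p w) - X (\<gamma> j p w)) \<le> L * norm (\<gamma> (Suc j) p w - \<gamma> j p w)"
        by (intro X_lipschitz nb w)
      also have "\<dots> \<le> L * (norm p * (L * norm w) ^ Suc j / fact (Suc j))"
        using Suc.IH[OF w] by (intro mult_left_mono L_nonneg) auto
      finally show "norm (X (\<gamma> (Suc j) p w) - X (\<gamma> j p w)) \<le> L * (norm p * L ^ Suc j / fact (Suc j)) * norm w ^ Suc j"
        by (simp only: power_mult_distrib) (simp add: mult_ac)
    qed (use Suc.prems \<gamma>init in auto)
    also have "\<dots> = norm p * (L * norm z) ^ Suc (Suc j) / fact (Suc (Suc j))"
      by (simp only: power_mult_distrib fact_Suc) (simp add: field_simps)
    finally show ?case using nb(3)[OF Suc.prems] by blast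
  qed
  have bound: "norm (\<gamma> j p z) \<le> K * norm p" if "norm p < \<delta>" "z \<in> ball 0 R" for j p z
  proof -
    have "norm p * (\<Sum>i\<le>j. (L * norm z) ^ i / fact i) \<le> norm p * K"
      using partial[OF that(2)] by (intro mult_left_mono) auto
    then show ?thesis using est[OF that] by (auto simp: mult.commute intro: order_trans)
  qed
  define A where "A = {x :: (complex \<times> complex) \<times> complex. norm (fst x) < \<delta> \<and> snd x \<in> ball 0 R}"
  \<comment> \<open>Writing the limit as a telescoping series lets the M-test give convergence that
    is uniform in the initial point and the time together.\<close>
  define g where "g = (\<lambda>p z. p + (\<Sum>i. \<gamma> (Suc i) p z - \<gamma> i p z))"
  have W: "uniform_limit A (\<lambda>n x. \<Sum>i<n. \<gamma> (Suc i) (fst x) (snd x) - \<gamma> i (fst x) (snd x))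
      (\<lambda>x. \<Sum>i. \<gamma> (Suc i) (fst x) (snd x) - \<gamma> i (fst x) (snd x)) sequentially"
  proof (rule Weierstrass_m_test)
    fix i x assume x: "x \<in> A"
    have "norm (\<gamma> (Suc i) (fst x) (snd x) - \<gamma> i (fst x) (snd x)) \<le> norm (fst x) * (L * norm (snd x)) ^ Suc i / fact (Suc i)"
      using est x unfolding A_def by blast
    also have "\<dots> \<le> 1 * (L * R) ^ Suc i / fact (Suc i)"
      using x \<delta> L_nonneg unfolding A_def by (intro divide_right_mono mult_mono power_mono) auto
    finally show "norm (\<gamma> (Suc i) (fst x) (snd x) - \<gamma> i (fst x) (snd x)) \<le> (L * R) ^ Suc i / fact (Suc i)" by simp
  next
    show "summable (\<lambda>i. (L * R) ^ Suc i / fact (Suc i))"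
      using summable_exp[of "L * R"] by (subst summable_Suc_iff) (simp add: divide_inverse mult.commute)
  qed
  have lim: "uniform_limit A (\<lambda>n x. \<gamma> n (fst x) (snd x)) (\<lambda>x. g (fst x) (snd x)) sequentially"
  proof -
    have tel: "(\<Sum>i<n. \<gamma> (Suc i) p z - \<gamma> i p z) = \<gamma> n p z - p" for n and p :: "complex \<times> complex" and z :: complex
      using sum_lessThan_telescope[of "\<lambda>i. \<gamma> i p z" n] by (simp add: \<gamma>0)
    show ?thesis using W unfolding uniform_limit_iff g_def tel by (simp add: dist_norm algebra_simps)
  qed
  have pw: "(\<lambda>n. \<gamma> n p z) \<longlonglongrightarrow> g p z" if "norm p < \<delta>" "z \<in> ball 0 R" for p :: "complex \<times> complex" and z :: complex
    using tendsto_uniform_limitI[OF lim, of "(p, z)"] that by (simp add: A_def)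
  have ul: "\<forall>\<^sub>F n in sequentially. \<forall>(p :: complex \<times> complex) (z :: complex). norm p < \<delta> \<longrightarrow> z \<in> ball 0 R \<longrightarrow> dist (fst (\<gamma> n p z)) (fst (g p z)) < e
      \<and> dist (snd (\<gamma> n p z)) (snd (g p z)) < e" if "e > 0" for e
  proof -
    have "\<forall>\<^sub>F n in sequentially. \<forall>x\<in>A. dist (\<gamma> n (fst x) (snd x)) (g (fst x) (snd x)) < e"
      using uniform_limitD[OF lim that] .
    then show ?thesis
    proof eventually_elim
      case (elim n)
      show ?case
      proof (intro allI impI)
        fix p :: "complex \<times> complex" and z :: complex assume "norm p < \<delta>" "z \<in> ball 0 R"
        then have "dist (\<gamma> n p z) (g p z) < e" using elim[rule_format, of "(p, z)"] by (simp add: A_def)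
        then show "dist (fst (\<gamma> n p z)) (fst (g p z)) < e \<and> dist (snd (\<gamma> n p z)) (snd (g p z)) < e"
          using dist_fst_le[of "\<gamma> n p z" "g p z"] dist_snd_le[of "\<gamma> n p z" "g p z"] by simp
      qed
    qed
  qed
  show thesis
  proof (rule that[OF \<delta>(1) K \<delta>(2), of g])
    fix p :: "complex \<times> complex" assume p: "norm p < \<delta>"
    show "g p 0 = p"
      using pw[OF p, of 0] R \<gamma>init LIMSEQ_unique[OF _ tendsto_const] by simp
    show "norm (g p z) \<le> K * norm p" if "z \<in> ball 0 R" for z
      by (rule tendsto_upperbound[OF tendsto_norm[OF pw[OF p that]]]) (use bound[OF p that] in auto)
    show "solves_on X (g p) (ball 0 R)"
      unfolding solves_on_def
    proof
      fix z :: complex assume z: "z \<in> ball 0 R"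
      \<comment> \<open>Differentiating the limit in the time needs locally uniform convergence. The
        index is shifted because \<open>\<gamma> (Suc n)\<close> is the primitive of the field along
        \<open>\<gamma> n\<close>.\<close>
      have u: "\<exists>d>0. cball x d \<subseteq> ball 0 R \<and> uniform_limit (cball x d) (\<lambda>n z. fst (\<gamma> (Suc n) p z)) (\<lambda>z. fst (g p z)) sequentially
          \<and> uniform_limit (cball x d) (\<lambda>n z. snd (\<gamma> (Suc n) p z)) (\<lambda>z. snd (g p z)) sequentially"
        if x: "x \<in> ball 0 R" for x
      proof -
        obtain d where d: "d > 0" "cball x d \<subseteq> ball 0 R" using x open_contains_cball_eq[OF open_ball] by blast
        have "\<forall>\<^sub>F n in sequentially. \<forall>z\<in>cball x d. dist (fst (\<gamma> (Suc n) p z)) (fst (g p z)) < e \<and> dist (snd (\<gamma> (Suc n) p z)) (snd (g p z)) < e"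
          if "e > 0" for e
        proof -
          have "\<forall>\<^sub>F n in sequentially. \<forall>z\<in>cball x d. dist (fst (\<gamma> n p z)) (fst (g p z)) < e \<and> dist (snd (\<gamma> n p z)) (snd (g p z)) < e"
            using ul[OF that] by eventually_elim (use p d in blast)
          then show ?thesis by (simp add: eventually_sequentially_Suc[of "\<lambda>n. \<forall>z\<in>cball x d. dist (fst (\<gamma> n p z)) (fst (g p z)) < e \<and> dist (snd (\<gamma> n p z)) (snd (g p z)) < e"])
        qed
        then show ?thesis using d unfolding uniform_limit_iff
          by (intro exI[of _ d]) (fastforce elim: eventually_mono)
      qed
      obtain d1 where d1: "\<forall>x\<in>ball 0 R. ((\<lambda>z. fst (g p z)) has_field_derivative d1 x) (at x) \<and> (\<lambda>n. fst (X (\<gamma> n p x))) \<longlonglongrightarrow> d1 x"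
        using has_complex_derivative_uniform_sequence[where S = "ball 0 R" and f = "\<lambda>n z. fst (\<gamma> (Suc n) p z)"
            and f' = "\<lambda>n z. fst (X (\<gamma> n p z))" and g = "\<lambda>z. fst (g p z)", OF open_ball der(1)] u by blast
      obtain d2 where d2: "\<forall>x\<in>ball 0 R. ((\<lambda>z. snd (g p z)) has_field_derivative d2 x) (at x) \<and> (\<lambda>n. snd (X (\<gamma> n p x))) \<longlonglongrightarrow> d2 x"
        using has_complex_derivative_uniform_sequence[where S = "ball 0 R" and f = "\<lambda>n z. snd (\<gamma> (Suc n) p z)"
            and f' = "\<lambda>n z. snd (X (\<gamma> n p z))" and g = "\<lambda>z. snd (g p z)", OF open_ball der(2)] u by blast
      have "(\<lambda>n. fst (X (\<gamma> n p z))) \<longlonglongrightarrow> fst (X (g p z))" "(\<lambda>n. snd (X (\<gamma> n p z))) \<longlonglongrightarrow> snd (X (g p z))"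
        using isCont_tendsto_compose[OF isCont_X(1) pw[OF p z]] isCont_tendsto_compose[OF isCont_X(2) pw[OF p z]] by auto
      then have "d1 z = fst (X (g p z))" "d2 z = snd (X (g p z))"
        using d1 d2 z LIMSEQ_unique by blast+
      then show "((\<lambda>w. fst (g p w)) has_field_derivative fst (X (g p z))) (at z) \<and>
         ((\<lambda>w. snd (g p w)) has_field_derivative snd (X (g p z))) (at z)" using d1 d2 z by metis
    qed
  next
    fix z :: complex assume z: "z \<in> ball 0 R"
    have main: "\<forall>\<^sub>F n in sequentially. \<forall>x\<in>ball 0 \<delta>. dist (fst (\<gamma> n x z)) (fst (g x z)) < e \<and>
        dist (snd (\<gamma> n x z)) (snd (g x z)) < e" if "e > 0" for e
      using ul[OF that]
    proof eventually_elim
      case (elim n)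
      show ?case
      proof
        fix x :: "complex \<times> complex" assume "x \<in> ball 0 \<delta>"
        then have "norm x < \<delta>" by (simp only: mem_ball_0)
        then show "dist (fst (\<gamma> n x z)) (fst (g x z)) < e \<and> dist (snd (\<gamma> n x z)) (snd (g x z)) < e"
          using elim z by blast
      qed
    qed
    have u1: "uniform_limit (ball 0 \<delta>) (\<lambda>n p. fst (\<gamma> n p z)) (\<lambda>p. fst (g p z)) sequentially"
      unfolding uniform_limit_iff by (intro allI impI, drule main, erule eventually_mono) blast
    have u2: "uniform_limit (ball 0 \<delta>) (\<lambda>n p. snd (\<gamma> n p z)) (\<lambda>p. snd (g p z)) sequentially"
      unfolding uniform_limit_iff by (intro allI impI, drule main, erule eventually_mono) blast
    show "holomorphic2_map_on (\<lambda>p. g p z) (ball 0 \<delta>)"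
      unfolding holomorphic2_map_on_def
      using holomorphic2_uniform_limit[where f = "\<lambda>n p. fst (\<gamma> n p z)", OF open_ball time_poly_holomorphic2[OF tp(1)] u1]
        holomorphic2_uniform_limit[where f = "\<lambda>n p. snd (\<gamma> n p z)", OF open_ball time_poly_holomorphic2[OF tp(2)] u2]
      by blast
  qed
qed

end

section \<open>The displacement of a branch along a flow\<close>

context poly_field
begin

text \<open>The inverse germ is the flow at time \<open>-s\<close>: by uniqueness, following the
  orbit of \<open>p\<close> for time \<open>u\<close> and then for time \<open>-u\<close> returns to
  \<open>p\<close>.\<close>

lemma flow_biholomorphism:
  obtains \<delta> K g R where "0 < \<delta>" "1 \<le> K" "\<delta> * K \<le> 1" "norm s < R"
    "\<And>p. norm p < \<delta> \<Longrightarrow> g p 0 = p" "\<And>p. norm p < \<delta> \<Longrightarrow> solves_on X (g p) (ball 0 R)"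
    "\<And>p z. norm p < \<delta> \<Longrightarrow> z \<in> ball 0 R \<Longrightarrow> norm (g p z) \<le> K * norm p"
    "biholomorphism_germ (\<lambda>p. g p s)" "is_time_flow X s (\<lambda>p. g p s)"
proof -
  \<comment> \<open>The orbit of \<open>g p u\<close> is compared with a shifted orbit on the disc
    of radius \<open>R - norm u\<close>, which must contain \<open>-u\<close>; this requires
    \<open>R > 2 * norm s\<close>.\<close>
  define R where "R = 3 * norm s + 1"
  have R: "0 < R" by (simp add: R_def add_nonneg_pos)
  obtain \<delta> K g where \<delta>: "0 < \<delta>" "1 \<le> K" "\<delta> * K \<le> 1"
    and g0: "\<And>p. norm p < \<delta> \<Longrightarrow> g p 0 = p" and sol: "\<And>p. norm p < \<delta> \<Longrightarrow> solves_on X (g p) (ball 0 R)"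
    and gb: "\<And>p z. norm p < \<delta> \<Longrightarrow> z \<in> ball 0 R \<Longrightarrow> norm (g p z) \<le> K * norm p"
    and hol: "\<And>z. z \<in> ball 0 R \<Longrightarrow> holomorphic2_map_on (\<lambda>p. g p z) (ball 0 \<delta>)"
    using flow_exists[OF R] by blast
  have le1: "norm (g p z) \<le> 1" if "norm p < \<delta>" "z \<in> ball 0 R" for p z
  proof -
    have "K * norm p \<le> K * \<delta>" using that(1) \<delta>(2) by (intro mult_left_mono) auto
    then show ?thesis using gb[OF that] \<delta>(3) by (simp add: mult.commute)
  qed
  have returns: "g (g p u) (- u) = p" if u: "norm u = norm s" and p: "norm p < \<delta> / K" for p u
  proof -
    have p': "norm p < \<delta>" "K * norm p < \<delta>"
      using p \<delta> by (auto simp: field_simps intro: le_less_trans[OF mult_left_mono[of 1 K "norm p"], simplified])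
    have uR: "u \<in> ball 0 R" using u norm_ge_zero[of s] by (simp add: R_def del: norm_ge_zero)
    have q: "norm (g p u) < \<delta>" using gb[OF p'(1) uR] p'(2) by simp
    let ?R = "R - norm u"
    have sub: "u + w \<in> ball 0 R" if "w \<in> ball 0 ?R" for w
      using that norm_triangle_ineq[of u w] by simp
    have sub': "w \<in> ball 0 R" if "w \<in> ball 0 ?R" for w :: complex
      using that norm_ge_zero[of u] by (simp del: norm_ge_zero)
    have "g (g p u) (- u) = g p (u + (- u))"
    proof (rule flow_unique[of "g (g p u)" ?R "\<lambda>w. g p (u + w)" "- u"])
      show "solves_on X (g (g p u)) (ball 0 ?R)"
        using sol[OF q] sub' unfolding solves_on_def by blast
      show "solves_on X (\<lambda>w. g p (u + w)) (ball 0 ?R)"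
        unfolding solves_on_def
      proof (intro ballI conjI)
        fix w :: complex assume w: "w \<in> ball 0 ?R"
        have "((\<lambda>w. fst (g p w)) has_field_derivative fst (X (g p (w + u)))) (at (w + u))"
          "((\<lambda>w. snd (g p w)) has_field_derivative snd (X (g p (w + u)))) (at (w + u))"
          using sol[OF p'(1)] sub[OF w] unfolding solves_on_def by (simp_all add: add.commute)
        then show "((\<lambda>w. fst (g p (u + w))) has_field_derivative fst (X (g p (u + w)))) (at w)"
          "((\<lambda>w. snd (g p (u + w))) has_field_derivative snd (X (g p (u + w)))) (at w)"
          unfolding DERIV_shift by (simp_all add: add.commute)
      qed
      show "g (g p u) 0 = g p (u + 0)" using g0[OF q] by simp
      show "norm (g (g p u) w) \<le> 1" "norm (g p (u + w)) \<le> 1" if "w \<in> ball 0 ?R" for w :: complex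
        using le1[OF q sub'[OF that]] le1[OF p'(1) sub[OF that]] by auto
      show "- u \<in> ball 0 ?R" using u norm_ge_zero[of s] by (simp add: R_def del: norm_ge_zero)
    qed
    then show ?thesis using g0[OF p'(1)] by simp
  qed
  have "\<delta> / K > 0" using \<delta> by simp
  from eventually_ball_prod[OF this]
  have ev: "\<forall>\<^sub>F p in nhds (0,0). g (g p u) (- u) = p" if "norm u = norm s" for u
    by eventually_elim (use returns[OF that] in auto)
  have sR: "s \<in> ball 0 R" "- s \<in> ball 0 R" using norm_ge_zero[of s] by (simp_all add: R_def del: norm_ge_zero)
  have g00: "g (0,0) z = (0,0)" if "z \<in> ball 0 R" for z
    using gb[of "(0,0)" z] that \<delta>(1) by (simp add: zero_prod_def)
  have "biholomorphism_germ (\<lambda>p. g p s)"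
    using hol[OF sR(1)] hol[OF sR(2)] g00[OF sR(1)] g00[OF sR(2)] ev[of s] ev[of "- s"] \<delta>(1)
    by (intro biholomorphism_germI[of "ball 0 \<delta>" _ "ball 0 \<delta>" "\<lambda>p. g p (- s)"]) (auto simp: zero_prod_def)
  moreover have "is_time_flow X s (\<lambda>p. g p s)"
    unfolding is_time_flow_def
  proof (intro exI[of _ UNIV] conjI)
    show "\<forall>\<^sub>F p in nhds (0, 0). \<exists>R \<gamma>. norm s < R \<and> \<gamma> 0 = p \<and> \<gamma> s = g p s \<and>
        (\<forall>z\<in>ball 0 R. \<gamma> z \<in> UNIV \<and>
          ((\<lambda>w. fst (\<gamma> w)) has_field_derivative fst (X (\<gamma> z))) (at z) \<and>
          ((\<lambda>w. snd (\<gamma> w)) has_field_derivative snd (X (\<gamma> z))) (at z))"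
      using eventually_ball_prod[OF \<delta>(1)]
    proof eventually_elim
      case (elim p)
      then show ?case using g0[of p] sol[of p] sR(1)
        by (intro exI[of _ R] exI[of _ "g p"]) (auto simp: solves_on_def)
    qed
  qed (auto simp: holomorphic2_X)
  ultimately show thesis using that[OF \<delta> _ g0 sol gb] sR(1) by auto
qed

end

section \<open>Local roots and mean value estimates\<close>

lemma norm_add_diff_le:
  fixes u v w :: "'a :: real_normed_vector"
  assumes "norm u \<le> A" "norm v \<le> B" "norm w \<le> C"
  shows "norm (u + v - w) \<le> A + B + C"
  using norm_triangle_ineq4[of "u + v" w] norm_triangle_ineq[of u v] assms by linarith

lemma deriv_imp_lipschitz_at:
  fixes f :: "complex \<Rightarrow> complex"
  assumes "(f has_field_derivative d) (at a)"
  shows "\<exists>C>0. \<forall>\<^sub>F w in nhds a. norm (f w - f a) \<le> C * norm (w - a)"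
proof -
  have "((\<lambda>w. norm ((f w - f a) / (w - a))) \<longlongrightarrow> norm d) (at a)"
    using assms by (intro tendsto_norm) (simp add: has_field_derivative_iff)
  then have "\<forall>\<^sub>F w in at a. norm ((f w - f a) / (w - a)) < norm d + 1"
    by (rule order_tendstoD(2)) simp
  then have "\<forall>\<^sub>F w in nhds a. w \<noteq> a \<longrightarrow> norm ((f w - f a) / (w - a)) < norm d + 1"
    by (simp add: eventually_at_filter)
  then have "\<forall>\<^sub>F w in nhds a. norm (f w - f a) \<le> (norm d + 1) * norm (w - a)"
  proof eventually_elim
    case (elim w)
    then show ?case by (cases "w = a") (auto simp: norm_divide field_simps)
  qed
  then show ?thesis by (intro exI[of _ "norm d + 1"]) (auto intro: add_nonneg_pos)
qed

text \<open>Near 1 this is the holomorphic branch of the \<open>n\<close>-th root with value 1 at 1.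
  For every other nonzero \<open>w\<close> it is still some \<open>n\<close>-th root, which suffices
  where only existence matters.\<close>

definition root1 :: "nat \<Rightarrow> complex \<Rightarrow> complex"
  where "root1 n w = exp (Ln w / of_nat n)"

lemma root1_power: "0 < n \<Longrightarrow> w \<noteq> 0 \<Longrightarrow> root1 n w ^ n = w"
  by (simp add: root1_def exp_of_nat_mult[symmetric])

lemma root1_nonzero: "root1 n w \<noteq> 0"
  by (simp add: root1_def)

lemma root1_1: "root1 n 1 = 1"
  by (simp add: root1_def)

lemma near_1_not_nonpos: "norm (w - 1 :: complex) < 1 \<Longrightarrow> w \<notin> \<real>\<^sub>\<le>\<^sub>0"
proof
  assume w: "norm (w - 1 :: complex) < 1" "w \<in> \<real>\<^sub>\<le>\<^sub>0"
  have "\<bar>Re (w - 1)\<bar> < 1" using w(1) abs_Re_le_cmod le_less_trans by blast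
  then show False using w(2) by (auto elim!: nonpos_Reals_cases)
qed

lemma root1_deriv:
  assumes "norm (w - 1) < 1" "0 < n"
  shows "(root1 n has_field_derivative root1 n w / (of_nat n * w)) (at w)"
proof -
  have "w \<notin> \<real>\<^sub>\<le>\<^sub>0" by (rule near_1_not_nonpos[OF assms(1)])
  moreover from this have "w \<noteq> 0" by auto
  ultimately show ?thesis unfolding root1_def[abs_def] using assms(2)
    by (auto intro!: derivative_eq_intros simp: field_simps)
qed

lemma root1_bounds:
  assumes "0 < n"
  obtains e C where "0 < e" "e \<le> 1/2" "0 < C"
    "\<And>w. norm (w - 1) < e \<Longrightarrow> norm (root1 n w - 1) \<le> C * norm (w - 1)"
    "\<And>w. norm (w - 1) < e \<Longrightarrow> norm (root1 n w ^ k - 1) \<le> C * norm (w - 1)"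
proof -
  have d: "(root1 n has_field_derivative root1 n 1 / (of_nat n * 1)) (at 1)" by (rule root1_deriv) (use assms in auto)
  obtain C1 where C1: "0 < C1" "\<forall>\<^sub>F w in nhds 1. norm (root1 n w - root1 n 1) \<le> C1 * norm (w - 1)"
    using deriv_imp_lipschitz_at[OF d] by blast
  obtain C2 where C2: "0 < C2" "\<forall>\<^sub>F w in nhds 1. norm (root1 n w ^ k - root1 n 1 ^ k) \<le> C2 * norm (w - 1)"
    using deriv_imp_lipschitz_at[OF DERIV_power[OF d, of k]] by blast
  have "\<forall>\<^sub>F w in nhds 1. norm (root1 n w - 1) \<le> C1 * norm (w - 1) \<and> norm (root1 n w ^ k - 1) \<le> C2 * norm (w - 1)"
    using C1(2) C2(2) by eventually_elim (simp add: root1_1)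
  then obtain e where e: "0 < e" "\<And>w. dist w 1 < e \<Longrightarrow> norm (root1 n w - 1) \<le> C1 * norm (w - 1) \<and> norm (root1 n w ^ k - 1) \<le> C2 * norm (w - 1)"
    unfolding eventually_nhds_metric by blast
  show thesis
  proof (rule that[of "min e (1/2)" "C1 + C2"])
    fix w :: complex assume "norm (w - 1) < min e (1/2)"
    then have "norm (root1 n w - 1) \<le> C1 * norm (w - 1)" "norm (root1 n w ^ k - 1) \<le> C2 * norm (w - 1)"
      using e(2)[of w] by (auto simp: dist_norm)
    moreover have "0 \<le> C1 * norm (w - 1)" "0 \<le> C2 * norm (w - 1)" using C1(1) C2(1) by auto
    ultimately show "norm (root1 n w - 1) \<le> (C1 + C2) * norm (w - 1)"
      "norm (root1 n w ^ k - 1) \<le> (C1 + C2) * norm (w - 1)" by (simp_all add: distrib_right)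
  qed (use e C1 C2 in auto)
qed

lemma eventually_norm_small:
  assumes "0 < e"
  shows "\<forall>\<^sub>F t::complex in nhds 0. C * norm t < e"
proof -
  have "((\<lambda>t::complex. C * norm t) \<longlongrightarrow> C * norm (0::complex)) (nhds 0)"
    by (intro tendsto_mult tendsto_const tendsto_norm filterlim_ident)
  then show ?thesis using order_tendstoD(2)[of "\<lambda>t::complex. C * norm t" _ "nhds 0" e] assms by simp
qed

lemma mvt_ball:
  fixes f :: "complex \<Rightarrow> complex"
  assumes "\<And>z. z \<in> S \<Longrightarrow> (f has_field_derivative f' z) (at z)" "\<And>z. z \<in> S \<Longrightarrow> norm (f' z) \<le> B"
    "convex S" "0 \<in> S" "z \<in> S"
  shows "norm (f z - f 0) \<le> B * norm z"
  using field_differentiable_bound[OF assms(3), of f f' B z 0] assms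
  by (simp add: has_field_derivative_at_within)

text \<open>With \<open>P\<close> and \<open>Q\<close> the polynomials given by \<open>a\<close> and
  \<open>b\<close>, the conditions on the coefficients leave \<open>y \<partial>\<^sub>x\<close> as
  the only possible linear term of \<open>P \<partial>\<^sub>x + Q \<partial>\<^sub>y\<close>, and
  \<open>ord\<close> says that the pullback of \<open>Q dx - P dy\<close> is
  \<open>n c t^(k+n-1) dt\<close> up to higher order.\<close>

locale elimination = poly_field +
  fixes n m k :: nat and y :: "complex \<Rightarrow> complex" and Y :: "complex fps" and c s :: complex
  assumes N2: "2 \<le> N" and n: "0 < n" and nm: "n < m" and mk: "m < k"
    and a10: "a 1 0 = 0" and b10: "b 1 0 = 0" and b01: "b 0 1 = 0"
    and y: "y has_fps_expansion Y" and Y_low: "\<And>i. i < m \<Longrightarrow> fps_nth Y i = 0"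
    and ord: "\<exists>C. \<forall>\<^sub>F t in nhds 0. norm (of_nat n * t ^ (n - 1) * poly2 N b (t ^ n, y t)
      - deriv y t * poly2 N a (t ^ n, y t) - of_nat n * c * t ^ (k + n - 1)) \<le> C * norm t ^ (k + n)"
begin

lemma Q_order2:
  assumes "norm p \<le> r" "norm q \<le> r" "r \<le> 1"
  shows "norm (poly2 N b p - poly2 N b q) \<le> L * r * norm (p - q)"
proof -
  have "0 \<le> r" using assms(1) norm_ge_zero order_trans by blast
  then have "poly2_lip N b * r * norm (p - q) \<le> L * r * norm (p - q)"
    unfolding L_def by (intro mult_right_mono) (auto simp: poly2_lip_nonneg)
  with poly2_lipschitz_order2[where c = b and N = N, OF assms b01 b10] show ?thesis by linarith
qed

lemma P_lipschitz:
  assumes "norm p \<le> 1" "norm q \<le> 1"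
  shows "norm (poly2 N a p - poly2 N a q) \<le> L * norm (p - q)"
proof -
  have "poly2_lip N a * norm (p - q) \<le> L * norm (p - q)"
    unfolding L_def by (intro mult_right_mono) (auto simp: poly2_lip_nonneg)
  with poly2_lipschitz[OF assms, of N a] show ?thesis by linarith
qed

text \<open>The linear part of \<open>P\<close> is a multiple of \<open>y\<close>. It is kept apart
  because \<open>y\<close> is of smaller size than \<open>x\<close> along orbits that start on the
  branch.\<close>

lemma P_bound:
  obtains C where "0 \<le> C" "\<And>p r. norm p \<le> r \<Longrightarrow> r \<le> 1 \<Longrightarrow> norm (poly2 N a p) \<le> C * (norm (snd p) + r * r)"
proof -
  define a' where "a' = (\<lambda>i j. if i = 0 \<and> j = 1 then 0 else a i j)"
  define C where "C = norm (a 0 1) + poly2_lip N a'"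
  have "norm (poly2 N a p) \<le> C * (norm (snd p) + r * r)" if p: "norm p \<le> r" "r \<le> 1" for p r
  proof -
    have r: "0 \<le> r" using p(1) norm_ge_zero order_trans by blast
    have "poly2 N a p = (\<Sum>i<N. \<Sum>j<N. a' i j * (fst p ^ i * snd p ^ j) + (if j = 1 then (if i = 0 then a 0 1 * snd p else 0) else 0))"
      unfolding poly2_def a'_def by (intro sum.cong) auto
    also have "\<dots> = poly2 N a' p + a 0 1 * snd p" using N2 by (simp add: poly2_def sum.distrib)
    finally have e: "poly2 N a p = poly2 N a' p + a 0 1 * snd p" .
    have "norm (poly2 N a' p - poly2 N a' 0) \<le> poly2_lip N a' * r * norm (p - 0)"
      by (rule poly2_lipschitz_order2) (use p r a10 in \<open>auto simp: a'_def\<close>)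
    also have "\<dots> \<le> poly2_lip N a' * r * r"
      using p r poly2_lip_nonneg by (intro mult_left_mono) auto
    finally have "norm (poly2 N a' p) \<le> poly2_lip N a' * (r * r)"
      using poly2_at_0[of N a'] N2 a0 by (simp add: a'_def zero_prod_def mult.assoc)
    then have "norm (poly2 N a p) \<le> poly2_lip N a' * (r * r) + norm (a 0 1) * norm (snd p)"
      unfolding e by (intro norm_triangle_le) (simp add: norm_mult)
    also have "\<dots> \<le> C * (norm (snd p) + r * r)"
      unfolding C_def using r poly2_lip_nonneg[of N a'] by (simp add: algebra_simps)
    finally show ?thesis .
  qed
  moreover have "0 \<le> C" unfolding C_def using poly2_lip_nonneg by (simp add: add_nonneg_nonneg)
  ultimately show thesis using that by blast
qed

lemma Q_bound:
  assumes "norm p \<le> r" "r \<le> 1"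
  shows "norm (poly2 N b p) \<le> L * r * r"
proof -
  have r: "0 \<le> r" using assms(1) norm_ge_zero order_trans by blast
  have "norm (poly2 N b p - poly2 N b 0) \<le> L * r * norm (p - 0)" by (rule Q_order2) (use assms r in auto)
  also have "\<dots> \<le> L * r * r" using assms r L_nonneg by (intro mult_left_mono) auto
  finally show ?thesis using poly2_at_0[of N b] N2 b0 by (simp add: zero_prod_def)
qed

lemma y_bounds:
  obtains r C where "0 < r" "r \<le> 1" "0 \<le> C" "y holomorphic_on ball 0 r"
    "\<And>t. norm t < r \<Longrightarrow> norm (y t) \<le> C * norm t ^ m"
    "\<And>t. norm t < r \<Longrightarrow> norm (deriv y t) \<le> C * norm t ^ (m - 1)"
    "\<And>t. norm t < r \<Longrightarrow> norm (of_nat n * t ^ (n - 1) * poly2 N b (t ^ n, y t)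
      - deriv y t * poly2 N a (t ^ n, y t) - of_nat n * c * t ^ (k + n - 1)) \<le> C * norm t ^ (k + n)"
proof -
  obtain C1 where C1: "0 < C1" "\<forall>\<^sub>F t in nhds 0. norm (y t) \<le> C1 * norm t ^ m"
    using has_fps_expansion_bigoI[OF y Y_low] by blast
  have "deriv y has_fps_expansion fps_deriv Y" by (rule has_fps_expansion_deriv[OF y])
  then obtain C2 where C2: "0 < C2" "\<forall>\<^sub>F t in nhds 0. norm (deriv y t) \<le> C2 * norm t ^ (m - 1)"
    by (rule has_fps_expansion_bigoI[where N = "m - 1"]) (use Y_low in auto)
  obtain C3 where C3: "\<forall>\<^sub>F t in nhds 0. norm (of_nat n * t ^ (n - 1) * poly2 N b (t ^ n, y t)
      - deriv y t * poly2 N a (t ^ n, y t) - of_nat n * c * t ^ (k + n - 1)) \<le> C3 * norm t ^ (k + n)"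
    using ord by blast
  obtain r1 where r1: "0 < r1" "y holomorphic_on ball 0 r1"
    using analytic_at_0_ball[OF has_fps_expansion_imp_analytic_0[OF y]] by blast
  obtain e where e: "0 < e" "\<And>t. dist t 0 < e \<Longrightarrow> norm (y t) \<le> C1 * norm t ^ m \<and> norm (deriv y t) \<le> C2 * norm t ^ (m - 1) \<and>
    norm (of_nat n * t ^ (n - 1) * poly2 N b (t ^ n, y t)
      - deriv y t * poly2 N a (t ^ n, y t) - of_nat n * c * t ^ (k + n - 1)) \<le> C3 * norm t ^ (k + n)"
    using eventually_conj[OF C1(2) eventually_conj[OF C2(2) C3]] unfolding eventually_nhds_metric by blast
  define C where "C = C1 + C2 + \<bar>C3\<bar>"
  have C: "C1 \<le> C" "C2 \<le> C" "C3 \<le> C" using C1(1) C2(1) by (auto simp: C_def)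
  have up: "u \<le> C * norm t ^ j" if "u \<le> C' * norm t ^ j" "C' \<le> C" for u C' t j
    using that by (meson order_trans mult_right_mono zero_le_power norm_ge_zero)
  show thesis
  proof (rule that[of "min 1 (min e r1)" C])
    show "0 \<le> C" using C C1 by linarith
    show "y holomorphic_on ball 0 (min 1 (min e r1))" using r1(2) by (rule holomorphic_on_subset) auto
    fix t :: complex assume "norm t < min 1 (min e r1)"
    then have "dist t 0 < e" by simp
    from e(2)[OF this] C show "norm (y t) \<le> C * norm t ^ m" "norm (deriv y t) \<le> C * norm t ^ (m - 1)"
      "norm (of_nat n * t ^ (n - 1) * poly2 N b (t ^ n, y t)
      - deriv y t * poly2 N a (t ^ n, y t) - of_nat n * c * t ^ (k + n - 1)) \<le> C * norm t ^ (k + n)"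
      using up by blast+
  qed (use e r1 in auto)
qed


text \<open>Comparing the trajectory \<open>(x, v)\<close> of a point of the branch with the branch itself: the height
  \<open>D = v - y(\<sigma>)\<close>, where \<open>\<sigma>\<^sup>n = x\<close>, satisfies \<open>D' = c \<sigma>\<^sup>k + O(t) D\<close>, so that \<open>D\<close> at time \<open>s\<close> is
  \<open>c s t\<^sup>k\<close> up to higher order.\<close>

lemma displacement:
  assumes \<delta>: "0 < \<delta>" "1 \<le> K" and sR: "norm s < R"
    and g0: "\<And>p. norm p < \<delta> \<Longrightarrow> g p 0 = p" and sol: "\<And>p. norm p < \<delta> \<Longrightarrow> solves_on X (g p) (ball 0 R)"
    and gb: "\<And>p z. norm p < \<delta> \<Longrightarrow> z \<in> ball 0 R \<Longrightarrow> norm (g p z) \<le> K * norm p"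
  shows "\<exists>C. \<forall>\<^sub>F t in at 0. norm (fst (g (t ^ n, y t) s) - t ^ n) \<le> C * norm t ^ (n + 1) \<and>
    norm (snd (g (t ^ n, y t) s) - y (t * root1 n (fst (g (t ^ n, y t) s) / t ^ n)) - c * s * t ^ k) \<le> C * norm t ^ (k + 1)"
proof -
  have R: "0 < R" using sR norm_ge_zero[of s] by linarith
  obtain r0 Cy where r0: "0 < r0" "r0 \<le> 1" "0 \<le> Cy" "y holomorphic_on ball 0 r0"
    and Cy: "\<And>t. norm t < r0 \<Longrightarrow> norm (y t) \<le> Cy * norm t ^ m"
    "\<And>t. norm t < r0 \<Longrightarrow> norm (deriv y t) \<le> Cy * norm t ^ (m - 1)"
    "\<And>t. norm t < r0 \<Longrightarrow> norm (of_nat n * t ^ (n - 1) * poly2 N b (t ^ n, y t)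
      - deriv y t * poly2 N a (t ^ n, y t) - of_nat n * c * t ^ (k + n - 1)) \<le> Cy * norm t ^ (k + n)"
    by (rule y_bounds) (rule that)
  obtain CP where CP: "0 \<le> CP" "\<And>p r. norm p \<le> r \<Longrightarrow> r \<le> 1 \<Longrightarrow> norm (poly2 N a p) \<le> CP * (norm (snd p) + r * r)"
    by (rule P_bound) (rule that)
  obtain e1 Cr where e1: "0 < e1" "e1 \<le> 1/2" "0 < Cr"
    and Cr: "\<And>w. norm (w - 1) < e1 \<Longrightarrow> norm (root1 n w - 1) \<le> Cr * norm (w - 1)"
    "\<And>w. norm (w - 1) < e1 \<Longrightarrow> norm (root1 n w ^ k - 1) \<le> Cr * norm (w - 1)"
    by (rule root1_bounds[OF n]) (rule that)
  \<comment> \<open>With \<open>T = norm t\<close>, \<open>C1\<close> and \<open>C2\<close> bound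
    the initial point and its orbit in units of \<open>T^n\<close>; \<open>C3\<close> to
    \<open>C5\<close> bound the second coordinate, the values of \<open>P\<close> and the shift of
    \<open>x\<close> in units of \<open>T^(n+1)\<close>; \<open>C6\<close> covers both points to be
    compared; \<open>C7\<close> to \<open>C9\<close> control \<open>D'\<close>; \<open>C10\<close>
    bounds the maximum of \<open>D\<close> in units of \<open>T^k\<close> and \<open>C11\<close> the
    final error in units of \<open>T^(k+1)\<close>.\<close>
  define C1 where "C1 = 1 + Cy"
  define C2 where "C2 = K * C1"
  define C3 where "C3 = Cy + L * C2 * C2 * R"
  define C4 where "C4 = CP * (C3 + C2 * C2)"
  define C5 where "C5 = C4 * R"
  define C6 where "C6 = C2 + Cy * 2 ^ m"
  define C7 where "C7 = Cy * 2 ^ (k + 1)"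
  define C8 where "C8 = L * C6 + Cy * L * 2 ^ (m - n)"
  define C9 where "C9 = C7 + norm c * (Cr * C5)"
  define C10 where "C10 = 2 * (norm c + C9) * norm s"
  define C11 where "C11 = (C9 + C8 * C10) * norm s"
  have pos: "0 \<le> C1" "0 \<le> C2" "0 \<le> C3" "0 \<le> C4" "0 \<le> C5" "0 \<le> C6" "0 \<le> C7" "0 \<le> C8" "0 \<le> C9" "0 \<le> C10" "0 \<le> C11"
  proof -
    show p1: "0 \<le> C1" using r0 by (simp add: C1_def)
    show p2: "0 \<le> C2" using p1 \<delta> by (simp add: C2_def)
    show p3: "0 \<le> C3" using p2 r0 L_nonneg R by (simp add: C3_def)
    show p4: "0 \<le> C4" using p2 p3 CP by (simp add: C4_def)
    show p5: "0 \<le> C5" using p4 R by (simp add: C5_def)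
    show p6: "0 \<le> C6" using p2 r0 by (simp add: C6_def)
    show p7: "0 \<le> C7" using r0 by (simp add: C7_def)
    show p8: "0 \<le> C8" using p6 r0 L_nonneg by (simp add: C8_def)
    show p9: "0 \<le> C9" using p7 p5 e1 by (simp add: C9_def)
    show p10: "0 \<le> C10" using p9 by (simp add: C10_def)
    show "0 \<le> C11" using p8 p9 p10 by (simp add: C11_def)
  qed
  have small: "\<forall>\<^sub>F t in at 0. C * norm (t::complex) < e" if "0 < e" for C e
    using eventually_norm_small[OF that, of C] by (auto simp: eventually_at_filter elim: eventually_mono)
  have "\<forall>\<^sub>F t::complex in at 0. t \<noteq> 0"
    by (simp add: eventually_at_filter)
  moreover have "\<forall>\<^sub>F t::complex in at 0. 2 * norm t < r0" by (rule small[OF r0(1)])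
  moreover have "\<forall>\<^sub>F t::complex in at 0. C1 * norm t < \<delta>" by (rule small[OF \<delta>(1)])
  moreover have "\<forall>\<^sub>F t::complex in at 0. C6 * norm t < 1" by (rule small) simp
  moreover have "\<forall>\<^sub>F t::complex in at 0. C5 * norm t < e1" by (rule small[OF e1(1)])
  moreover have "\<forall>\<^sub>F t::complex in at 0. (Cr * C5) * norm t < 1" by (rule small) simp
  moreover have "\<forall>\<^sub>F t::complex in at 0. (2 * C8 * norm s) * norm t < 1" by (rule small) simp
  ultimately have "\<forall>\<^sub>F t in at 0. norm (fst (g (t ^ n, y t) s) - t ^ n) \<le> C5 * norm t ^ (n + 1) \<and>
    norm (snd (g (t ^ n, y t) s) - y (t * root1 n (fst (g (t ^ n, y t) s) / t ^ n)) - c * s * t ^ k) \<le> C11 * norm t ^ (k + 1)"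
  proof eventually_elim
    case (elim t)
    define T where "T = norm t"
    have T: "0 < T" "T \<le> 1" using elim(1,2) r0 by (auto simp: T_def)
    note sm = elim(2-7)[folded T_def]
    have tr: "norm t < r0" using sm(1) T(1) unfolding T_def by linarith
    have pw: "T ^ j \<le> T ^ i" if "i \<le> j" for i j using T that by (simp add: power_decreasing)
    have pw1: "T ^ n \<le> T" using pw[of 1 n] n by simp
    let ?p = "(t ^ n, y t)"
    have np: "norm ?p \<le> C1 * T ^ n"
    proof -
      have "norm ?p \<le> norm (t ^ n) + norm (y t)" by (rule norm_Pair_le)
      also have "\<dots> \<le> T ^ n + Cy * T ^ m" using Cy(1)[OF tr] by (simp add: norm_power T_def)
      also have "\<dots> \<le> T ^ n + Cy * T ^ n" using pw[of n m] nm r0 by (simp add: mult_left_mono)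
      finally show ?thesis by (simp add: C1_def algebra_simps)
    qed
    have p\<delta>: "norm ?p < \<delta>"
    proof -
      have "C1 * T ^ n \<le> C1 * T" using pw1 pos by (simp add: mult_left_mono)
      then show ?thesis using np sm(2) by linarith
    qed
    define \<gamma> where "\<gamma> = g ?p"
    define \<xi> where "\<xi> = (\<lambda>z. fst (\<gamma> z))"
    define v where "v = (\<lambda>z. snd (\<gamma> z))"
    have \<gamma>0: "\<xi> 0 = t ^ n" "v 0 = y t" using g0[OF p\<delta>] by (simp_all add: \<xi>_def v_def \<gamma>_def)
    have d\<xi>: "(\<xi> has_field_derivative poly2 N a (\<gamma> z)) (at z)" and dv: "(v has_field_derivative poly2 N b (\<gamma> z)) (at z)"
      if "z \<in> ball 0 R" for z
      using sol[OF p\<delta>] that unfolding solves_on_def \<xi>_def v_def \<gamma>_def X_def by auto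
    define \<eta> where "\<eta> = C2 * T ^ n"
    have n\<gamma>: "norm (\<gamma> z) \<le> \<eta>" if "z \<in> ball 0 R" for z
    proof -
      have "K * norm ?p \<le> K * (C1 * T ^ n)" using np \<delta> by (intro mult_left_mono) auto
      then show ?thesis using gb[OF p\<delta> that] by (simp add: \<gamma>_def \<eta>_def C2_def)
    qed
    have \<eta>: "0 \<le> \<eta>" "\<eta> \<le> 1" "C6 * T ^ n \<le> 1" "\<eta> \<le> C6 * T ^ n" "\<eta> * \<eta> \<le> C2 * C2 * T ^ (n + 1)"
    proof -
      show "0 \<le> \<eta>" using pos T by (simp add: \<eta>_def)
      have "C6 * T ^ n \<le> C6 * T" using pw1 pos by (simp add: mult_left_mono)
      then show a: "C6 * T ^ n \<le> 1" using sm(3) by linarith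
      show b: "\<eta> \<le> C6 * T ^ n" unfolding \<eta>_def C6_def using r0 T by (intro mult_right_mono) auto
      show "\<eta> \<le> 1" using a b by linarith
      have "\<eta> * \<eta> = C2 * C2 * T ^ (n + n)" by (simp add: \<eta>_def power_add)
      also have "\<dots> \<le> C2 * C2 * T ^ (n + 1)" using pw[of "n + 1" "n + n"] n pos by (intro mult_left_mono) auto
      finally show "\<eta> * \<eta> \<le> C2 * C2 * T ^ (n + 1)" .
    qed
    have R0: "(0::complex) \<in> ball 0 R" using R by simp
    \<comment> \<open>\<open>Q\<close> vanishes to order 2, so \<open>v\<close> changes by
      \<open>O(T^(2n))\<close>, while \<open>y t\<close> is \<open>O(T^m)\<close>; both exponents
      are at least \<open>n + 1\<close>. As the linear part of \<open>P\<close> involves only the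
      second coordinate, \<open>P\<close> is then \<open>O(T^(n+1))\<close> as well.\<close>
    have nv: "norm (v z) \<le> C3 * T ^ (n + 1)" if z: "z \<in> ball 0 R" for z
    proof -
      have "norm (v z - v 0) \<le> (L * \<eta> * \<eta>) * norm z"
        by (rule mvt_ball[OF dv _ convex_ball R0 z]) (use Q_bound[OF n\<gamma> \<eta>(2)] in auto)
      also have "\<dots> \<le> (L * \<eta> * \<eta>) * R" using z \<eta> L_nonneg by (intro mult_left_mono) auto
      also have "\<dots> = (L * R) * (\<eta> * \<eta>)" by simp
      also have "\<dots> \<le> (L * R) * (C2 * C2 * T ^ (n + 1))" using \<eta>(5) L_nonneg R by (intro mult_left_mono) auto
      finally have "norm (v z - y t) \<le> (L * C2 * C2 * R) * T ^ (n + 1)" by (simp add: \<gamma>0 mult_ac)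
      moreover have "norm (y t) \<le> Cy * T ^ (n + 1)"
        using Cy(1)[OF tr] pw[of "n + 1" m] nm r0(3) by (simp add: T_def) (meson mult_left_mono order_trans)
      ultimately show ?thesis
        using norm_triangle_sub[of "v z" "y t"] by (simp add: C3_def distrib_right)
    qed
    have nP: "norm (poly2 N a (\<gamma> z)) \<le> C4 * T ^ (n + 1)" if z: "z \<in> ball 0 R" for z
    proof -
      have "norm (poly2 N a (\<gamma> z)) \<le> CP * (norm (v z) + \<eta> * \<eta>)" using CP(2)[OF n\<gamma>[OF z] \<eta>(2)] by (simp add: v_def)
      also have "\<dots> \<le> CP * (C3 * T ^ (n + 1) + C2 * C2 * T ^ (n + 1))"
        using nv[OF z] \<eta>(5) CP by (intro mult_left_mono add_mono) auto
      finally show ?thesis by (simp add: C4_def algebra_simps)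
    qed
    have n\<xi>: "norm (\<xi> z - t ^ n) \<le> C5 * T ^ (n + 1)" if z: "z \<in> ball 0 R" for z
    proof -
      have "norm (\<xi> z - \<xi> 0) \<le> (C4 * T ^ (n + 1)) * norm z"
        by (rule mvt_ball[OF d\<xi> _ convex_ball R0 z]) (use nP in auto)
      also have "\<dots> \<le> (C4 * T ^ (n + 1)) * R" using z pos T by (intro mult_left_mono) auto
      finally show ?thesis by (simp add: \<gamma>0 C5_def mult_ac)
    qed
    \<comment> \<open>This quotient stays close to 1, so its root has a holomorphic branch along the
      orbit; this yields a parameter \<open>\<sigma>\<close> with \<open>n\<close>-th power
      \<open>\<xi>\<close>.\<close>
    define w where "w = (\<lambda>z. \<xi> z / t ^ n)"
    have w1: "norm (w z - 1) \<le> C5 * T" if z: "z \<in> ball 0 R" for z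
    proof -
      have "w z - 1 = (\<xi> z - t ^ n) / t ^ n" using elim(1) by (simp add: w_def field_simps)
      then have "norm (w z - 1) = norm (\<xi> z - t ^ n) / T ^ n" by (simp add: norm_divide norm_power T_def)
      also have "\<dots> \<le> C5 * T ^ (n + 1) / T ^ n" using n\<xi>[OF z] T by (intro divide_right_mono) auto
      finally show ?thesis using T by simp
    qed
    have we: "norm (w z - 1) < e1" "norm (w z - 1) < 1" if "z \<in> ball 0 R" for z
      using w1[OF that] sm(4) e1(2) by linarith+
    have wn: "w z \<noteq> 0" if "z \<in> ball 0 R" for z using we(2)[OF that] by auto
    define \<sigma> where "\<sigma> = (\<lambda>z. t * root1 n (w z))"
    have \<sigma>n: "\<sigma> z ^ n = \<xi> z" if "z \<in> ball 0 R" for z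
      using root1_power[OF n wn[OF that]] elim(1) by (simp add: \<sigma>_def power_mult_distrib w_def)
    have \<sigma>nz: "\<sigma> z \<noteq> 0" for z using elim(1) root1_nonzero by (simp add: \<sigma>_def)
    have \<sigma>2: "norm (\<sigma> z) \<le> 2 * T" if z: "z \<in> ball 0 R" for z
    proof -
      have "norm (root1 n (w z) - 1) \<le> Cr * norm (w z - 1)" by (rule Cr(1)[OF we(1)[OF z]])
      also have "\<dots> \<le> Cr * (C5 * T)" using w1[OF z] e1 by (intro mult_left_mono) auto
      finally have "norm (root1 n (w z) - 1) \<le> 1" using sm(5) by (simp add: mult_ac)
      then have "norm (root1 n (w z)) \<le> 2" using norm_triangle_sub[of "root1 n (w z)" 1] by simp
      then show ?thesis using T by (simp add: \<sigma>_def norm_mult T_def mult.commute mult_left_mono)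
    qed
    have \<sigma>r: "norm (\<sigma> z) < r0" if "z \<in> ball 0 R" for z using \<sigma>2[OF that] sm(1) by linarith
    have \<sigma>k: "norm (\<sigma> z ^ k - t ^ k) \<le> (Cr * C5) * T ^ (k + 1)" if z: "z \<in> ball 0 R" for z
    proof -
      have "\<sigma> z ^ k - t ^ k = t ^ k * (root1 n (w z) ^ k - 1)" by (simp add: \<sigma>_def power_mult_distrib algebra_simps)
      then have "norm (\<sigma> z ^ k - t ^ k) = T ^ k * norm (root1 n (w z) ^ k - 1)" by (simp add: norm_mult norm_power T_def)
      also have "\<dots> \<le> T ^ k * (Cr * (C5 * T))"
        using Cr(2)[OF we(1)[OF z]] w1[OF z] e1 T by (intro mult_left_mono) (auto intro: order_trans mult_left_mono)
      finally show ?thesis by (simp add: mult_ac)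
    qed
    have d\<sigma>: "(\<sigma> has_field_derivative poly2 N a (\<gamma> z) / (of_nat n * \<sigma> z ^ (n - 1))) (at z)" if z: "z \<in> ball 0 R" for z
    proof -
      have dw: "(w has_field_derivative poly2 N a (\<gamma> z) / t ^ n) (at z)"
        unfolding w_def by (rule DERIV_cdivide[OF d\<xi>[OF z]])
      have "(\<sigma> has_field_derivative t * (root1 n (w z) / (of_nat n * w z) * (poly2 N a (\<gamma> z) / t ^ n))) (at z)"
        unfolding \<sigma>_def by (rule DERIV_cmult[OF DERIV_chain2[OF root1_deriv[OF we(2)[OF z] n] dw]])
      moreover have "t * (root1 n (w z) / (of_nat n * w z) * (poly2 N a (\<gamma> z) / t ^ n)) = \<sigma> z * poly2 N a (\<gamma> z) / (of_nat n * \<xi> z)"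
        using elim(1) by (simp add: \<sigma>_def w_def)
      moreover have "\<sigma> z * poly2 N a (\<gamma> z) / (of_nat n * \<xi> z) = poly2 N a (\<gamma> z) / (of_nat n * \<sigma> z ^ (n - 1))"
      proof -
        have "\<xi> z = \<sigma> z * \<sigma> z ^ (n - 1)" unfolding \<sigma>n[OF z, symmetric] using n by (simp flip: power_Suc)
        then show ?thesis using \<sigma>nz[of z] by simp
      qed
      ultimately show ?thesis by simp
    qed
    define D where "D = (\<lambda>z. v z - y (\<sigma> z))"
    define D' where "D' = (\<lambda>z. poly2 N b (\<gamma> z) - deriv y (\<sigma> z) * (poly2 N a (\<gamma> z) / (of_nat n * \<sigma> z ^ (n - 1))))"
    have dD: "(D has_field_derivative D' z) (at z)" if z: "z \<in> ball 0 R" for z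
    proof -
      have "(y has_field_derivative deriv y (\<sigma> z)) (at (\<sigma> z))"
        using \<sigma>r[OF z] by (intro holomorphic_derivI[OF r0(4)]) auto
      from DERIV_diff[OF dv[OF z] DERIV_chain2[OF this d\<sigma>[OF z]]] show ?thesis unfolding D_def D'_def .
    qed
    have D'est: "norm (D' z - c * t ^ k) \<le> C9 * T ^ (k + 1) + C8 * T * norm (D z)" if z: "z \<in> ball 0 R" for z
    proof -
      define S where "S = norm (\<sigma> z)"
      have S: "0 < S" "S \<le> 2 * T" using \<sigma>nz \<sigma>2[OF z] by (auto simp: S_def)
      \<comment> \<open>\<open>?q\<close> is the point of the branch with the same first coordinate
        as \<open>\<gamma> z\<close>, hence at distance \<open>norm (D z)\<close> from it.\<close>
      let ?q = "(\<xi> z, y (\<sigma> z))"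
      have \<gamma>q: "\<gamma> z - ?q = (0, D z)" by (simp add: prod_eq_iff D_def v_def \<xi>_def)
      have n\<gamma>q: "norm (\<gamma> z - ?q) = norm (D z)" unfolding \<gamma>q by (simp add: norm_prod_def)
      have nq: "norm ?q \<le> C6 * T ^ n"
      proof -
        have "norm ?q \<le> norm (\<xi> z) + norm (y (\<sigma> z))" by (rule norm_Pair_le)
        also have "\<dots> \<le> \<eta> + Cy * S ^ m"
          using n\<gamma>[OF z] norm_fst_le'[of "\<gamma> z"] Cy(1)[OF \<sigma>r[OF z]] by (simp add: \<xi>_def S_def)
        also have "\<dots> \<le> \<eta> + Cy * (2 * T) ^ m" using S r0 by (intro add_left_mono mult_left_mono power_mono) auto
        also have "\<dots> \<le> \<eta> + Cy * (2 ^ m * T ^ n)"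
          unfolding power_mult_distrib using pw[of n m] nm r0 by (intro add_left_mono mult_left_mono) auto
        finally show ?thesis by (simp add: \<eta>_def C6_def algebra_simps)
      qed
      have ng: "norm (\<gamma> z) \<le> C6 * T ^ n" using n\<gamma>[OF z] \<eta>(4) by linarith
      define \<nu> where "\<nu> = (of_nat n :: complex) * \<sigma> z ^ (n - 1)"
      have \<nu>: "\<nu> \<noteq> 0" "norm \<nu> = real n * S ^ (n - 1)" using n \<sigma>nz by (auto simp: \<nu>_def norm_mult norm_power S_def)
      have \<nu>pos: "0 < norm \<nu>" using \<nu>(1) by simp
      have \<nu>ge: "S ^ (n - 1) \<le> norm \<nu>"
        unfolding \<nu>(2) using n S by (simp add: mult_le_cancel_right1)
      \<comment> \<open>Multiplication by \<open>\<nu>\<close> clears the denominator. The first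
        bracket is the expression in \<open>ord\<close> at the parameter \<open>\<sigma> z\<close>;
        the other two terms measure the change of \<open>Q\<close> and \<open>P\<close> between
        \<open>\<gamma> z\<close> and \<open>?q\<close>.\<close>
      have "\<nu> * (D' z - c * \<sigma> z ^ k) = (\<nu> * poly2 N b ?q - deriv y (\<sigma> z) * poly2 N a ?q - of_nat n * c * \<sigma> z ^ (k + n - 1))
          + \<nu> * (poly2 N b (\<gamma> z) - poly2 N b ?q) - deriv y (\<sigma> z) * (poly2 N a (\<gamma> z) - poly2 N a ?q)"
      proof -
        have "\<sigma> z ^ (k + n - 1) = \<sigma> z ^ k * \<sigma> z ^ (n - 1)" using n by (simp flip: power_add)
        moreover have "D' z = poly2 N b (\<gamma> z) - deriv y (\<sigma> z) * (poly2 N a (\<gamma> z) / \<nu>)"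
          by (simp add: D'_def \<nu>_def)
        then have "\<nu> * D' z = \<nu> * poly2 N b (\<gamma> z) - deriv y (\<sigma> z) * poly2 N a (\<gamma> z)"
          using \<nu>(1) by (simp add: right_diff_distrib)
        ultimately show ?thesis by (simp add: right_diff_distrib) (simp add: \<nu>_def mult_ac)
      qed
      also have "norm \<dots> \<le> Cy * S ^ (k + n) + norm \<nu> * (L * (C6 * T ^ n) * norm (D z)) + Cy * S ^ (m - 1) * (L * norm (D z))"
      proof (rule norm_add_diff_le)
        show "norm (\<nu> * poly2 N b ?q - deriv y (\<sigma> z) * poly2 N a ?q - of_nat n * c * \<sigma> z ^ (k + n - 1)) \<le> Cy * S ^ (k + n)"
          using Cy(3)[OF \<sigma>r[OF z]] unfolding \<sigma>n[OF z] \<nu>_def S_def .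
        show "norm (\<nu> * (poly2 N b (\<gamma> z) - poly2 N b ?q)) \<le> norm \<nu> * (L * (C6 * T ^ n) * norm (D z))"
          unfolding norm_mult using Q_order2[OF ng nq \<eta>(3)] n\<gamma>q by (intro mult_left_mono) auto
        have "norm (\<gamma> z) \<le> 1" "norm ?q \<le> 1" using ng nq \<eta>(3) by linarith+
        then show "norm (deriv y (\<sigma> z) * (poly2 N a (\<gamma> z) - poly2 N a ?q)) \<le> Cy * S ^ (m - 1) * (L * norm (D z))"
          unfolding norm_mult using P_lipschitz[of "\<gamma> z" ?q] n\<gamma>q Cy(2)[OF \<sigma>r[OF z]] S r0
          by (intro mult_mono) (auto simp: S_def)
      qed
      \<comment> \<open>Factoring out \<open>\<nu>\<close> turns \<open>S^(m-1)\<close> into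
        \<open>S^(m-n)\<close>, a positive power because \<open>n < m\<close>; this makes the
        coefficient of \<open>norm (D z)\<close> small.\<close>
      also have "\<dots> \<le> norm \<nu> * (Cy * S ^ (k + 1) + L * C6 * T * norm (D z) + Cy * L * S ^ (m - n) * norm (D z))"
      proof -
        have "k + n = (n - 1) + (k + 1)" using n by simp
        then have "S ^ (k + n) = S ^ (n - 1) * S ^ (k + 1)" by (metis power_add)
        then have "Cy * S ^ (k + n) = S ^ (n - 1) * (Cy * S ^ (k + 1))" by simp
        also have "\<dots> \<le> norm \<nu> * (Cy * S ^ (k + 1))" using \<nu>ge r0 S by (intro mult_right_mono) auto
        finally have 1: "Cy * S ^ (k + n) \<le> norm \<nu> * (Cy * S ^ (k + 1))" .
        have "m - 1 = (n - 1) + (m - n)" using n nm by simp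
        then have "S ^ (m - 1) = S ^ (n - 1) * S ^ (m - n)" by (metis power_add)
        then have "Cy * S ^ (m - 1) * (L * norm (D z)) = S ^ (n - 1) * (Cy * L * S ^ (m - n) * norm (D z))" by simp
        also have "\<dots> \<le> norm \<nu> * (Cy * L * S ^ (m - n) * norm (D z))"
          using \<nu>ge r0 S L_nonneg by (intro mult_right_mono) auto
        finally have 2: "Cy * S ^ (m - 1) * (L * norm (D z)) \<le> norm \<nu> * (Cy * L * S ^ (m - n) * norm (D z))" .
        have "norm \<nu> * (L * (C6 * T ^ n) * norm (D z)) \<le> norm \<nu> * (L * (C6 * T) * norm (D z))"
          using pw1 pos L_nonneg by (intro mult_left_mono mult_right_mono) auto
        then have 3: "norm \<nu> * (L * (C6 * T ^ n) * norm (D z)) \<le> norm \<nu> * (L * C6 * T * norm (D z))" by (simp add: mult_ac)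
        show ?thesis using 1 2 3 by (simp add: distrib_left)
      qed
      finally have "norm (D' z - c * \<sigma> z ^ k) \<le> Cy * S ^ (k + 1) + L * C6 * T * norm (D z) + Cy * L * S ^ (m - n) * norm (D z)"
        unfolding norm_mult using \<nu>pos by (simp only: mult_le_cancel_left_pos)
      also have "\<dots> \<le> C7 * T ^ (k + 1) + C8 * T * norm (D z)"
      proof -
        have "S ^ (k + 1) \<le> (2 * T) ^ (k + 1)" using S by (intro power_mono) auto
        then have "Cy * S ^ (k + 1) \<le> Cy * (2 * T) ^ (k + 1)" using r0(3) by (rule mult_left_mono)
        then have 1: "Cy * S ^ (k + 1) \<le> C7 * T ^ (k + 1)" unfolding C7_def power_mult_distrib by (simp add: mult_ac)
        have "S ^ (m - n) \<le> (2 * T) ^ (m - n)" using S by (intro power_mono) auto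
        also have "\<dots> \<le> 2 ^ (m - n) * T" unfolding power_mult_distrib using pw[of 1 "m - n"] nm by (intro mult_left_mono) auto
        finally have "Cy * L * S ^ (m - n) * norm (D z) \<le> Cy * L * (2 ^ (m - n) * T) * norm (D z)"
          using r0(3) L_nonneg by (intro mult_right_mono mult_left_mono) auto
        then show ?thesis using 1 by (simp add: C8_def algebra_simps)
      qed
      finally have "norm (D' z - c * \<sigma> z ^ k) \<le> C7 * T ^ (k + 1) + C8 * T * norm (D z)" .
      moreover have "norm (c * \<sigma> z ^ k - c * t ^ k) \<le> norm c * (Cr * C5 * T ^ (k + 1))"
        unfolding right_diff_distrib[symmetric] norm_mult using \<sigma>k[OF z] by (intro mult_left_mono) auto
      ultimately show ?thesis
        using norm_triangle_ineq[of "D' z - c * \<sigma> z ^ k" "c * \<sigma> z ^ k - c * t ^ k"]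
        by (simp add: C9_def algebra_simps)
    qed
    \<comment> \<open>In place of a differential inequality, the maximum \<open>M\<close> of
      \<open>norm (D z)\<close> over the closed time disc is estimated by itself with a factor at
      most 1/2 and absorbed.\<close>
    let ?B = "cball (0::complex) (norm s)"
    have B: "?B \<subseteq> ball 0 R" using sR by auto
    have "continuous_on ?B D"
      by (intro continuous_at_imp_continuous_on ballI DERIV_isCont[OF dD]) (use B in auto)
    then have "continuous_on ?B (\<lambda>z. norm (D z))" by (rule continuous_on_norm)
    then have "\<exists>z1\<in>?B. \<forall>z\<in>?B. norm (D z) \<le> norm (D z1)"
      by (intro continuous_attains_sup) auto
    then obtain z1 where z1: "z1 \<in> ?B" "\<And>z. z \<in> ?B \<Longrightarrow> norm (D z) \<le> norm (D z1)" by blast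
    define M where "M = norm (D z1)"
    have D0: "D 0 = 0" using elim(1) by (simp add: D_def \<gamma>0 \<sigma>_def w_def root1_1)
    have est: "norm (D z - c * t ^ k * z) \<le> (C9 * T ^ (k + 1) + C8 * T * M) * norm s" if z: "z \<in> ?B" for z
    proof -
      have "norm ((D z - c * t ^ k * z) - (D 0 - c * t ^ k * 0)) \<le> (C9 * T ^ (k + 1) + C8 * T * M) * norm z"
      proof (rule mvt_ball[where S = ?B and f' = "\<lambda>z. D' z - c * t ^ k"])
        fix u :: complex assume u: "u \<in> ?B"
        then have uR: "u \<in> ball 0 R" using B by blast
        show "((\<lambda>z. D z - c * t ^ k * z) has_field_derivative D' u - c * t ^ k) (at u)"
          using DERIV_diff[OF dD[OF uR] DERIV_cmult_Id[of "c * t ^ k" u]] .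
        have "C8 * T * norm (D u) \<le> C8 * T * M" using z1(2)[OF u] pos T by (intro mult_left_mono) (auto simp: M_def)
        then show "norm (D' u - c * t ^ k) \<le> C9 * T ^ (k + 1) + C8 * T * M" using D'est[OF uR] by linarith
      qed (use z in auto)
      also have "\<dots> \<le> (C9 * T ^ (k + 1) + C8 * T * M) * norm s"
        using z pos T by (intro mult_left_mono) (auto simp: M_def)
      finally show ?thesis by (simp add: D0)
    qed
    have M: "M \<le> C10 * T ^ k"
    proof -
      have "M \<le> norm (D z1 - c * t ^ k * z1) + norm (c * t ^ k * z1)"
        unfolding M_def using norm_triangle_ineq[of "D z1 - c * t ^ k * z1" "c * t ^ k * z1"] by simp
      also have "\<dots> \<le> (C9 * T ^ (k + 1) + C8 * T * M) * norm s + norm c * T ^ k * norm s"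
        using est[OF z1(1)] z1(1) T by (intro add_mono) (auto simp: norm_mult norm_power T_def intro!: mult_left_mono)
      also have "\<dots> \<le> C9 * T ^ k * norm s + M / 2 + norm c * T ^ k * norm s"
      proof -
        have "C9 * T ^ (k + 1) * norm s \<le> C9 * T ^ k * norm s"
          using pw[of k "k + 1"] pos by (intro mult_right_mono mult_left_mono) auto
        moreover have "(C8 * norm s * T) * M \<le> 1/2 * M"
          using sm(6) by (intro mult_right_mono) (auto simp: M_def)
        ultimately show ?thesis by (simp add: algebra_simps)
      qed
      finally show ?thesis by (simp add: C10_def algebra_simps)
    qed
    have sB: "s \<in> ?B" by simp
    have "norm (D s - c * t ^ k * s) \<le> (C9 * T ^ (k + 1) + C8 * T * (C10 * T ^ k)) * norm s"
      using est[OF sB] mult_left_mono[OF M, of "C8 * T"] pos T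
      by (smt (verit) mult_nonneg_nonneg mult_right_mono norm_ge_zero)
    also have "\<dots> = C11 * T ^ (k + 1)" by (simp add: C11_def algebra_simps)
    finally have "norm (D s - c * s * t ^ k) \<le> C11 * T ^ (k + 1)" by (simp add: mult_ac)
    then show ?case using n\<xi>[of s] sR
      by (simp add: D_def \<sigma>_def w_def v_def \<xi>_def \<gamma>_def T_def)
  qed
  then have "\<forall>\<^sub>F t in at 0. norm (fst (g (t ^ n, y t) s) - t ^ n) \<le> max C5 C11 * norm t ^ (n + 1) \<and>
    norm (snd (g (t ^ n, y t) s) - y (t * root1 n (fst (g (t ^ n, y t) s) / t ^ n)) - c * s * t ^ k) \<le> max C5 C11 * norm t ^ (k + 1)"
    by eventually_elim (auto intro: order_trans[OF _ mult_right_mono])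
  then show ?thesis by blast
qed

end

section \<open>Puiseux parametrizations\<close>

definition puiseux_series :: "nat \<Rightarrow> (nat \<Rightarrow> complex) \<Rightarrow> complex fps"
  where "puiseux_series m a = Abs_fps (\<lambda>i. if i = m then 1 else if m < i then a i else 0)"

lemma puiseux_series_nth: "fps_nth (puiseux_series m a) i = (if i = m then 1 else if m < i then a i else 0)"
  by (simp add: puiseux_series_def)

lemma fst_puiseux: "fst (puiseux n m a t) = t ^ n"
  by (simp add: puiseux_def)

lemma snd_puiseux_fps:
  assumes "conv_radius a > 0"
  shows "(\<lambda>t. snd (puiseux n m a t)) has_fps_expansion puiseux_series m a"
proof (rule has_fps_expansionI)
  obtain r :: real where r: "0 < r" "ereal r < conv_radius a"
    using assms by (metis ereal_dense2 ereal_less(2) less_ereal.simps(1) zero_ereal_def)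
  have "\<forall>\<^sub>F u in nhds (0::complex). u \<in> ball 0 r"
    using r by (intro eventually_nhds_in_open) auto
  then show "\<forall>\<^sub>F u in nhds 0. (\<lambda>i. fps_nth (puiseux_series m a) i * u ^ i) sums snd (puiseux n m a u)"
  proof eventually_elim
    case (elim u)
    then have "ereal (norm u) < ereal r" by simp
    then have "ereal (norm u) < conv_radius a" using r(2) by order
    then have "summable (\<lambda>i. norm (a i * u ^ i))" by (rule abs_summable_in_conv_radius)
    then have "summable (\<lambda>i. if i > m then a i * u ^ i else 0)"
      by (rule summable_comparison_test'[where N = 0]) auto
    then have s: "(\<lambda>i. if i > m then a i * u ^ i else 0) sums (\<Sum>i. if i > m then a i * u ^ i else 0)"
      by (rule summable_sums)
    have "(\<lambda>i. (if i = m then u ^ i else 0) + (if i > m then a i * u ^ i else 0)) sums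
       (u ^ m + (\<Sum>i. if i > m then a i * u ^ i else 0))"
      using sums_add[OF sums_single[of m "\<lambda>i. u ^ i"] s] by simp
    moreover have "(\<lambda>i. (if i = m then u ^ i else 0) + (if i > m then a i * u ^ i else 0))
        = (\<lambda>i. fps_nth (puiseux_series m a) i * u ^ i)"
      by (auto simp: puiseux_series_nth)
    ultimately show ?case by (simp add: puiseux_def)
  qed
qed

lemma puiseux_curve_germ:
  assumes "0 < n" "0 < m" "conv_radius a > 0"
  shows "curve_germ (puiseux n m a)"
proof -
  have "(\<lambda>t. snd (puiseux n m a t)) analytic_on {0}"
    by (rule has_fps_expansion_imp_analytic_0[OF snd_puiseux_fps[OF assms(3)]])
  moreover have "snd (puiseux n m a 0) = 0"
    using has_fps_expansion_nth_0[OF snd_puiseux_fps[OF assms(3), of n m]] assms(2)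
    by (simp add: puiseux_series_nth)
  ultimately show ?thesis
    using assms(1) unfolding curve_germ_def
    by (auto simp: prod_eq_iff fst_puiseux intro!: analytic_intros)
qed

lemma puiseux_of_fps:
  assumes F: "y has_fps_expansion F" and low: "\<And>i. i < m \<Longrightarrow> fps_nth F i = 0" and "fps_nth F m = 1"
  shows "conv_radius (fps_nth F) > 0" "puiseux_series m (fps_nth F) = F"
    "\<forall>\<^sub>F t in nhds 0. puiseux n m (fps_nth F) t = (t ^ n, y t)"
proof -
  show c: "conv_radius (fps_nth F) > 0" using F by (simp add: has_fps_expansion_def fps_conv_radius_def)
  show e: "puiseux_series m (fps_nth F) = F"
    by (rule fps_ext) (use assms in \<open>auto simp: puiseux_series_nth\<close>)
  have "\<forall>\<^sub>F t in nhds 0. eval_fps F t = snd (puiseux n m (fps_nth F) t)"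
    using snd_puiseux_fps[OF c, of n m] unfolding e has_fps_expansion_def by blast
  moreover have "\<forall>\<^sub>F t in nhds 0. eval_fps F t = y t" using F unfolding has_fps_expansion_def by blast
  ultimately show "\<forall>\<^sub>F t in nhds 0. puiseux n m (fps_nth F) t = (t ^ n, y t)"
    by eventually_elim (simp add: prod_eq_iff fst_puiseux)
qed

lemma analytic_tendsto_0:
  assumes "f analytic_on {0}" "f 0 = 0" "\<forall>\<^sub>F t in nhds 0. P t"
  shows "\<forall>\<^sub>F t in nhds 0. P (f t)"
proof -
  have "filterlim f (nhds 0) (nhds 0)"
    using isCont_tendsto_nhds[OF analytic_at_imp_isCont[OF assms(1)]] assms(2) by simp
  then show ?thesis using assms(3) by (simp add: filterlim_iff)
qed

text \<open>\<open>\<Gamma>'\<close> is the image of a small disc. Injectivity is inherited from the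
  old parametrization through the inverse of \<open>F\<close> and \<open>\<rho>\<close>. The germ
  does not depend on the disc because the first coordinate \<open>t^n\<close> determines
  \<open>norm t\<close>: points near the origin come from small parameters only.\<close>

lemma puiseux_transport:
  assumes n: "0 < n" and m: "0 < m" and \<Gamma>: "puiseux_parametrization n m a \<Gamma>"
    and a': "conv_radius a' > 0" and F: "biholomorphism_germ F"
    and \<sigma>: "\<sigma> analytic_on {0}" "\<sigma> 0 = 0" and \<rho>: "\<rho> analytic_on {0}" "\<rho> 0 = 0"
    and inv: "\<forall>\<^sub>F t in nhds 0. \<rho> (\<sigma> t) = t" "\<forall>\<^sub>F t in nhds 0. \<sigma> (\<rho> t) = t"
    and eq: "\<forall>\<^sub>F t in nhds 0. F (puiseux n m a t) = puiseux n m a' (\<sigma> t)"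
  shows "\<exists>\<Gamma>'. puiseux_parametrization n m a' \<Gamma>' \<and> sends_branch F \<Gamma> \<Gamma>'"
proof -
  let ?\<phi> = "puiseux n m a" and ?\<psi> = "puiseux n m a'"
  have a: "conv_radius a > 0" using \<Gamma> unfolding puiseux_parametrization_def by blast
  obtain r where r: "0 < r" "inj_on ?\<phi> (ball 0 r)"
    and \<Gamma>r: "\<And>\<epsilon>. 0 < \<epsilon> \<Longrightarrow> \<epsilon> \<le> r \<Longrightarrow> \<forall>\<^sub>F p in nhds (0, 0). p \<in> \<Gamma> \<longleftrightarrow> p \<in> ?\<phi> ` ball 0 \<epsilon>"
    using \<Gamma> unfolding puiseux_parametrization_def parametrizes_def by blast
  have c\<phi>: "curve_germ ?\<phi>" and c\<psi>: "curve_germ ?\<psi>" using puiseux_curve_germ n m a a' by auto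
  obtain G where G: "biholomorphism_germ G" "\<forall>\<^sub>F p in nhds (0,0). G (F p) = p" "\<forall>\<^sub>F p in nhds (0,0). F (G p) = p"
    using biholomorphism_germ_inverse[OF F] by blast
  have GF\<phi>: "\<forall>\<^sub>F t in nhds 0. G (F (?\<phi> t)) = ?\<phi> t" by (rule curve_germ_eventually[OF c\<phi> G(2)])
  have "\<forall>\<^sub>F t in nhds 0. F (?\<phi> (\<rho> t)) = ?\<psi> (\<sigma> (\<rho> t))" by (rule analytic_tendsto_0[OF \<rho> eq])
  moreover have "\<forall>\<^sub>F t in nhds 0. G (F (?\<phi> (\<rho> t))) = ?\<phi> (\<rho> t)" by (rule analytic_tendsto_0[OF \<rho> GF\<phi>])
  moreover have "\<forall>\<^sub>F t in nhds 0. \<rho> t \<in> ball 0 r"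
    by (rule analytic_tendsto_0[OF \<rho> eventually_nhds_in_open]) (use r in auto)
  ultimately have "\<forall>\<^sub>F t in nhds 0. G (?\<psi> t) = ?\<phi> (\<rho> t) \<and> \<rho> t \<in> ball 0 r \<and> \<sigma> (\<rho> t) = t"
    using inv(2) by eventually_elim auto
  then obtain r1 where r1: "0 < r1" "\<And>t. t \<in> ball 0 r1 \<Longrightarrow> G (?\<psi> t) = ?\<phi> (\<rho> t) \<and> \<rho> t \<in> ball 0 r \<and> \<sigma> (\<rho> t) = t"
    unfolding eventually_nhds_metric by (auto simp: dist_commute)
  obtain r2 where r2: "0 < r2" "(\<lambda>t. snd (?\<psi> t)) holomorphic_on ball 0 r2"
    using c\<psi> unfolding curve_germ_def by (auto elim: analytic_at_0_ball)
  define r' where "r' = min r1 r2"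
  have r': "0 < r'" "r' \<le> r1" "r' \<le> r2" using r1 r2 by (auto simp: r'_def)
  define \<Gamma>' where "\<Gamma>' = ?\<psi> ` ball 0 r'"
  have close: "\<forall>\<^sub>F p in nhds (0::complex, 0::complex). norm (fst p) < \<epsilon> ^ n" if "0 < \<epsilon>" for \<epsilon> :: real
    using eventually_ball_prod[of "\<epsilon> ^ n"] that by (auto elim: eventually_mono)
  have lt: "norm t < \<epsilon>" if "norm (t ^ n) < \<epsilon> ^ n" "0 < \<epsilon>" for t :: complex and \<epsilon>
    using that power_less_imp_less_base[of "norm t" n \<epsilon>] by (simp add: norm_power)
  have "parametrizes ?\<psi> \<Gamma>'"
    unfolding parametrizes_def
  proof (intro conjI exI[of _ r'] allI impI)
    show "?\<psi> 0 = (0,0)" using c\<psi> unfolding curve_germ_def by blast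
    show "0 < r'" by (rule r'(1))
    show "(\<lambda>t. fst (?\<psi> t)) holomorphic_on ball 0 r'" by (simp add: fst_puiseux holomorphic_intros)
    show "(\<lambda>t. snd (?\<psi> t)) holomorphic_on ball 0 r'" using r2(2) by (rule holomorphic_on_subset) (use r' in auto)
    show "inj_on ?\<psi> (ball 0 r')"
    proof (rule inj_onI)
      fix u v assume uv: "u \<in> ball 0 r'" "v \<in> ball 0 r'" "?\<psi> u = ?\<psi> v"
      then have uv': "u \<in> ball 0 r1" "v \<in> ball 0 r1" using r' by auto
      have "?\<phi> (\<rho> u) = ?\<phi> (\<rho> v)" using r1(2)[OF uv'(1)] r1(2)[OF uv'(2)] uv(3) by metis
      then have "\<rho> u = \<rho> v" using r(2) r1(2)[OF uv'(1)] r1(2)[OF uv'(2)] by (meson inj_onD)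
      then show "u = v" using r1(2)[OF uv'(1)] r1(2)[OF uv'(2)] by metis
    qed
    fix \<epsilon> :: real assume \<epsilon>: "0 < \<epsilon> \<and> \<epsilon> \<le> r'"
    then show "\<forall>\<^sub>F p in nhds (0, 0). (p \<in> \<Gamma>') = (p \<in> ?\<psi> ` ball 0 \<epsilon>)"
      using close[of \<epsilon>]
    proof (auto elim!: eventually_mono simp: \<Gamma>'_def)
      fix t x y assume "norm (fst (?\<psi> t)) < \<epsilon> ^ n" "0 < \<epsilon>"
      then have "norm t < \<epsilon>" using lt by (simp add: fst_puiseux)
      then show "?\<psi> t \<in> ?\<psi> ` ball 0 \<epsilon>" by auto
    qed
  qed
  then have "puiseux_parametrization n m a' \<Gamma>'" using a' unfolding puiseux_parametrization_def by blast
  moreover have "sends_branch F \<Gamma> \<Gamma>'"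
    unfolding sends_branch_def
  proof (rule conjI[OF F])
    have "\<forall>\<^sub>F t in nhds 0. \<sigma> t \<in> ball 0 r'"
      by (rule analytic_tendsto_0[OF \<sigma> eventually_nhds_in_open]) (use r' in auto)
    from eventually_conj[OF this eq] obtain r3 where r3: "0 < r3"
      "\<And>t. t \<in> ball 0 r3 \<Longrightarrow> \<sigma> t \<in> ball 0 r' \<and> F (?\<phi> t) = ?\<psi> (\<sigma> t)"
      unfolding eventually_nhds_metric by (auto simp: dist_commute)
    define r4 where "r4 = min r3 r"
    have r4: "0 < r4" "r4 \<le> r3" "r4 \<le> r" using r3 r by (auto simp: r4_def)
    show "\<forall>\<^sub>F p in nhds (0, 0). p \<in> \<Gamma> \<longleftrightarrow> F p \<in> \<Gamma>'"
      using \<Gamma>r[OF r4(1,3)] G(2) close[OF r4(1)]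
    proof eventually_elim
      case (elim p)
      show ?case
      proof
        assume "p \<in> \<Gamma>"
        then obtain t where t: "t \<in> ball 0 r4" "p = ?\<phi> t" using elim by blast
        then have "t \<in> ball 0 r3" using r4 by auto
        then show "F p \<in> \<Gamma>'" using r3(2)[of t] t unfolding \<Gamma>'_def by blast
      next
        assume "F p \<in> \<Gamma>'"
        then obtain t where t: "t \<in> ball 0 r'" "F p = ?\<psi> t" unfolding \<Gamma>'_def by blast
        then have "t \<in> ball 0 r1" using r' by auto
        then have p: "p = ?\<phi> (\<rho> t)" using r1(2)[of t] t(2) elim by metis
        then have "norm (\<rho> t) < r4" using elim lt[of "\<rho> t" r4] r4(1) by (simp add: fst_puiseux)
        then show "p \<in> \<Gamma>" using p elim by auto
      qed
    qed
  qed
  ultimately show ?thesis by blast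
qed

lemma analytic_local_inverse:
  assumes \<sigma>: "\<sigma> analytic_on {0}" "\<sigma> 0 = 0" "deriv \<sigma> 0 \<noteq> 0"
  obtains \<rho> where "\<rho> analytic_on {0}" "\<rho> 0 = 0" "deriv \<sigma> 0 * deriv \<rho> 0 = 1"
    "\<forall>\<^sub>F t in nhds 0. \<rho> (\<sigma> t) = t" "\<forall>\<^sub>F t in nhds 0. \<sigma> (\<rho> t) = t"
proof -
  obtain r0 where r0: "0 < r0" "\<sigma> holomorphic_on ball 0 r0" using \<sigma>(1) by (rule analytic_at_0_ball)
  have "0 \<in> ball 0 r0" using r0 by simp
  then obtain r where r: "r > 0" "ball (0::complex) r \<subseteq> ball 0 r0" "open (\<sigma> ` ball 0 r)" "inj_on \<sigma> (ball 0 r)"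
    by (rule has_complex_derivative_locally_invertible[OF r0(2) _ open_ball \<sigma>(3)]) (rule that)
  have hol: "\<sigma> holomorphic_on ball 0 r" using r0(2) r(2) by (rule holomorphic_on_subset)
  obtain \<rho> where \<rho>: "\<rho> holomorphic_on \<sigma> ` ball 0 r" "\<And>z. z \<in> ball 0 r \<Longrightarrow> deriv \<sigma> z * deriv \<rho> (\<sigma> z) = 1"
    "\<And>z. z \<in> ball 0 r \<Longrightarrow> \<rho> (\<sigma> z) = z"
    by (rule holomorphic_has_inverse[OF hol open_ball r(4)]) (rule that)
  have 0: "0 \<in> ball 0 r" "0 \<in> \<sigma> ` ball 0 r" using r(1) \<sigma>(2) by (auto intro!: image_eqI[of _ _ 0])
  show thesis
  proof (rule that)
    show "\<rho> analytic_on {0}" using \<rho>(1) r(3) 0 by (auto simp: analytic_at)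
    show "\<rho> 0 = 0" using \<rho>(3)[OF 0(1)] \<sigma>(2) by simp
    show "deriv \<sigma> 0 * deriv \<rho> 0 = 1" using \<rho>(2)[OF 0(1)] \<sigma>(2) by simp
    show "\<forall>\<^sub>F t in nhds 0. \<rho> (\<sigma> t) = t"
      by (rule eventually_mono[OF eventually_nhds_in_open[OF open_ball 0(1)]]) (rule \<rho>(3))
    show "\<forall>\<^sub>F t in nhds 0. \<sigma> (\<rho> t) = t"
      by (rule eventually_mono[OF eventually_nhds_in_open[OF r(3) 0(2)]]) (use \<rho>(3) in auto)
  qed
qed

text \<open>Splitting off \<open>t^k\<close> from \<open>F\<close> and \<open>t\<close> from
  \<open>R\<close> leaves a factor of \<open>R\<close> with constant term 1, so the composite is
  \<open>t^k\<close> times a series whose constant term is the coefficient of \<open>F\<close> at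
  \<open>k\<close>. A change of parameter tangent to the identity thus keeps the leading
  coefficient.\<close>

lemma fps_compose_low:
  fixes F R :: "complex fps"
  assumes F: "\<And>i. i < k \<Longrightarrow> fps_nth F i = 0" and R: "fps_nth R 0 = 0" "fps_nth R 1 = 1"
  shows "i < k \<Longrightarrow> fps_nth (F oo R) i = 0" "fps_nth (F oo R) k = fps_nth F k"
proof -
  have F': "F = fps_shift k F * fps_X ^ k"
    by (rule fps_ext) (use F in \<open>auto simp: fps_X_power_mult_right_nth\<close>)
  have R': "R = fps_X * fps_shift 1 R"
    by (rule fps_ext) (use R in \<open>auto simp: fps_X_mult_nth\<close>)
  have "fps_X ^ k oo R = R ^ k"
    using fps_compose_power[OF R(1), of fps_X k] by (simp add: fps_X_fps_compose_startby0[OF R(1)])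
  then have "F oo R = (fps_shift k F oo R) * R ^ k"
    by (subst F') (simp add: fps_compose_mult_distrib[OF R(1)])
  also have "R ^ k = fps_X ^ k * fps_shift 1 R ^ k" by (subst R') (simp add: power_mult_distrib)
  finally have e: "F oo R = fps_X ^ k * ((fps_shift k F oo R) * fps_shift 1 R ^ k)" by (simp add: mult_ac)
  show "i < k \<Longrightarrow> fps_nth (F oo R) i = 0" unfolding e by (simp add: fps_X_power_mult_nth)
  show "fps_nth (F oo R) k = fps_nth F k"
    unfolding e using R by (simp add: fps_X_power_mult_nth fps_power_zeroth)
qed

context elimination
begin

text \<open>The image curve is brought back to Puiseux form by the parameter
  \<open>\<sigma>\<close>, an \<open>n\<close>-th root of its first coordinate. Since
  \<open>\<sigma>\<close> is tangent to the identity, the displacement \<open>c s t^k\<close> keeps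
  its leading coefficient in the new parameter.\<close>

lemma flow_normal_form:
  obtains F \<sigma> \<rho> \<psi> \<Psi> where "is_time_flow X s F" "biholomorphism_germ F"
    "\<sigma> analytic_on {0}" "\<sigma> 0 = 0" "deriv \<sigma> 0 = 1" "\<rho> analytic_on {0}" "\<rho> 0 = 0" "deriv \<rho> 0 = 1"
    "\<forall>\<^sub>F t in nhds 0. \<rho> (\<sigma> t) = t" "\<forall>\<^sub>F t in nhds 0. \<sigma> (\<rho> t) = t"
    "\<psi> has_fps_expansion \<Psi>" "\<And>i. i < k \<Longrightarrow> fps_nth \<Psi> i = fps_nth Y i" "fps_nth \<Psi> k = fps_nth Y k + c * s"
    "\<forall>\<^sub>F t in nhds 0. F (t ^ n, y t) = (\<sigma> t ^ n, \<psi> (\<sigma> t))"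
proof -
  obtain \<delta> K g R where fl: "0 < \<delta>" "1 \<le> K" "\<delta> * K \<le> 1" "norm s < R"
    "\<And>p. norm p < \<delta> \<Longrightarrow> g p 0 = p" "\<And>p. norm p < \<delta> \<Longrightarrow> solves_on X (g p) (ball 0 R)"
    "\<And>p z. norm p < \<delta> \<Longrightarrow> z \<in> ball 0 R \<Longrightarrow> norm (g p z) \<le> K * norm p"
    "biholomorphism_germ (\<lambda>p. g p s)" "is_time_flow X s (\<lambda>p. g p s)"
    by (rule flow_biholomorphism[of s]) (rule that)
  define F where "F = (\<lambda>p. g p s)"
  define e where "e = root1 n"
  obtain C where C: "\<forall>\<^sub>F t in at 0. norm (fst (F (t ^ n, y t)) - t ^ n) \<le> C * norm t ^ (n + 1) \<and>
    norm (snd (F (t ^ n, y t)) - y (t * e (fst (F (t ^ n, y t)) / t ^ n)) - c * s * t ^ k) \<le> C * norm t ^ (k + 1)"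
    using displacement[OF fl(1,2,4-7)] unfolding F_def e_def by blast
  have F: "biholomorphism_germ F" "is_time_flow X s F" using fl(8,9) unfolding F_def by auto
  have y0: "y 0 = 0" using has_fps_expansion_nth_0[OF y] Y_low[of 0] nm by simp
  have cg: "curve_germ (\<lambda>t. (t ^ n, y t))"
    unfolding curve_germ_def using n y0 has_fps_expansion_imp_analytic_0[OF y] by (auto intro!: analytic_intros)
  obtain U where U: "open U" "(0,0) \<in> U" "holomorphic2_map_on F U" using biholomorphism_germ_map(1)[OF F(1)] by blast
  have F0: "F (0,0) = (0,0)" by (rule biholomorphism_germ_map(2)[OF F(1)])
  have "holomorphic2_germ (\<lambda>p. fst (F p))" "holomorphic2_germ (\<lambda>p. snd (F p))"
    using U unfolding holomorphic2_germ_def holomorphic2_map_on_def by blast+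
  from this[THEN holomorphic2_germ_curve_analytic[OF _ cg]]
  have an: "(\<lambda>t. fst (F (t ^ n, y t))) analytic_on {0}" "(\<lambda>t. snd (F (t ^ n, y t))) analytic_on {0}" by auto
  define G where "G = fps_expansion (\<lambda>t. fst (F (t ^ n, y t))) 0"
  have G: "(\<lambda>t. fst (F (t ^ n, y t))) has_fps_expansion G"
    unfolding G_def by (rule analytic_at_imp_has_fps_expansion_0[OF an(1)])
  have "(\<lambda>t. fst (F (t ^ n, y t)) - t ^ n) has_fps_expansion G - fps_X ^ n"
    by (intro has_fps_expansion_diff G has_fps_expansion_fps_X_power)
  from has_fps_expansion_bigoD[OF this eventually_mono[OF C]]
  have "fps_nth (G - fps_X ^ n) i = 0" if "i < n + 1" for i using that by blast
  then have Gi: "fps_nth G i = (if i = n then 1 else 0)" if "i < n + 1" for i using that by fastforce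
  \<comment> \<open>The value at 0 fills the removable singularity: the first coordinate has leading
    term \<open>t^n\<close>.\<close>
  define W where "W = (\<lambda>t. if t = 0 then 1 else fst (F (t ^ n, y t)) / t ^ n)"
  have W: "W has_fps_expansion fps_shift n G"
  proof -
    have "subdegree G = n" by (rule subdegreeI) (simp_all add: Gi)
    then show ?thesis unfolding W_def using Gi[of n] by (intro has_fps_expansion_shift[OF G]) auto
  qed
  have W0: "W 0 = 1" by (simp add: W_def)
  have Wan: "W analytic_on {0}" by (rule has_fps_expansion_imp_analytic_0[OF W])
  have "e analytic_on {1}"
  proof -
    have "(e has_field_derivative e w / (of_nat n * w)) (at w)" if "w \<in> ball 1 1" for w
      using root1_deriv[OF _ n, of w] that by (simp add: e_def dist_norm norm_minus_commute)
    then have "e holomorphic_on ball 1 1" unfolding holomorphic_on_open[OF open_ball] by blast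
    then show ?thesis by (auto simp: analytic_at intro!: exI[of _ "ball 1 1"])
  qed
  then have eW: "(\<lambda>t. e (W t)) analytic_on {0}"
    using analytic_on_compose[OF Wan, of e] W0 by (simp add: o_def)
  define \<sigma> where "\<sigma> = (\<lambda>t. t * e (W t))"
  have \<sigma>an: "\<sigma> analytic_on {0}" unfolding \<sigma>_def by (intro analytic_intros eW)
  have \<sigma>0: "\<sigma> 0 = 0" by (simp add: \<sigma>_def)
  have \<sigma>1: "deriv \<sigma> 0 = 1"
  proof -
    have "(\<lambda>t. e (W t)) field_differentiable at 0"
      by (rule analytic_on_imp_differentiable_at[OF eW]) simp
    then obtain d where "((\<lambda>t. e (W t)) has_field_derivative d) (at 0)"
      unfolding field_differentiable_def by blast
    from DERIV_mult[OF DERIV_ident this] have "(\<sigma> has_field_derivative 1) (at 0)"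
      unfolding \<sigma>_def by (simp add: W0 e_def root1_1)
    then show ?thesis by (rule DERIV_imp_deriv)
  qed
  obtain \<rho> where \<rho>: "\<rho> analytic_on {0}" "\<rho> 0 = 0" "deriv \<sigma> 0 * deriv \<rho> 0 = 1"
    "\<forall>\<^sub>F t in nhds 0. \<rho> (\<sigma> t) = t" "\<forall>\<^sub>F t in nhds 0. \<sigma> (\<rho> t) = t"
    by (rule analytic_local_inverse[OF \<sigma>an \<sigma>0]) (use \<sigma>1 in auto)
  have \<rho>1: "deriv \<rho> 0 = 1" using \<rho>(3) \<sigma>1 by simp
  define D where "D = (\<lambda>t. snd (F (t ^ n, y t)) - y (\<sigma> t))"
  have "(\<lambda>t. y (\<sigma> t)) analytic_on {0}"
    using analytic_on_compose[OF \<sigma>an, of y] has_fps_expansion_imp_analytic_0[OF y] \<sigma>0 by (simp add: o_def)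
  then have "D analytic_on {0}" unfolding D_def by (intro analytic_intros an)
  then obtain FD where FD: "D has_fps_expansion FD" using analytic_at_imp_has_fps_expansion_0 by blast
  have "(\<lambda>t. D t - c * s * t ^ k) has_fps_expansion FD - fps_const (c * s) * fps_X ^ k"
    by (intro has_fps_expansion_diff FD has_fps_expansion_cmult_left has_fps_expansion_fps_X_power)
  moreover have "\<forall>\<^sub>F t in at 0. norm (D t - c * s * t ^ k) \<le> C * norm t ^ (k + 1)"
    using C eventually_at_filter[of "\<lambda>x. x \<noteq> 0" 0 UNIV, simplified]
    by eventually_elim (auto simp: D_def \<sigma>_def W_def)
  ultimately have "fps_nth (FD - fps_const (c * s) * fps_X ^ k) i = 0" if "i < k + 1" for i
    using has_fps_expansion_bigoD that by blast
  then have FDi: "fps_nth FD i = (if i = k then c * s else 0)" if "i < k + 1" for i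
    using that by (fastforce split: if_splits)
  define Rh where "Rh = fps_expansion \<rho> 0"
  have Rh: "\<rho> has_fps_expansion Rh" unfolding Rh_def by (rule analytic_at_imp_has_fps_expansion_0[OF \<rho>(1)])
  have Rh0: "fps_nth Rh 0 = 0" using has_fps_expansion_nth_0[OF Rh] \<rho>(2) by simp
  have Rh1: "fps_nth Rh 1 = 1" using fps_nth_fps_expansion[OF Rh, of 1] \<rho>1 by simp
  \<comment> \<open>\<open>D\<close> is the deviation of the second coordinate from
    \<open>y (\<sigma> t)\<close>; hence \<open>\<psi> (\<sigma> t)\<close> is that coordinate near
    0.\<close>
  define \<psi> where "\<psi> = (\<lambda>t. y t + (D \<circ> \<rho>) t)"
  have \<psi>: "\<psi> has_fps_expansion Y + (FD oo Rh)"
    unfolding \<psi>_def by (intro has_fps_expansion_add y has_fps_expansion_compose FD Rh Rh0)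
  have low: "fps_nth (FD oo Rh) i = 0" if "i < k" for i
    by (rule fps_compose_low(1)[OF _ Rh0 Rh1 that]) (use FDi in auto)
  have at_k: "fps_nth (FD oo Rh) k = c * s"
    using fps_compose_low(2)[OF _ Rh0 Rh1, of k FD] FDi by auto
  have ev: "\<forall>\<^sub>F t in nhds 0. F (t ^ n, y t) = (\<sigma> t ^ n, \<psi> (\<sigma> t))"
  proof -
    have "\<forall>\<^sub>F t in nhds 0. W t \<in> ball 1 1"
    proof -
      have "(W \<longlongrightarrow> 1) (nhds 0)" using isCont_tendsto_nhds[OF analytic_at_imp_isCont[OF Wan]] W0 by simp
      then show ?thesis by (rule topological_tendstoD) auto
    qed
    then show ?thesis using \<rho>(4)
    proof eventually_elim
      case (elim t)
      have 1: "\<psi> (\<sigma> t) = snd (F (t ^ n, y t))" using elim by (simp add: \<psi>_def D_def)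
      have "W t \<noteq> 0" using elim by auto
      then have "e (W t) ^ n = W t" unfolding e_def by (rule root1_power[OF n])
      then have "\<sigma> t ^ n = fst (F (t ^ n, y t))"
        using n y0 F0 by (cases "t = 0") (auto simp: \<sigma>_def power_mult_distrib W_def power_0_left)
      with 1 show ?case by (simp add: prod_eq_iff)
    qed
  qed
  show thesis
    by (rule that[OF F(2,1) \<sigma>an \<sigma>0 \<sigma>1 \<rho>(1,2) \<rho>1 \<rho>(4,5) \<psi> _ _ ev]) (use low at_k in auto)
qed

end

section \<open>Elimination of one term\<close>

lemma poly2_fps:
  assumes "u has_fps_expansion U" "v has_fps_expansion V"
  shows "(\<lambda>t. poly2 N c (u t, v t)) has_fps_expansion (\<Sum>i<N. \<Sum>j<N. fps_const (c i j) * (U ^ i * V ^ j))"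
  unfolding poly2_def fst_conv snd_conv
  by (intro has_fps_expansion_sum has_fps_expansion_cmult_left has_fps_expansion_mult has_fps_expansion_power assms)

lemma curve_germ_norm_bound:
  assumes "curve_germ \<phi>"
  shows "\<exists>C>0. \<forall>\<^sub>F t in nhds 0. norm (\<phi> t) \<le> C * norm t"
proof -
  obtain U V where UV: "(\<lambda>t. fst (\<phi> t)) has_fps_expansion U" "(\<lambda>t. snd (\<phi> t)) has_fps_expansion V"
    "fps_nth U 0 = 0" "fps_nth V 0 = 0" using curve_germ_fps[OF assms] by blast
  obtain C where C: "0 < C" "\<forall>\<^sub>F t in nhds 0. norm (fst (\<phi> t)) \<le> C * norm t ^ 1"
    by (rule has_fps_expansion_bigoI[OF UV(1), of 1]) (use UV(3) in \<open>auto intro: that\<close>)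
  obtain D where D: "0 < D" "\<forall>\<^sub>F t in nhds 0. norm (snd (\<phi> t)) \<le> D * norm t ^ 1"
    by (rule has_fps_expansion_bigoI[OF UV(2), of 1]) (use UV(4) in \<open>auto intro: that\<close>)
  have "\<forall>\<^sub>F t in nhds 0. norm (\<phi> t) \<le> (C + D) * norm t"
    using C(2) D(2)
  proof eventually_elim
    case (elim t)
    then show ?case using norm_Pair_le[of "fst (\<phi> t)" "snd (\<phi> t)"] by (simp add: distrib_right)
  qed
  then show ?thesis using C(1) D(1) by (intro exI[of _ "C + D"]) auto
qed

text \<open>On the curve \<open>norm (\<phi> t)\<close> is \<open>O(t)\<close>, so the two-variable
  error \<open>O(norm p ^ N)\<close> becomes \<open>O(t^N)\<close>. This allows orders on the branch
  to be computed with polynomials.\<close>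

lemma taylor_along_curve:
  assumes f: "holomorphic2_germ f" and \<phi>: "curve_germ \<phi>" and F: "(\<lambda>t. f (\<phi> t)) has_fps_expansion F"
    and U: "(\<lambda>t. fst (\<phi> t)) has_fps_expansion U" and V: "(\<lambda>t. snd (\<phi> t)) has_fps_expansion V"
  shows "\<exists>c. \<forall>i<N. fps_nth F i = fps_nth (\<Sum>i<N. \<Sum>j<N. fps_const (c i j) * (U ^ i * V ^ j)) i"
proof -
  obtain c C where c: "0 \<le> C" "\<forall>\<^sub>F p in nhds (0,0). norm (f p - poly2 N c p) \<le> C * norm p ^ N"
    using holomorphic2_germ_taylor[OF f] by blast
  obtain D where D: "0 < D" "\<forall>\<^sub>F t in nhds 0. norm (\<phi> t) \<le> D * norm t"
    using curve_germ_norm_bound[OF \<phi>] by blast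
  let ?P = "\<Sum>i<N. \<Sum>j<N. fps_const (c i j) * (U ^ i * V ^ j)"
  have "(\<lambda>t. poly2 N c (\<phi> t)) has_fps_expansion ?P" using poly2_fps[OF U V, of N c] by simp
  then have "(\<lambda>t. f (\<phi> t) - poly2 N c (\<phi> t)) has_fps_expansion F - ?P" by (rule has_fps_expansion_diff[OF F])
  moreover have "\<forall>\<^sub>F t in nhds 0. norm (f (\<phi> t) - poly2 N c (\<phi> t)) \<le> (C * D ^ N) * norm t ^ N"
    using curve_germ_eventually[OF \<phi> c(2)] D(2)
  proof eventually_elim
    case (elim t)
    have "C * norm (\<phi> t) ^ N \<le> C * (D * norm t) ^ N" using elim(2) c(1) by (intro mult_left_mono power_mono) auto
    with elim(1) show ?case by (simp add: power_mult_distrib mult_ac)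
  qed
  then have "\<forall>\<^sub>F t in at 0. norm (f (\<phi> t) - poly2 N c (\<phi> t)) \<le> (C * D ^ N) * norm t ^ N"
    by (auto simp: eventually_at_filter elim: eventually_mono)
  ultimately have "fps_nth (F - ?P) i = 0" if "i < N" for i using has_fps_expansion_bigoD that by blast
  then show ?thesis by (intro exI[of _ c]) auto
qed

context puiseux_fps
begin

lemma form_coeff_fps:
  "fps_nth (fps_X * ((\<Sum>i<N. \<Sum>j<N. fps_const (A i j) * ((fps_X ^ n) ^ i * Y ^ j)) * fps_deriv (fps_X ^ n)
     + (\<Sum>i<N. \<Sum>j<N. fps_const (B i j) * ((fps_X ^ n) ^ i * Y ^ j)) * fps_deriv Y)) w = form_coeff N A B w"
proof -
  have d: "fps_X * fps_deriv (fps_X ^ n) = fps_const (of_nat n) * (fps_X ^ n :: complex fps)"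
    by (rule fps_ext) (use n in \<open>auto simp: fps_X_mult_nth split: if_splits\<close>)
  have "fps_X * ((\<Sum>i<N. \<Sum>j<N. fps_const (A i j) * ((fps_X ^ n) ^ i * Y ^ j)) * fps_deriv (fps_X ^ n)
     + (\<Sum>i<N. \<Sum>j<N. fps_const (B i j) * ((fps_X ^ n) ^ i * Y ^ j)) * fps_deriv Y)
    = (\<Sum>i<N. \<Sum>j<N. fps_const (A i j) * ((fps_X ^ n) ^ i * Y ^ j)) * (fps_X * fps_deriv (fps_X ^ n))
     + (\<Sum>i<N. \<Sum>j<N. fps_const (B i j) * ((fps_X ^ n) ^ i * Y ^ j)) * (fps_X * fps_deriv Y)"
    by (simp add: distrib_left mult_ac)
  also have "\<dots> = (\<Sum>i<N. \<Sum>j<N. fps_const (of_nat n * A i j) * (fps_X ^ (n * Suc i) * Y ^ j)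
      + fps_const (B i j) * (fps_X ^ (n * i) * (Y ^ j * fps_XD Y)))"
  proof -
    have t1: "fps_const (A i j) * ((fps_X ^ n) ^ i * Y ^ j) * (fps_const (of_nat n) * fps_X ^ n)
        = fps_const (of_nat n * A i j) * (fps_X ^ (n * Suc i) * Y ^ j)" for i j
      by (simp only: power_mult[symmetric] mult_Suc_right power_add fps_const_mult[symmetric] mult_ac)
    have t2: "fps_const (B i j) * ((fps_X ^ n) ^ i * Y ^ j) * (fps_X * fps_deriv Y)
        = fps_const (B i j) * (fps_X ^ (n * i) * (Y ^ j * fps_XD Y))" for i j
      by (simp only: power_mult[symmetric] fps_XD_def o_def mult_ac)
    show ?thesis unfolding d sum.distrib sum_distrib_right by (simp only: t1 t2)
  qed
  finally show ?thesis
    unfolding form_coeff_def sum.cartesian_product[symmetric]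
    by (simp add: fps_sum_nth dx_coeff_def dy_coeff_def fps_mult_left_const_nth del: mult_Suc_right)
qed

lemma fun_coeff_fps:
  "fps_nth (\<Sum>i<N. \<Sum>j<N. fps_const (c i j) * ((fps_X ^ n) ^ i * Y ^ j)) w = fun_coeff N c w"
  unfolding fun_coeff_def sum.cartesian_product[symmetric]
  by (simp add: fps_sum_nth fps_mult_left_const_nth power_mult)

text \<open>Truncation of the coefficients of a form at order \<open>w + 2\<close> leaves all
  exponents up to \<open>w\<close> untouched, so polynomial forms realise every contact order. The
  bound \<open>2 \<le> N\<close> keeps the linear coefficients in range.\<close>

lemma contact_orders_form_coeff:
  assumes a: "conv_radius a > 0" and Y: "Y = puiseux_series m a"
  shows "w \<in> contact_orders (puiseux n m a) \<longleftrightarrow>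
    (\<exists>N A B. 2 \<le> N \<and> form_coeff N A B w \<noteq> 0 \<and> (\<forall>u<w. form_coeff N A B u = 0))" (is "_ = ?R")
proof -
  let ?\<phi> = "puiseux n m a"
  have \<phi>: "curve_germ ?\<phi>" using puiseux_curve_germ a n nm by auto
  have V: "(\<lambda>t. snd (?\<phi> t)) has_fps_expansion Y" unfolding Y by (rule snd_puiseux_fps[OF a])
  have U: "(\<lambda>t. fst (?\<phi> t)) has_fps_expansion fps_X ^ n"
    unfolding fst_puiseux by (rule has_fps_expansion_fps_X_power)
  define P where "P = (\<lambda>N c. \<Sum>i<N. \<Sum>j<N. fps_const (c i j) * ((fps_X ^ n) ^ i * Y ^ j))"
  define FF where "FF = (\<lambda>N A B. P N A * fps_deriv (fps_X ^ n) + P N B * fps_deriv Y)"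
  have fc: "form_coeff N A B (Suc u) = fps_nth (FF N A B) u" "form_coeff N A B 0 = 0" for N A B u
    unfolding form_coeff_fps[symmetric] FF_def P_def by (simp_all add: fps_X_mult_nth)
  show ?thesis
  proof
    assume "w \<in> contact_orders ?\<phi>"
    then obtain A B F where AB: "holomorphic2_germ A" "holomorphic2_germ B" and
      F: "form_pullback ?\<phi> A B has_fps_expansion F" "F \<noteq> 0" "subdegree F + 1 = w"
      unfolding contact_orders_iff[OF \<phi>] by blast
    define FA where "FA = fps_expansion (\<lambda>t. A (?\<phi> t)) 0"
    define FB where "FB = fps_expansion (\<lambda>t. B (?\<phi> t)) 0"
    have FA: "(\<lambda>t. A (?\<phi> t)) has_fps_expansion FA" and FB: "(\<lambda>t. B (?\<phi> t)) has_fps_expansion FB"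
      unfolding FA_def FB_def
      using analytic_at_imp_has_fps_expansion_0 holomorphic2_germ_curve_analytic AB \<phi> by blast+
    have FE: "F = FA * fps_deriv (fps_X ^ n) + FB * fps_deriv Y"
      by (rule has_fps_expansion_unique[OF F(1) form_pullback_fps[OF FA FB U V]])
    obtain cA where cA: "\<forall>i<w + 2. fps_nth FA i = fps_nth (P (w + 2) cA) i"
      using taylor_along_curve[OF AB(1) \<phi> FA U V, of "w + 2"] unfolding P_def by blast
    obtain cB where cB: "\<forall>i<w + 2. fps_nth FB i = fps_nth (P (w + 2) cB) i"
      using taylor_along_curve[OF AB(2) \<phi> FB U V, of "w + 2"] unfolding P_def by blast
    have eq: "fps_nth (FF (w + 2) cA cB) u = fps_nth F u" if "u < w + 2" for u
      unfolding FE FF_def fps_add_nth fps_mult_nth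
      by (intro arg_cong2[of _ _ _ _ "(+)"] sum.cong) (use cA cB that in auto)
    show ?R
    proof (intro exI conjI)
      show "2 \<le> w + 2" by simp
      show "form_coeff (w + 2) cA cB w \<noteq> 0"
        using F(2,3) eq[of "subdegree F"] fc(1)[of "w + 2" cA cB "subdegree F"] by auto
      show "\<forall>u<w. form_coeff (w + 2) cA cB u = 0"
      proof (intro allI impI)
        fix u assume u: "u < w"
        show "form_coeff (w + 2) cA cB u = 0"
        proof (cases u)
          case (Suc v)
          then show ?thesis using u F(3) eq[of v] fc(1)[of "w + 2" cA cB v] nth_less_subdegree_zero[of v F] by auto
        qed (simp add: fc(2))
      qed
    qed
  next
    assume ?R
    then obtain N A B where R: "form_coeff N A B w \<noteq> 0" "\<And>u. u < w \<Longrightarrow> form_coeff N A B u = 0" by blast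
    obtain v where v: "w = Suc v" using R(1) fc(2) by (cases w) auto
    have PP: "(\<lambda>t. poly2 N c (?\<phi> t)) has_fps_expansion P N c" for c
      unfolding P_def using poly2_fps[OF U V, of N c] by simp
    have F: "form_pullback ?\<phi> (poly2 N A) (poly2 N B) has_fps_expansion FF N A B"
      unfolding FF_def by (rule form_pullback_fps[OF PP PP U V])
    have "subdegree (FF N A B) = v"
      using R v fc(1)[of N A B] by (intro subdegreeI) (metis, metis Suc_mono)
    moreover have "FF N A B \<noteq> 0" using R(1) v fc(1)[of N A B v] by auto
    ultimately show "w \<in> contact_orders ?\<phi>"
      unfolding contact_orders_iff[OF \<phi>] using F holomorphic2_germ_poly2 v by (metis Suc_eq_plus1)
  qed
qed

lemma branch_semigroup_fun_coeff:
  assumes a: "conv_radius a > 0" and Y: "Y = puiseux_series m a" and e: "e \<in> branch_semigroup (puiseux n m a)"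
  shows "\<exists>N c. 2 \<le> N \<and> fun_coeff N c e \<noteq> 0 \<and> (\<forall>u<e. fun_coeff N c u = 0)"
proof -
  let ?\<phi> = "puiseux n m a"
  have \<phi>: "curve_germ ?\<phi>" using puiseux_curve_germ a n nm by auto
  have V: "(\<lambda>t. snd (?\<phi> t)) has_fps_expansion Y" unfolding Y by (rule snd_puiseux_fps[OF a])
  have U: "(\<lambda>t. fst (?\<phi> t)) has_fps_expansion fps_X ^ n"
    unfolding fst_puiseux by (rule has_fps_expansion_fps_X_power)
  obtain f F where f: "holomorphic2_germ f" "(\<lambda>t. f (?\<phi> t)) has_fps_expansion F" "F \<noteq> 0" "subdegree F = e"
    using e unfolding branch_semigroup_iff[OF \<phi>] by blast
  obtain c where c: "\<forall>i<e + 2. fps_nth F i = fun_coeff (e + 2) c i"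
    using taylor_along_curve[OF f(1) \<phi> f(2) U V, of "e + 2"] unfolding fun_coeff_fps by blast
  have "fun_coeff (e + 2) c e \<noteq> 0"
    using c[rule_format, of e] f(3,4) nth_subdegree_nonzero[of F] by simp
  moreover have "fun_coeff (e + 2) c u = 0" if "u < e" for u
    using c[rule_format, of u] f(4) that nth_less_subdegree_zero[of u F] by simp
  ultimately show ?thesis by (intro exI[of _ "e + 2"] exI[of _ c]) simp
qed

lemma monomial_in_branch_semigroup:
  assumes a: "conv_radius a > 0" and Y: "Y = puiseux_series m a"
  shows "i * n + j * m \<in> branch_semigroup (puiseux n m a)"
proof -
  let ?\<phi> = "puiseux n m a"
  have \<phi>: "curve_germ ?\<phi>" using puiseux_curve_germ a n nm by auto
  have V: "(\<lambda>t. snd (?\<phi> t)) has_fps_expansion Y" unfolding Y by (rule snd_puiseux_fps[OF a])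
  have U: "(\<lambda>t. fst (?\<phi> t)) has_fps_expansion fps_X ^ n"
    unfolding fst_puiseux by (rule has_fps_expansion_fps_X_power)
  have F: "(\<lambda>t. fst (?\<phi> t) ^ i * snd (?\<phi> t) ^ j) has_fps_expansion fps_X ^ (n * i) * Y ^ j"
    unfolding power_mult by (intro has_fps_expansion_mult has_fps_expansion_power U V)
  have "holomorphic2_on (\<lambda>p. fst p ^ i * snd p ^ j) UNIV" by (intro holomorphic2_intros)
  then have h: "holomorphic2_germ (\<lambda>p. fst p ^ i * snd p ^ j)"
    unfolding holomorphic2_germ_def by (intro exI[of _ UNIV]) auto
  let ?M = "fps_X ^ (n * i) * Y ^ j"
  have lead: "fps_nth ?M (i * n + j * m) = 1" by (rule mono_coeff_lead)
  have "fps_nth ?M u = 0" if "u < i * n + j * m" for u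
  proof (rule ccontr)
    assume "fps_nth ?M u \<noteq> 0"
    from mono_coeff_nonzero[OF this] that mi show False by auto
  qed
  then have "subdegree ?M = i * n + j * m" using lead by (intro subdegreeI) auto
  moreover have "?M \<noteq> 0" using lead by (metis fps_zero_nth zero_neq_one)
  ultimately show ?thesis unfolding branch_semigroup_iff[OF \<phi>] using h F by blast
qed

end

lemma invariants_eq:
  assumes c: "curve_germ \<phi>" "curve_germ \<psi>" and F: "biholomorphism_germ F"
    and \<sigma>: "\<sigma> analytic_on {0}" "\<sigma> 0 = 0" "deriv \<sigma> 0 \<noteq> 0" and \<rho>: "\<rho> analytic_on {0}" "\<rho> 0 = 0" "deriv \<rho> 0 \<noteq> 0"
    and inv: "\<forall>\<^sub>F t in nhds 0. \<sigma> (\<rho> t) = t" and eq: "\<forall>\<^sub>F t in nhds 0. F (\<phi> t) = \<psi> (\<sigma> t)"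
  shows "branch_semigroup \<phi> = branch_semigroup \<psi>" "contact_orders \<phi> = contact_orders \<psi>"
proof -
  obtain G where G: "biholomorphism_germ G" "\<forall>\<^sub>F p in nhds (0,0). G (F p) = p"
    using biholomorphism_germ_inverse[OF F] by blast
  have "\<forall>\<^sub>F t in nhds 0. G (F (\<phi> t)) = \<phi> t" by (rule curve_germ_eventually[OF c(1) G(2)])
  then have "\<forall>\<^sub>F t in nhds 0. G (F (\<phi> (\<rho> t))) = \<phi> (\<rho> t)" by (rule analytic_tendsto_0[OF \<rho>(1,2)])
  moreover have "\<forall>\<^sub>F t in nhds 0. F (\<phi> (\<rho> t)) = \<psi> (\<sigma> (\<rho> t))" by (rule analytic_tendsto_0[OF \<rho>(1,2) eq])
  ultimately have "\<forall>\<^sub>F t in nhds 0. G (\<psi> t) = \<phi> (\<rho> t)" using inv by eventually_elim simp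
  from invariants_subset[OF c G(1) \<rho> this] invariants_subset[OF c(2,1) F \<sigma> eq]
  show "branch_semigroup \<phi> = branch_semigroup \<psi>" "contact_orders \<phi> = contact_orders \<psi>" by auto
qed

text \<open>The field is \<open>-B \<partial>\<^sub>x + A \<partial>\<^sub>y\<close>, dual to
  \<open>A dx + B dy\<close>. Vanishing of the form up to exponent \<open>n + m\<close> together
  with \<open>B 1 0 = 0\<close> leaves \<open>y \<partial>\<^sub>x\<close> as its only possible
  linear term.\<close>

lemma flow_elimination_step:
  assumes nm: "0 < n" "n < m" "\<not> n dvd m" and \<Gamma>: "puiseux_parametrization n m a \<Gamma>" and k: "m < k"
    and N: "2 \<le> N" and form: "puiseux_fps.form_coeff n (puiseux_series m a) N A B (k + n) \<noteq> 0"
      "\<And>u. u < k + n \<Longrightarrow> puiseux_fps.form_coeff n (puiseux_series m a) N A B u = 0"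
    and B: "B 1 0 = 0"
  shows "\<exists>a' \<Gamma>'. flow_eliminates n m k a \<Gamma> a' \<Gamma>' \<and>
    branch_semigroup (puiseux n m a') = branch_semigroup (puiseux n m a) \<and>
    contact_orders (puiseux n m a') = contact_orders (puiseux n m a)"
proof -
  define Y where "Y = puiseux_series m a"
  define y where "y = (\<lambda>t. snd (puiseux n m a t))"
  have a: "conv_radius a > 0" using \<Gamma> unfolding puiseux_parametrization_def by blast
  have y: "y has_fps_expansion Y" unfolding y_def Y_def by (rule snd_puiseux_fps[OF a])
  interpret pf: puiseux_fps n m "Suc m" Y
    by unfold_locales (use nm in \<open>auto simp: Y_def puiseux_series_nth\<close>)
  note form = form[folded Y_def]
  have low: "A 0 0 = 0" "A 1 0 = 0" "B 0 0 = 0" "of_nat n * A 0 1 + of_nat m * B 1 0 = 0"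
    using pf.form_coeff_low[OF N, of A B] form(2) k by auto
  then have A01: "A 0 1 = 0" using B nm by simp
  \<comment> \<open>The division by \<open>n\<close> matches the factor in \<open>ord\<close>, which
    comes from \<open>dx = n t^(n-1) dt\<close>.\<close>
  define c where "c = pf.form_coeff N A B (k + n) / of_nat n"
  have c: "c \<noteq> 0" using form(1) nm by (simp add: c_def)
  \<comment> \<open>The flow changes the coefficient of exponent \<open>k\<close> into
    \<open>a k + c * s\<close>.\<close>
  define s where "s = - a k / c"
  let ?B = "\<lambda>i j. - B i j"
  have mB: "poly2 N ?B p = - poly2 N B p" for p unfolding poly2_def by (simp add: sum_negf)
  let ?PA = "\<Sum>i<N. \<Sum>j<N. fps_const (A i j) * ((fps_X ^ n) ^ i * Y ^ j)"
  let ?PB = "\<Sum>i<N. \<Sum>j<N. fps_const (B i j) * ((fps_X ^ n) ^ i * Y ^ j)"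
  let ?FF = "?PA * fps_deriv (fps_X ^ n) + ?PB * fps_deriv Y"
  have dX: "deriv (\<lambda>t::complex. t ^ n) = (\<lambda>t. of_nat n * t ^ (n - 1))"
    by (rule ext, rule DERIV_imp_deriv) (auto intro!: derivative_eq_intros)
  have XX: "(\<lambda>t::complex. t ^ n) has_fps_expansion fps_X ^ n" by (rule has_fps_expansion_fps_X_power)
  have "(\<lambda>t. poly2 N A (t ^ n, y t) * deriv (\<lambda>t. t ^ n) t + poly2 N B (t ^ n, y t) * deriv y t) has_fps_expansion ?FF"
    by (intro has_fps_expansion_add has_fps_expansion_mult poly2_fps has_fps_expansion_deriv y XX)
  then have "(\<lambda>t. of_nat n * t ^ (n - 1) * poly2 N A (t ^ n, y t) - deriv y t * poly2 N ?B (t ^ n, y t)) has_fps_expansion ?FF"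
    unfolding dX mB by (simp add: mult_ac)
  then have "(\<lambda>t. of_nat n * t ^ (n - 1) * poly2 N A (t ^ n, y t) - deriv y t * poly2 N ?B (t ^ n, y t) - of_nat n * c * t ^ (k + n - 1))
      has_fps_expansion ?FF - fps_const (of_nat n * c) * fps_X ^ (k + n - 1)"
    by (intro has_fps_expansion_diff has_fps_expansion_cmult_left has_fps_expansion_fps_X_power)
  moreover have "fps_nth (?FF - fps_const (of_nat n * c) * fps_X ^ (k + n - 1)) i = 0" if "i < k + n" for i
  proof -
    have "fps_nth ?FF i = pf.form_coeff N A B (Suc i)"
      unfolding pf.form_coeff_fps[symmetric] by (simp add: fps_X_mult_nth)
    moreover have "pf.form_coeff N A B (Suc i) = (if i = k + n - 1 then of_nat n * c else 0)"
    proof (cases "i = k + n - 1")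
      case True
      then have "Suc i = k + n" using k by simp
      then show ?thesis using True nm by (simp add: c_def)
    next
      case False
      then show ?thesis using form(2)[of "Suc i"] that by auto
    qed
    ultimately show ?thesis by (simp del: power_Suc)
  qed
  ultimately have ord: "\<exists>C. \<forall>\<^sub>F t in nhds 0. norm (of_nat n * t ^ (n - 1) * poly2 N A (t ^ n, y t)
      - deriv y t * poly2 N ?B (t ^ n, y t) - of_nat n * c * t ^ (k + n - 1)) \<le> C * norm t ^ (k + n)"
    by (rule has_fps_expansion_bigoI) blast+
  interpret el: elimination N ?B A n m k y Y c s
    by unfold_locales (use N low A01 B nm k y ord pf.Y_low in auto)
  obtain F \<sigma> \<rho> \<psi> \<Psi> where fl: "is_time_flow el.X s F" "biholomorphism_germ F"
    and \<sigma>: "\<sigma> analytic_on {0}" "\<sigma> 0 = 0" "deriv \<sigma> 0 = 1" and \<rho>: "\<rho> analytic_on {0}" "\<rho> 0 = 0" "deriv \<rho> 0 = 1"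
    and inv: "\<forall>\<^sub>F t in nhds 0. \<rho> (\<sigma> t) = t" "\<forall>\<^sub>F t in nhds 0. \<sigma> (\<rho> t) = t"
    and \<psi>: "\<psi> has_fps_expansion \<Psi>" "\<And>i. i < k \<Longrightarrow> fps_nth \<Psi> i = fps_nth Y i" "fps_nth \<Psi> k = fps_nth Y k + c * s"
    and eq: "\<forall>\<^sub>F t in nhds 0. F (t ^ n, y t) = (\<sigma> t ^ n, \<psi> (\<sigma> t))"
    by (rule el.flow_normal_form) (rule that)
  define a' where "a' = fps_nth \<Psi>"
  have \<Psi>low: "fps_nth \<Psi> i = 0" if "i < m" for i using \<psi>(2)[of i] pf.Y_low[OF that] that k by simp
  have \<Psi>m: "fps_nth \<Psi> m = 1" using \<psi>(2)[of m] pf.Y_m k by simp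
  have pa': "conv_radius a' > 0" "\<forall>\<^sub>F t in nhds 0. puiseux n m a' t = (t ^ n, \<psi> t)"
    unfolding a'_def by (rule puiseux_of_fps[OF \<psi>(1) _ \<Psi>m]; fact \<Psi>low)+
  have ya: "(t ^ n, y t) = puiseux n m a t" for t by (simp add: y_def prod_eq_iff fst_puiseux)
  have eq': "\<forall>\<^sub>F t in nhds 0. F (puiseux n m a t) = puiseux n m a' (\<sigma> t)"
    using analytic_tendsto_0[OF \<sigma>(1,2) pa'(2)] eq by eventually_elim (simp add: ya)
  obtain \<Gamma>' where \<Gamma>': "puiseux_parametrization n m a' \<Gamma>'" "sends_branch F \<Gamma> \<Gamma>'"
    using puiseux_transport[OF nm(1) _ \<Gamma> pa'(1) fl(2) \<sigma>(1,2) \<rho>(1,2) inv eq'] nm by auto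
  have "a' i = a i" if "m < i" "i < k" for i using \<psi>(2)[of i] that by (simp add: a'_def Y_def puiseux_series_nth)
  moreover have "a' k = 0" using \<psi>(3) k c by (simp add: a'_def Y_def puiseux_series_nth s_def)
  ultimately have "flow_eliminates n m k a \<Gamma> a' \<Gamma>'"
    unfolding flow_eliminates_def using \<Gamma> \<Gamma>' fl(1) by blast
  moreover have "branch_semigroup (puiseux n m a) = branch_semigroup (puiseux n m a')"
    "contact_orders (puiseux n m a) = contact_orders (puiseux n m a')"
    using invariants_eq[OF puiseux_curve_germ puiseux_curve_germ fl(2) \<sigma>(1,2) _ \<rho>(1,2) _ inv(2) eq'] nm a pa'(1) \<sigma>(3) \<rho>(3)
    by auto
  ultimately show ?thesis by metis
qed

section \<open>The conductor\<close>

abbreviation unity_roots :: "nat \<Rightarrow> complex set"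
  where "unity_roots n \<equiv> {z. z ^ n = 1}"

lemma finite_unity_roots: "0 < n \<Longrightarrow> finite (unity_roots n)"
  by (rule finite_roots_unity) simp

lemma norm_unity_root:
  assumes "(z :: complex) ^ n = 1" "0 < n"
  shows "norm z = 1"
proof -
  have "norm z ^ n = 1 ^ n" using assms(1) by (simp flip: norm_power)
  then show ?thesis using assms(2) by (metis norm_ge_zero power_eq_imp_eq_base zero_le_one)
qed

text \<open>Multiplication by a primitive root \<open>w\<close> permutes the roots, so the sum is
  invariant and at the same time multiplied by \<open>w^i\<close>; it vanishes unless
  \<open>w^i = 1\<close>.\<close>

lemma sum_power_unity_roots:
  assumes n: "0 < n"
  shows "(\<Sum>\<zeta>\<in>unity_roots n. \<zeta> ^ i) = (if n dvd i then of_nat n else 0)"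
proof (cases "n dvd i")
  case True
  then obtain k where "i = n * k" by blast
  then have "(\<Sum>\<zeta>\<in>unity_roots n. \<zeta> ^ i) = (\<Sum>\<zeta>\<in>unity_roots n. 1)" by (intro sum.cong) (auto simp: power_mult)
  also have "\<dots> = of_nat n" using card_complex_roots_unity[of n] n by simp
  finally show ?thesis using True by simp
next
  case False
  define w where "w = exp (2 * of_real pi * \<i> * of_nat 1 / of_nat n)"
  have pw: "w ^ j = exp (2 * of_real pi * \<i> * of_nat j / of_nat n)" for j
    unfolding w_def exp_of_nat_mult[symmetric] by (simp add: mult_ac)
  have w: "w ^ n = 1" "w ^ i \<noteq> 1"
    using complex_root_unity_eq_1[of n n] complex_root_unity_eq_1[of n i] n False unfolding pw by auto
  have "w \<noteq> 0" by (simp add: w_def)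
  have "bij_betw (\<lambda>z. w * z) (unity_roots n) (unity_roots n)"
    by (rule bij_betw_byWitness[where f' = "\<lambda>z. z / w"])
      (use w \<open>w \<noteq> 0\<close> in \<open>auto simp: power_mult_distrib power_divide\<close>)
  then have "(\<Sum>\<zeta>\<in>unity_roots n. (w * \<zeta>) ^ i) = (\<Sum>\<zeta>\<in>unity_roots n. \<zeta> ^ i)"
    by (rule sum.reindex_bij_betw)
  then have "w ^ i * (\<Sum>\<zeta>\<in>unity_roots n. \<zeta> ^ i) = (\<Sum>\<zeta>\<in>unity_roots n. \<zeta> ^ i)"
    by (simp add: power_mult_distrib sum_distrib_left)
  then show ?thesis using w(2) False by (metis mult_cancel_right1)
qed

text \<open>The trace over the conjugates \<open>\<zeta> * t\<close> kills all powers of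
  \<open>t\<close> except those divisible by \<open>n\<close>, so it is a power series in
  \<open>t^n\<close>.\<close>

lemma average_over_unity_roots:
  assumes n: "0 < n" and r: "0 < r" and u: "u holomorphic_on ball 0 r"
  obtains H where "H holomorphic_on ball 0 (r ^ n)"
    "\<And>t. t \<in> ball 0 r \<Longrightarrow> H (t ^ n) = (\<Sum>\<zeta>\<in>unity_roots n. u (\<zeta> * t))"
proof -
  define c where "c = (\<lambda>i. (deriv ^^ i) u 0 / fact i)"
  define H where "H = (\<lambda>x. \<Sum>j. c (n * j) * of_nat n * x ^ j)"
  have nz: "norm \<zeta> = 1" if "\<zeta> \<in> unity_roots n" for \<zeta>
    using that n norm_unity_root by blast
  have s: "(\<lambda>j. c (n * j) * of_nat n * (t ^ n) ^ j) sums (\<Sum>\<zeta>\<in>unity_roots n. u (\<zeta> * t))" if t: "t \<in> ball 0 r" for t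
  proof -
    have "(\<lambda>i. c i * (\<zeta> * t) ^ i) sums u (\<zeta> * t)" if "\<zeta> \<in> unity_roots n" for \<zeta>
    proof -
      have "\<zeta> * t \<in> ball 0 r" using t nz[OF that] by (simp add: norm_mult)
      from holomorphic_power_series[OF u this] show ?thesis by (simp add: c_def)
    qed
    then have "(\<lambda>i. \<Sum>\<zeta>\<in>unity_roots n. c i * (\<zeta> * t) ^ i) sums (\<Sum>\<zeta>\<in>unity_roots n. u (\<zeta> * t))"
      by (rule sums_sum)
    moreover have "(\<Sum>\<zeta>\<in>unity_roots n. c i * (\<zeta> * t) ^ i) = c i * t ^ i * (\<Sum>\<zeta>\<in>unity_roots n. \<zeta> ^ i)" for i
      by (simp add: power_mult_distrib sum_distrib_left mult_ac)
    ultimately have "(\<lambda>i. c i * t ^ i * (if n dvd i then of_nat n else 0)) sums (\<Sum>\<zeta>\<in>unity_roots n. u (\<zeta> * t))"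
      unfolding sum_power_unity_roots[OF n] by simp
    moreover have "strict_mono (\<lambda>j. n * j)" using n by (simp add: strict_mono_def)
    moreover have "c i * t ^ i * (if n dvd i then of_nat n else 0) = 0" if "i \<notin> range (\<lambda>j. n * j)" for i
      using that by auto
    ultimately have "(\<lambda>j. c (n * j) * t ^ (n * j) * (if n dvd n * j then of_nat n else 0)) sums (\<Sum>\<zeta>\<in>unity_roots n. u (\<zeta> * t))"
      using sums_mono_reindex[of "\<lambda>j. n * j" "\<lambda>i. c i * t ^ i * (if n dvd i then of_nat n else 0)"] by blast
    then show ?thesis by (simp add: power_mult[symmetric] mult_ac)
  qed
  \<comment> \<open>Every point of \<open>ball 0 (r ^ n)\<close> is the \<open>n\<close>-th power of
    a point where convergence is known, so the series for \<open>H\<close> converges on the whole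
    ball.\<close>
  have root: "\<exists>t\<in>ball 0 r. t ^ n = x" if "x \<in> ball 0 (r ^ n)" for x :: complex
  proof (cases "x = 0")
    case True
    then show ?thesis using n r by (intro bexI[of _ 0]) (auto simp: power_0_left)
  next
    case False
    then have "root1 n x ^ n = x" using root1_power n by blast
    moreover have "norm (root1 n x) < r"
    proof (rule power_less_imp_less_base)
      show "norm (root1 n x) ^ n < r ^ n" using that \<open>root1 n x ^ n = x\<close> by (simp flip: norm_power)
    qed (use r in simp)
    ultimately show ?thesis by auto
  qed
  show thesis
  proof (rule that)
    show "H holomorphic_on ball 0 (r ^ n)"
    proof (rule power_series_holomorphic)
      fix x :: complex assume "x \<in> ball 0 (r ^ n)"
      then obtain t where "t \<in> ball 0 r" "t ^ n = x" using root by blast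
      then show "(\<lambda>j. c (n * j) * of_nat n * (x - 0) ^ j) sums H x"
        using s[of t] unfolding H_def by (simp add: sums_iff)
    qed
    show "H (t ^ n) = (\<Sum>\<zeta>\<in>unity_roots n. u (\<zeta> * t))" if "t \<in> ball 0 r" for t
      using s[OF that] unfolding H_def by (simp add: sums_iff)
  qed
qed

text \<open>With conjugates of \<open>y\<close> as the functions \<open>f a\<close>, this expands
  the interpolation product in powers of the second variable, so that the averaging can be done
  coefficient by coefficient.\<close>

lemma product_coefficients_holomorphic:
  assumes "finite A" "\<And>a. a \<in> A \<Longrightarrow> f a holomorphic_on S"
  shows "\<exists>d e. (\<forall>j. e j holomorphic_on S) \<and> (\<forall>t Y. (\<Prod>a\<in>A. (Y - f a t)) = (\<Sum>j<d. e j t * Y ^ j))"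
  using assms
proof (induction A rule: finite_induct)
  case empty
  show ?case by (intro exI[of _ 1] exI[of _ "\<lambda>_ _. 1"]) auto
next
  case (insert a A)
  then obtain d e where e: "\<And>j. e j holomorphic_on S" "\<And>t Y. (\<Prod>a\<in>A. (Y - f a t)) = (\<Sum>j<d. e j t * Y ^ j)" by auto
  define e0 where "e0 = (\<lambda>j t. if j < d then e j t else 0)"
  define e' where "e' = (\<lambda>j t. (case j of 0 \<Rightarrow> 0 | Suc i \<Rightarrow> e0 i t) - f a t * e0 j t)"
  have fa: "f a holomorphic_on S" using insert by auto
  have e0h: "e0 j holomorphic_on S" for j unfolding e0_def using e(1) by (cases "j < d") auto
  have "e' j holomorphic_on S" for j
    unfolding e'_def using e0h fa by (cases j) (auto intro!: holomorphic_intros)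
  moreover have "(\<Prod>a\<in>insert a A. (Y - f a t)) = (\<Sum>j<Suc d. e' j t * Y ^ j)" for t Y
  proof -
    have "(\<Prod>a\<in>insert a A. (Y - f a t)) = Y * (\<Sum>j<d. e j t * Y ^ j) - f a t * (\<Sum>j<d. e j t * Y ^ j)"
      using insert e(2) by (simp add: algebra_simps)
    also have "(\<Sum>j<d. e j t * Y ^ j) = (\<Sum>j<d. e0 j t * Y ^ j)" by (simp add: e0_def)
    also have "Y * (\<Sum>j<d. e0 j t * Y ^ j) = (\<Sum>j<Suc d. (case j of 0 \<Rightarrow> 0 | Suc i \<Rightarrow> e0 i t) * Y ^ j)"
      unfolding sum.lessThan_Suc_shift by (simp add: sum_distrib_left mult_ac)
    also have "(\<Sum>j<d. e0 j t * Y ^ j) = (\<Sum>j<Suc d. e0 j t * Y ^ j)" by (simp add: e0_def)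
    finally show ?thesis
      by (simp only: e'_def sum_distrib_left left_diff_distrib sum_subtractf mult.assoc)
  qed
  ultimately show ?case by (intro exI[of _ "Suc d"] exI[of _ e']) blast
qed

text \<open>Interpolation at the conjugates \<open>y(\<eta> t)\<close> of \<open>y\<close> writes every \<open>g\<close> of large order as a
  polynomial in \<open>y\<close> over the ring of convergent power series in \<open>x = t\<^sup>n\<close>.\<close>

lemma lagrange_interpolation:
  assumes n: "0 < n" and y: "y has_fps_expansion Y"
    and conj: "\<And>\<eta>. \<eta> ^ n = 1 \<Longrightarrow> \<eta> \<noteq> 1 \<Longrightarrow> \<exists>i\<le>q. fps_nth Y i * (\<eta> ^ i - 1) \<noteq> 0"
    and g: "g has_fps_expansion G" "\<And>i. i \<le> n * q \<Longrightarrow> fps_nth G i = 0"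
  obtains h where "holomorphic2_germ h" "h (0, 0) = 0" "partial2 h (0, 0) = 0"
    "\<forall>\<^sub>F t in nhds 0. h (t ^ n, y t) = g t"
proof -
  define Z where "Z = unity_roots n - {1}"
  have fin: "finite (unity_roots n)" "finite Z" using finite_unity_roots[OF n] by (auto simp: Z_def)
  have one: "unity_roots n = insert 1 Z" "1 \<notin> Z" by (auto simp: Z_def)
  have cardZ: "card Z < n" using card_complex_roots_unity[of n] n fin one by simp
  \<comment> \<open>The Lagrange denominator: the product of the differences to the other
    conjugates. Each factor has order at most \<open>q\<close> by \<open>conj\<close>, and there are
    fewer than \<open>n\<close> factors, so its order is at most \<open>n * q\<close>.\<close>
  define \<Delta> where "\<Delta> = (\<lambda>t. \<Prod>\<eta>\<in>Z. (y t - y (\<eta> * t)))"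
  define YY where "YY = (\<lambda>\<eta>. Y - (Y oo (fps_const \<eta> * fps_X)))"
  have yy: "(\<lambda>t. y t - y (\<eta> * t)) has_fps_expansion YY \<eta>" for \<eta>
  proof -
    have l: "(\<lambda>t. \<eta> * t) has_fps_expansion fps_const \<eta> * fps_X"
      by (intro has_fps_expansion_cmult_left has_fps_expansion_fps_X)
    have "(y \<circ> (\<lambda>t. \<eta> * t)) has_fps_expansion (Y oo (fps_const \<eta> * fps_X))"
      by (rule has_fps_expansion_compose[OF y l]) simp
    from has_fps_expansion_diff[OF y this] show ?thesis by (simp add: YY_def o_def)
  qed
  have YYi: "fps_nth (YY \<eta>) i = - (fps_nth Y i * (\<eta> ^ i - 1))" for \<eta> i
    unfolding YY_def fps_sub_nth fps_nth_compose_linear by (simp add: algebra_simps)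
  have YYn: "YY \<eta> \<noteq> 0 \<and> subdegree (YY \<eta>) \<le> q" if "\<eta> \<in> Z" for \<eta>
  proof -
    have "\<eta> ^ n = 1" "\<eta> \<noteq> 1" using that by (auto simp: Z_def)
    then obtain i where i: "i \<le> q" "fps_nth (YY \<eta>) i \<noteq> 0"
      using conj[of \<eta>] unfolding YYi by auto
    then show ?thesis using subdegree_leI[OF i(2)] by auto
  qed
  have \<Delta>: "\<Delta> has_fps_expansion (\<Prod>\<eta>\<in>Z. YY \<eta>)"
    unfolding \<Delta>_def by (intro has_fps_expansion_prod yy)
  have P0: "(\<Prod>\<eta>\<in>Z. YY \<eta>) \<noteq> 0" using YYn fin by simp
  have "subdegree (\<Prod>\<eta>\<in>Z. YY \<eta>) = (\<Sum>\<eta>\<in>Z. subdegree (YY \<eta>))" using YYn by (intro subdegree_prod) auto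
  also have "\<dots> \<le> (\<Sum>\<eta>\<in>Z. q)" using YYn by (intro sum_mono) auto
  also have "\<dots> \<le> n * q" using cardZ by (simp add: mult_right_mono)
  finally have sP: "subdegree (\<Prod>\<eta>\<in>Z. YY \<eta>) \<le> n * q" .
  \<comment> \<open>The value 0 at the origin is the correct one because \<open>g\<close> vanishes
    to higher order than \<open>\<Delta>\<close>.\<close>
  define \<kappa> where "\<kappa> = (\<lambda>t. if t = 0 then 0 else g t / \<Delta> t)"
  have \<kappa>an: "\<kappa> analytic_on {0}"
  proof (cases "G = 0")
    case True
    have "\<forall>\<^sub>F t in nhds 0. g t = 0" using g(1) True by (simp add: has_fps_expansion_0_iff)
    then have "\<forall>\<^sub>F t in nhds 0. \<kappa> t = 0" by eventually_elim (simp add: \<kappa>_def)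
    then have "\<kappa> has_fps_expansion 0" by (simp add: has_fps_expansion_0_iff)
    then show ?thesis by (rule has_fps_expansion_imp_analytic_0)
  next
    case False
    then have "n * q < subdegree G" using g(2) by (meson le_less_linear nth_subdegree_nonzero)
    then have lt: "subdegree (\<Prod>\<eta>\<in>Z. YY \<eta>) < subdegree G" using sP by simp
    have "\<kappa> has_fps_expansion G / (\<Prod>\<eta>\<in>Z. YY \<eta>)"
      unfolding \<kappa>_def
      by (rule has_fps_expansion_divide[OF g(1) \<Delta> less_imp_le[OF lt] P0])
        (simp add: nth_less_subdegree_zero[OF lt])
    then show ?thesis by (rule has_fps_expansion_imp_analytic_0)
  qed
  obtain r1 where r1: "0 < r1" "\<kappa> holomorphic_on ball 0 r1" using \<kappa>an by (rule analytic_at_0_ball)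
  obtain r2 where r2: "0 < r2" "y holomorphic_on ball 0 r2"
    using has_fps_expansion_imp_analytic_0[OF y] by (rule analytic_at_0_ball)
  define r where "r = min r1 r2"
  have r: "0 < r" "\<kappa> holomorphic_on ball 0 r" "y holomorphic_on ball 0 r"
    using r1 r2 by (auto simp: r_def intro: holomorphic_on_subset)
  have nz: "norm \<zeta> = 1" if "\<zeta> \<in> unity_roots n" for \<zeta>
    using that n norm_unity_root by blast
  have yh: "(\<lambda>t. y (\<eta> * t)) holomorphic_on ball 0 r" if "\<eta> \<in> Z" for \<eta>
  proof -
    have "(y \<circ> (\<lambda>t. \<eta> * t)) holomorphic_on ball 0 r"
      by (rule holomorphic_on_compose_gen[OF _ r(3)])
        (use that nz one in \<open>auto intro!: holomorphic_intros simp: norm_mult\<close>)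
    then show ?thesis by (simp add: o_def)
  qed
  obtain d e where e: "\<And>j. e j holomorphic_on ball 0 r"
    "\<And>t v. (\<Prod>\<eta>\<in>Z. (v - y (\<eta> * t))) = (\<Sum>j<d. e j t * v ^ j)"
    using product_coefficients_holomorphic[where f = "\<lambda>\<eta> t. y (\<eta> * t)", OF fin(2) yh] by metis
  have "\<exists>H. H holomorphic_on ball 0 (r ^ n) \<and>
      (\<forall>t\<in>ball 0 r. H (t ^ n) = (\<Sum>\<zeta>\<in>unity_roots n. \<kappa> (\<zeta> * t) * e j (\<zeta> * t)))" for j
    using average_over_unity_roots[OF n r(1) holomorphic_on_mult[OF r(2) e(1)[of j]]] by metis
  then obtain H where H: "\<And>j. H j holomorphic_on ball 0 (r ^ n)"
    "\<And>j t. t \<in> ball 0 r \<Longrightarrow> H j (t ^ n) = (\<Sum>\<zeta>\<in>unity_roots n. \<kappa> (\<zeta> * t) * e j (\<zeta> * t))" by metis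
  \<comment> \<open>Hence \<open>h\<close> vanishes on the whole axis \<open>x = 0\<close>, which
    yields the condition on \<open>partial2 h\<close> that makes the shear invertible.\<close>
  have H0: "H j 0 = 0" for j using H(2)[of 0 j] r(1) n by (simp add: \<kappa>_def power_0_left)
  define h where "h = (\<lambda>p::complex \<times> complex. \<Sum>j<d. H j (fst p) * snd p ^ j)"
  define U where "U = (ball 0 (r ^ n) \<times> UNIV :: (complex \<times> complex) set)"
  have U: "open U" "(0,0) \<in> U" using r(1) by (auto simp: U_def open_Times)
  have "holomorphic2_on (\<lambda>p. H j (fst p)) U" for j
    by (rule holomorphic2_on_compose_left[OF H(1) open_ball holomorphic2_on_fst]) (auto simp: U_def)
  then have hh: "holomorphic2_on h U" unfolding h_def by (intro holomorphic2_intros)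
  show thesis
  proof (rule that)
    show "holomorphic2_germ h" unfolding holomorphic2_germ_def using U hh by blast
    show "h (0, 0) = 0" by (simp add: h_def H0)
    show "partial2 h (0, 0) = 0" unfolding partial2_def h_def by (simp add: H0)
    have ev: "\<forall>\<^sub>F t in nhds 0. \<kappa> t * \<Delta> t = g t"
    proof -
      have "\<forall>\<^sub>F t in at 0. \<Delta> t \<noteq> 0"
        using has_laurent_expansion_eventually_nonzero_iff[of \<Delta> 0 "fps_to_fls (\<Prod>\<eta>\<in>Z. YY \<eta>)"] \<Delta> P0
        by (simp add: has_fps_expansion_to_laurent)
      then have "\<forall>\<^sub>F t in nhds 0. t \<noteq> 0 \<longrightarrow> \<Delta> t \<noteq> 0" by (simp add: eventually_at_filter)
      moreover have "g 0 = 0" using has_fps_expansion_nth_0[OF g(1)] g(2)[of 0] by simp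
      ultimately show ?thesis by (auto simp: \<kappa>_def elim!: eventually_mono)
    qed
    have "\<forall>\<^sub>F t in nhds 0. t \<in> ball 0 r" using r(1) by (intro eventually_nhds_in_open) auto
    with ev show "\<forall>\<^sub>F t in nhds 0. h (t ^ n, y t) = g t"
    proof eventually_elim
      case (elim t)
      have "h (t ^ n, y t) = (\<Sum>j<d. (\<Sum>\<zeta>\<in>unity_roots n. \<kappa> (\<zeta> * t) * e j (\<zeta> * t)) * y t ^ j)"
        using H(2)[OF elim(2)] by (simp add: h_def)
      also have "\<dots> = (\<Sum>\<zeta>\<in>unity_roots n. \<kappa> (\<zeta> * t) * (\<Sum>j<d. e j (\<zeta> * t) * y t ^ j))"
        unfolding sum_distrib_right sum_distrib_left by (subst sum.swap) (simp add: mult.assoc)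
      also have "\<dots> = (\<Sum>\<zeta>\<in>unity_roots n. \<kappa> (\<zeta> * t) * (\<Prod>\<eta>\<in>Z. (y t - y (\<eta> * (\<zeta> * t)))))"
        unfolding e(2) ..
      \<comment> \<open>For \<open>\<zeta> \<noteq> 1\<close> the factor with
        \<open>\<eta> = inverse \<zeta>\<close> is \<open>y t - y t = 0\<close>, so only
        \<open>\<zeta> = 1\<close> survives.\<close>
      also have "\<dots> = (\<Sum>\<zeta>\<in>{1}. \<kappa> (\<zeta> * t) * (\<Prod>\<eta>\<in>Z. (y t - y (\<eta> * (\<zeta> * t)))))"
      proof (rule sum.mono_neutral_right[OF fin(1)])
        show "\<forall>\<zeta>\<in>unity_roots n - {1}. \<kappa> (\<zeta> * t) * (\<Prod>\<eta>\<in>Z. (y t - y (\<eta> * (\<zeta> * t)))) = 0"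
        proof
          fix \<zeta> assume \<zeta>: "\<zeta> \<in> unity_roots n - {1}"
          then have "\<zeta> \<noteq> 0" using n by (auto simp: power_0_left)
          moreover have "inverse \<zeta> \<in> Z" using \<zeta> by (auto simp: Z_def power_inverse)
          ultimately have "\<exists>\<eta>\<in>Z. y t - y (\<eta> * (\<zeta> * t)) = 0" by (intro bexI[of _ "inverse \<zeta>"]) (auto simp: field_simps)
          then have "(\<Prod>\<eta>\<in>Z. (y t - y (\<eta> * (\<zeta> * t)))) = 0" using fin(2) by (simp add: prod_zero)
          then show "\<kappa> (\<zeta> * t) * (\<Prod>\<eta>\<in>Z. (y t - y (\<eta> * (\<zeta> * t)))) = 0" by simp
        qed
      qed auto
      also have "\<dots> = \<kappa> t * \<Delta> t" by (simp add: \<Delta>_def)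
      finally show ?case using elim(1) by simp
    qed
  qed
qed

text \<open>The Jacobian determinant \<open>1 - partial2 h\<close> equals 1 at the origin, so the
  inverse function theorem applies. It gives real differentiability of the inverse; the explicit
  inverse of the Jacobian shows that its derivative is complex linear.\<close>

lemma shear_biholomorphism:
  assumes h: "holomorphic2_germ h" "h (0, 0) = 0" "partial2 h (0, 0) = 0"
  shows "biholomorphism_germ (\<lambda>p. (fst p, snd p - h p))"
proof -
  let ?F = "\<lambda>p. (fst p, snd p - h p)"
  obtain U where U: "open U" "(0,0) \<in> U" "holomorphic2_on h U" using h(1) unfolding holomorphic2_germ_def by blast
  define D where "D = (\<lambda>p (w :: complex \<times> complex). (fst w, snd w - (partial1 h p * fst w + partial2 h p * snd w)))"
  have D: "bounded_linear (D p)" for p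
    unfolding D_def by (intro bounded_linear_Pair bounded_linear_sub bounded_linear_add bounded_linear_fst
        bounded_linear_snd bounded_linear_compose[OF bounded_linear_mult_right bounded_linear_fst]
        bounded_linear_compose[OF bounded_linear_mult_right bounded_linear_snd])
  define f' where "f' = (\<lambda>p. Blinfun (D p))"
  have f'D: "blinfun_apply (f' p) = D p" for p unfolding f'_def by (rule bounded_linear_Blinfun_apply[OF D])
  have der: "(?F has_derivative blinfun_apply (f' p)) (at p)" if "p \<in> U" for p
    unfolding f'D D_def using holomorphic2_on_has_derivative[OF U(3) that]
    by (auto intro!: derivative_eq_intros)
  have "continuous_on U (\<lambda>p. blinfun_apply (f' p) w)" for w
    unfolding f'D D_def
    by (intro continuous_intros holomorphic2_on_imp_continuous_on holomorphic2_on_partial1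
        holomorphic2_on_partial2 U)
  then have cont: "continuous_on U f'" by (intro continuous_on_blinfun_componentwise)
  define I where "I = (\<lambda>w :: complex \<times> complex. (fst w, snd w + partial1 h (0,0) * fst w))"
  have I: "bounded_linear I"
    unfolding I_def by (intro bounded_linear_Pair bounded_linear_add bounded_linear_fst
        bounded_linear_snd bounded_linear_compose[OF bounded_linear_mult_right bounded_linear_fst])
  have "Blinfun I o\<^sub>L f' (0,0) = id_blinfun"
    by (rule blinfun_eqI) (simp add: bounded_linear_Blinfun_apply[OF I] f'D, simp add: I_def D_def h(3))
  from inverse_function_theorem[OF U(1) der cont U(2) this]
  obtain U' V g g' where inv: "open U'" "U' \<subseteq> U" "(0,0) \<in> U'" "open V" "?F (0,0) \<in> V" "homeomorphism U' V ?F g"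
    "\<And>q. q \<in> V \<Longrightarrow> (g has_derivative (g' q)) (at q)"
    "\<And>q. q \<in> V \<Longrightarrow> g' q = Hilbert_Choice.inv (blinfun_apply (f' (g q)))"
    "\<And>q. q \<in> V \<Longrightarrow> bij (blinfun_apply (f' (g q)))" by blast
  have F: "holomorphic2_map_on ?F U'"
    unfolding holomorphic2_map_on_def
    using holomorphic2_on_diff[OF holomorphic2_on_snd holomorphic2_on_subset[OF U(3) inv(2)]] holomorphic2_on_fst
    by simp
  have G: "holomorphic2_map_on g V"
    unfolding holomorphic2_map_on_def holomorphic2_on_def
  proof (intro conjI ballI)
    fix q assume q: "q \<in> V"
    define a b where "a = partial1 h (g q)" and "b = partial2 h (g q)"
    have bij: "bij (D (g q))" using inv(9)[OF q] unfolding f'D .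
    have b: "1 - b \<noteq> 0"
    proof
      assume "1 - b = 0"
      then have "D (g q) (0, 1) = D (g q) (0, 0)" by (simp add: D_def b_def)
      then show False using bij unfolding bij_def inj_def by (metis prod.inject zero_neq_one)
    qed
    have "D (g q) (fst w, (snd w + a * fst w) / (1 - b)) = w" for w
    proof -
      define W where "W = (snd w + a * fst w) / (1 - b)"
      have "(1 - b) * W = snd w + a * fst w" using b by (simp add: W_def)
      then have "W - (a * fst w + b * W) = snd w" by (simp add: algebra_simps)
      then show ?thesis
        unfolding D_def fst_conv snd_conv a_def[symmetric] b_def[symmetric] W_def[symmetric] by simp
    qed
    then have "Hilbert_Choice.inv (D (g q)) w = (fst w, (snd w + a * fst w) / (1 - b))" for w
      using bij by (metis bij_inv_eq_iff)
    then have "g' q = (\<lambda>w. (fst w, (snd w + a * fst w) / (1 - b)))"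
      using inv(8)[OF q] unfolding f'D by auto
    with inv(7)[OF q] have g: "(g has_derivative (\<lambda>w. (fst w, (snd w + a * fst w) / (1 - b)))) (at q)" by simp
    have "((\<lambda>q. fst (g q)) has_derivative (\<lambda>w. 1 * fst w + 0 * snd w)) (at q)"
      using has_derivative_fst[OF g] by simp
    then show "\<exists>a b. ((\<lambda>p. fst (g p)) has_derivative (\<lambda>h. a * fst h + b * snd h)) (at q)" by blast
    have "((\<lambda>q. snd (g q)) has_derivative (\<lambda>w. (a / (1 - b)) * fst w + (1 / (1 - b)) * snd w)) (at q)"
      using has_derivative_snd[OF g] by (simp add: add_divide_distrib add.commute)
    then show "\<exists>a b. ((\<lambda>p. snd (g p)) has_derivative (\<lambda>h. a * fst h + b * snd h)) (at q)" by blast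
  qed
  show ?thesis
    unfolding biholomorphism_germ_def using inv(1,3,4,6) F G h(2) by (intro conjI exI[of _ U'] exI[of _ V] exI[of _ g]) auto
qed

text \<open>If the conjugate by \<open>\<eta>\<close> had the same series, \<open>t\<close> and
  \<open>\<eta> * t\<close> would have the same image, against injectivity. As there are finitely
  many roots of unity, one bound \<open>q\<close> serves for all of them.\<close>

lemma conjugates_of_parametrization:
  assumes n: "0 < n" and \<Gamma>: "puiseux_parametrization n m a \<Gamma>"
  shows "\<exists>q. \<forall>\<eta>. \<eta> ^ n = 1 \<and> \<eta> \<noteq> 1 \<longrightarrow> (\<exists>i\<le>q. fps_nth (puiseux_series m a) i * (\<eta> ^ i - 1) \<noteq> 0)"
proof -
  let ?Y = "puiseux_series m a" and ?y = "\<lambda>t. snd (puiseux n m a t)"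
  have a: "conv_radius a > 0" using \<Gamma> unfolding puiseux_parametrization_def by blast
  obtain r where r: "0 < r" "inj_on (puiseux n m a) (ball 0 r)"
    using \<Gamma> unfolding puiseux_parametrization_def parametrizes_def by blast
  have y: "?y has_fps_expansion ?Y" by (rule snd_puiseux_fps[OF a])
  have ex: "\<exists>i. fps_nth ?Y i * (\<eta> ^ i - 1) \<noteq> 0" if \<eta>: "\<eta> ^ n = 1" "\<eta> \<noteq> 1" for \<eta>
  proof (rule ccontr)
    assume "\<not> ?thesis"
    then have z: "fps_nth ?Y i * (\<eta> ^ i - 1) = 0" for i by blast
    have "?Y oo (fps_const \<eta> * fps_X) = ?Y"
      by (rule fps_ext) (use z in \<open>auto simp: fps_nth_compose_linear\<close>)
    moreover have l: "(\<lambda>t. \<eta> * t) has_fps_expansion fps_const \<eta> * fps_X"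
      by (intro has_fps_expansion_cmult_left has_fps_expansion_fps_X)
    moreover have "(?y \<circ> (\<lambda>t. \<eta> * t)) has_fps_expansion (?Y oo (fps_const \<eta> * fps_X))"
      by (rule has_fps_expansion_compose[OF y l]) simp
    ultimately have "(\<lambda>t. (?y \<circ> (\<lambda>t. \<eta> * t)) t - ?y t) has_fps_expansion 0"
      using has_fps_expansion_diff[of "?y \<circ> (\<lambda>t. \<eta> * t)" ?Y ?y ?Y] y by simp
    then have "\<forall>\<^sub>F t in nhds 0. ?y (\<eta> * t) = ?y t"
      unfolding has_fps_expansion_0_iff by eventually_elim simp
    then obtain e where e: "0 < e" "\<And>t. norm t < e \<Longrightarrow> ?y (\<eta> * t) = ?y t"
      unfolding eventually_nhds_metric by auto
    define t where "t = complex_of_real (min e r / 2)"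
    have t: "t \<noteq> 0" "norm t < e" "norm t < r" using e r by (auto simp: t_def)
    have "norm \<eta> = 1" by (rule norm_unity_root[OF \<eta>(1) n])
    then have "\<eta> * t \<in> ball 0 r" "t \<in> ball 0 r" using t by (auto simp: norm_mult)
    moreover have "puiseux n m a (\<eta> * t) = puiseux n m a t"
      using e(2)[OF t(2)] \<eta>(1) by (simp add: prod_eq_iff fst_puiseux power_mult_distrib)
    ultimately have "\<eta> * t = t" using r(2) by (meson inj_onD)
    then show False using t \<eta> by simp
  qed
  then obtain q where q: "\<And>\<eta>. \<eta> ^ n = 1 \<Longrightarrow> \<eta> \<noteq> 1 \<Longrightarrow> fps_nth ?Y (q \<eta>) * (\<eta> ^ q \<eta> - 1) \<noteq> 0" by metis
  have "q \<eta> \<le> Max (q ` unity_roots n)" if "\<eta> ^ n = 1" for \<eta>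
    using finite_unity_roots[OF n] that by (intro Max_ge) auto
  then show ?thesis using q by (intro exI[of _ "Max (q ` unity_roots n)"]) blast
qed

context puiseux_fps
begin

text \<open>If the conjugate by \<open>\<eta>\<close> agreed with \<open>y\<close> up to order
  \<open>q\<close>, every exponent \<open>u \<le> q\<close> occurring in a function on the branch
  would satisfy \<open>\<eta>^u = 1\<close>. But \<open>q\<close> itself occurs, and
  \<open>\<eta>^q = \<eta>\<close> because \<open>q\<close> is 1 modulo \<open>n\<close>. The bound
  on the contact of conjugates thus comes from the semigroup alone and passes to all stages of the
  reduction.\<close>

lemma conjugates_of_semigroup:
  assumes a: "conv_radius a > 0" and Y: "Y = puiseux_series m a"
    and q: "q \<in> branch_semigroup (puiseux n m a)" "q mod n = 1 mod n" and \<eta>: "\<eta> ^ n = 1" "\<eta> \<noteq> 1"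
  shows "\<exists>i\<le>q. fps_nth Y i * (\<eta> ^ i - 1) \<noteq> 0"
proof (rule ccontr)
  assume no: "\<not> ?thesis"
  then have Yi: "\<eta> ^ i = 1" if "fps_nth Y i \<noteq> 0" "i \<le> q" for i using that by auto
  have pow: "\<eta> ^ u = 1" if "fps_nth (Y ^ j) u \<noteq> 0" "u \<le> q" for j u
    using that
  proof (induction j arbitrary: u)
    case 0
    then show ?case by (auto split: if_splits)
  next
    case (Suc j)
    then have "(\<Sum>i=0..u. fps_nth Y i * fps_nth (Y ^ j) (u - i)) \<noteq> 0" by (simp add: fps_mult_nth)
    then obtain i where i: "i \<le> u" "fps_nth Y i \<noteq> 0" "fps_nth (Y ^ j) (u - i) \<noteq> 0"
      by (metis (mono_tags, lifting) atLeastAtMost_iff mult_eq_0_iff sum.neutral)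
    have "\<eta> ^ u = \<eta> ^ i * \<eta> ^ (u - i)" using i(1) by (simp flip: power_add)
    then show ?case using Yi[OF i(2)] Suc.IH[OF i(3)] i(1) Suc.prems(2) by simp
  qed
  obtain N c where c: "fun_coeff N c q \<noteq> 0" using branch_semigroup_fun_coeff[OF a Y q(1)] by blast
  then obtain i j where "fps_nth (fps_X ^ (n * i) * Y ^ j) q \<noteq> 0"
    unfolding fun_coeff_def by (metis (no_types, lifting) case_prod_beta mult_zero_right sum.neutral)
  then have ij: "n * i \<le> q" "fps_nth (Y ^ j) (q - n * i) \<noteq> 0" unfolding fps_X_power_mult_nth by (auto split: if_splits)
  have "\<eta> ^ q = \<eta> ^ (n * i) * \<eta> ^ (q - n * i)" using ij(1) by (simp flip: power_add)
  also have "\<dots> = 1" using pow[OF ij(2)] \<eta>(1) by (simp add: power_mult)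
  finally have "\<eta> ^ q = 1" .
  moreover have "\<eta> ^ u = \<eta> ^ (u mod n)" for u
  proof -
    have "\<eta> ^ u = \<eta> ^ (n * (u div n) + u mod n)" by simp
    then show ?thesis using \<eta>(1) by (metis mult_1 power_add power_mult power_one)
  qed
  ultimately show False using q(2) \<eta>(2) by (metis power_one_right)
qed

end

text \<open>Interpolation yields a function equal to \<open>t^e\<close> on the branch; multiplied by
  \<open>dx = n t^(n-1) dt\<close> it gives a form of contact order \<open>e + n\<close>.\<close>

lemma large_orders_in_semigroup:
  assumes nm: "0 < n" "0 < m" and a: "conv_radius a > 0"
    and conj: "\<And>\<eta>. \<eta> ^ n = 1 \<Longrightarrow> \<eta> \<noteq> 1 \<Longrightarrow> \<exists>i\<le>q. fps_nth (puiseux_series m a) i * (\<eta> ^ i - 1) \<noteq> 0"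
    and e: "n * q < e"
  shows "e \<in> branch_semigroup (puiseux n m a)" "e + n \<in> contact_orders (puiseux n m a)"
proof -
  let ?\<phi> = "puiseux n m a"
  have \<phi>: "curve_germ ?\<phi>" by (rule puiseux_curve_germ[OF nm a])
  have y: "(\<lambda>t. snd (?\<phi> t)) has_fps_expansion puiseux_series m a" by (rule snd_puiseux_fps[OF a])
  obtain h where h: "holomorphic2_germ h" "\<forall>\<^sub>F t in nhds 0. h (t ^ n, snd (?\<phi> t)) = t ^ e"
    by (rule lagrange_interpolation[where q = q, OF nm(1) y conj has_fps_expansion_fps_X_power[of e]]) (use e in \<open>auto intro: that\<close>)
  have "(t ^ n, snd (?\<phi> t)) = ?\<phi> t" for t by (simp add: prod_eq_iff fst_puiseux)
  then have "\<forall>\<^sub>F t in nhds 0. t ^ e = h (?\<phi> t)" using h(2) by (auto elim: eventually_mono)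
  then have F: "(\<lambda>t. h (?\<phi> t)) has_fps_expansion fps_X ^ e"
    by (rule has_fps_expansion_transfer[OF has_fps_expansion_fps_X_power])
  have X: "fps_X ^ e \<noteq> (0::complex fps)" by simp
  show "e \<in> branch_semigroup ?\<phi>"
    unfolding branch_semigroup_iff[OF \<phi>] using h(1) F X by (intro exI[of _ h] exI[of _ "fps_X ^ e"]) simp
  have U: "(\<lambda>t. fst (?\<phi> t)) has_fps_expansion fps_X ^ n"
    unfolding fst_puiseux by (rule has_fps_expansion_fps_X_power)
  have "form_pullback ?\<phi> h (\<lambda>_. 0) has_fps_expansion fps_X ^ e * fps_deriv (fps_X ^ n) + 0 * fps_deriv (puiseux_series m a)"
    by (intro form_pullback_fps F U y has_fps_expansion_0)
  moreover have "fps_deriv (fps_X ^ n) = fps_const (of_nat n) * (fps_X ^ (n - 1) :: complex fps)"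
    by (simp add: fps_deriv_power fps_of_nat)
  ultimately have P: "form_pullback ?\<phi> h (\<lambda>_. 0) has_fps_expansion fps_X ^ e * (fps_const (of_nat n) * fps_X ^ (n - 1))" by simp
  have nz: "fps_X ^ e * (fps_const (of_nat n) * fps_X ^ (n - 1)) \<noteq> (0 :: complex fps)" using nm(1) by simp
  have "subdegree (fps_X ^ e * (fps_const (of_nat n) * fps_X ^ (n - 1)) :: complex fps) + 1 = e + n"
    using nz nm(1) by (simp add: subdegree_mult)
  moreover have "holomorphic2_germ (\<lambda>_. 0)"
    unfolding holomorphic2_germ_def using holomorphic2_on_const by (intro exI[of _ UNIV]) auto
  ultimately show "e + n \<in> contact_orders ?\<phi>"
    unfolding contact_orders_iff[OF \<phi>] using h(1) P nz by blast
qed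

section \<open>The reduction\<close>

text \<open>The difference of the two series has order above \<open>n * q\<close>, so it is the
  restriction of a holomorphic \<open>h\<close> to the branch. Subtracting \<open>h\<close> replaces
  one series by the other and changes neither \<open>x\<close> nor the parameter.\<close>

lemma truncation_equivalent:
  assumes nm: "0 < n" "n < m" and \<Gamma>: "puiseux_parametrization n m a \<Gamma>" and a': "conv_radius a' > 0"
    and conj: "\<And>\<eta>. \<eta> ^ n = 1 \<Longrightarrow> \<eta> \<noteq> 1 \<Longrightarrow> \<exists>i\<le>q. fps_nth (puiseux_series m a) i * (\<eta> ^ i - 1) \<noteq> 0"
    and eq: "\<And>i. m < i \<Longrightarrow> i \<le> n * q \<Longrightarrow> a' i = a i"
  shows "\<exists>\<Gamma>'. puiseux_parametrization n m a' \<Gamma>' \<and> analytically_equivalent \<Gamma> \<Gamma>'"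
proof -
  let ?y = "\<lambda>t. snd (puiseux n m a t)" and ?y' = "\<lambda>t. snd (puiseux n m a' t)"
  have a: "conv_radius a > 0" using \<Gamma> unfolding puiseux_parametrization_def by blast
  have y: "?y has_fps_expansion puiseux_series m a" by (rule snd_puiseux_fps[OF a])
  have y': "?y' has_fps_expansion puiseux_series m a'" by (rule snd_puiseux_fps[OF a'])
  have g: "(\<lambda>t. ?y t - ?y' t) has_fps_expansion puiseux_series m a - puiseux_series m a'"
    by (rule has_fps_expansion_diff[OF y y'])
  have low: "fps_nth (puiseux_series m a - puiseux_series m a') i = 0" if "i \<le> n * q" for i
    using eq[of i] that by (simp add: puiseux_series_nth)
  obtain h where h: "holomorphic2_germ h" "h (0, 0) = 0" "partial2 h (0, 0) = 0"
    "\<forall>\<^sub>F t in nhds 0. h (t ^ n, ?y t) = ?y t - ?y' t"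
    by (rule lagrange_interpolation[where q = q, OF nm(1) y conj g low]) (use that in auto)
  define F where "F = (\<lambda>p. (fst p, snd p - h p))"
  have F: "biholomorphism_germ F" unfolding F_def by (rule shear_biholomorphism[OF h(1-3)])
  have pt: "(t ^ n, ?y t) = puiseux n m a t" for t by (simp add: prod_eq_iff fst_puiseux)
  have "\<forall>\<^sub>F t in nhds 0. F (puiseux n m a t) = puiseux n m a' t"
    using h(4)
  proof eventually_elim
    case (elim t)
    then show ?case unfolding pt F_def by (simp add: prod_eq_iff fst_puiseux)
  qed
  moreover have "(\<lambda>t. t) analytic_on {0::complex}" by (intro analytic_intros)
  ultimately obtain \<Gamma>' where "puiseux_parametrization n m a' \<Gamma>'" "sends_branch F \<Gamma> \<Gamma>'"
    using puiseux_transport[OF nm(1) _ \<Gamma> a' F, of "\<lambda>t. t" "\<lambda>t. t"] nm by auto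
  then show ?thesis unfolding analytically_equivalent_def by blast
qed

text \<open>\<open>S\<close> and \<open>\<Lambda>\<close> are carried along as parameters because
  they are invariants: at every stage the allowed exponents are those of the initial branch.\<close>

definition reduced_up_to ::
    "nat \<Rightarrow> nat \<Rightarrow> nat set \<Rightarrow> nat set \<Rightarrow> enat \<Rightarrow> nat \<Rightarrow> (nat \<Rightarrow> complex) \<Rightarrow> (complex \<times> complex) set \<Rightarrow> bool"
  where "reduced_up_to n m S \<Lambda> l k a \<Gamma> \<longleftrightarrow> puiseux_parametrization n m a \<Gamma> \<and>
    branch_semigroup (puiseux n m a) = S \<and> contact_orders (puiseux n m a) = \<Lambda> \<and>
    (\<forall>i. m < i \<and> i \<le> k \<and> \<not> allowed_exponent n \<Lambda> l i \<longrightarrow> a i = 0)"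

text \<open>Below \<open>l\<close> all terms before \<open>k\<close> are gone, so the Euler form has
  contact order \<open>k + n\<close>; minimality of \<open>l\<close> places \<open>k + n\<close> in
  the semigroup, where it must be the order of a monomial. Above \<open>l\<close>, exclusion of
  \<open>k\<close> means \<open>k + n \<in> \<Lambda>\<close>, and the Euler part of any form
  realising it must vanish.\<close>

lemma form_for_elimination:
  assumes nm: "0 < n" "n < m" "\<not> n dvd m" and a: "conv_radius a > 0"
    and S: "S = branch_semigroup (puiseux n m a)" and \<Lambda>: "\<Lambda> = contact_orders (puiseux n m a)"
    and l: "l = (if \<Lambda> - S = {} then \<infinity> else enat ((LEAST i. i \<in> \<Lambda> \<and> i \<notin> S) - n))"
    and red: "\<And>i. m < i \<Longrightarrow> i < k \<Longrightarrow> \<not> allowed_exponent n \<Lambda> l i \<Longrightarrow> a i = 0"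
    and k: "m < k" "\<not> allowed_exponent n \<Lambda> l k" "a k \<noteq> 0"
  shows "\<exists>N A B. 2 \<le> N \<and> puiseux_fps.form_coeff n (puiseux_series m a) N A B (k + n) \<noteq> 0 \<and>
    (\<forall>u<k + n. puiseux_fps.form_coeff n (puiseux_series m a) N A B u = 0) \<and> B 1 0 = 0"
proof -
  define Y where "Y = puiseux_series m a"
  have pf: "puiseux_fps n m i0 Y" if "m < i0" "\<And>i. m < i \<Longrightarrow> i < i0 \<Longrightarrow> a i = 0" for i0
    by unfold_locales (use nm that in \<open>auto simp: Y_def puiseux_series_nth\<close>)
  have below: "w \<in> S" if i0: "m < i0" "\<And>i. m < i \<Longrightarrow> i < i0 \<Longrightarrow> a i = 0" and w: "w \<in> \<Lambda>" "w < i0 + n" for i0 w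
  proof -
    interpret puiseux_fps n m i0 Y by (rule pf[OF i0])
    obtain N A B where "2 \<le> N" "form_coeff N A B w \<noteq> 0" "\<forall>u<w. form_coeff N A B u = 0"
      using w(1) contact_orders_form_coeff[OF a Y_def] unfolding \<Lambda> by blast
    then obtain i j where "w = i * n + j * m" using contact_order_below[of N A B w] w(2) by auto
    then show ?thesis unfolding S using monomial_in_branch_semigroup[OF a Y_def, of i j] by simp
  qed
  \<comment> \<open>The Euler form annihilates the leading term \<open>t^m\<close>, so its first
    coefficient comes from \<open>a i0\<close>.\<close>
  have at: "i0 + n \<in> \<Lambda>" if i0: "m < i0" "\<And>i. m < i \<Longrightarrow> i < i0 \<Longrightarrow> a i = 0" "a i0 \<noteq> 0" for i0
  proof -
    interpret puiseux_fps n m i0 Y by (rule pf[OF i0(1,2)])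
    let ?A = "\<lambda>i j. if i = 0 \<and> j = 1 then 1 * of_nat m else 0" and ?B = "\<lambda>i j. if i = 1 \<and> j = 0 then - 1 * of_nat n else 0"
    have Yi: "fps_nth Y i = (if i = m then 1 else if m < i then a i else 0)" for i by (simp add: Y_def puiseux_series_nth)
    have E: "form_coeff 2 ?A ?B w = (if w < n then 0 else 1 * of_nat n * (of_nat m - of_nat (w - n)) * fps_nth Y (w - n))" for w
      by (rule form_coeff_euler) simp
    have "form_coeff 2 ?A ?B (i0 + n) \<noteq> 0" unfolding E Yi using i0 n nm by simp
    moreover have "form_coeff 2 ?A ?B u = 0" if "u < i0 + n" for u
      unfolding E Yi using i0(2)[of "u - n"] that by auto
    ultimately show ?thesis unfolding \<Lambda> contact_orders_form_coeff[OF a Y_def] by blast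
  qed
  have least: "\<Lambda> - S \<noteq> {} \<Longrightarrow> (LEAST i. i \<in> \<Lambda> \<and> i \<notin> S) \<in> \<Lambda> \<and> (LEAST i. i \<in> \<Lambda> \<and> i \<notin> S) \<notin> S"
    using LeastI_ex[of "\<lambda>i. i \<in> \<Lambda> \<and> i \<notin> S"] by blast
  have le: "l \<le> enat (w - n)" if "w \<in> \<Lambda>" "w \<notin> S" for w
    using that Least_le[of "\<lambda>i. i \<in> \<Lambda> \<and> i \<notin> S" w] unfolding l by auto
  have kl: "enat k \<noteq> l" using k(2) unfolding allowed_exponent_def by blast
  show ?thesis
  proof (cases "enat k < l")
    case True
    have z: "a i = 0" if "m < i" "i < k" for i
    proof (rule red[OF that])
      have "enat i < l" using True that(2) by (meson enat_ord_simps(2) less_trans)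
      then show "\<not> allowed_exponent n \<Lambda> l i" unfolding allowed_exponent_def by auto
    qed
    interpret puiseux_fps n m k Y by (rule pf[OF k(1) z])
    have "k + n \<in> S"
    proof (rule ccontr)
      assume "k + n \<notin> S"
      then have "l \<le> enat k" using le[of "k + n"] at[OF k(1) z k(3)] by simp
      then show False using True by simp
    qed
    then obtain N c where c: "2 \<le> N" "fun_coeff N c (k + n) \<noteq> 0" "\<forall>u<k + n. fun_coeff N c u = 0"
      using branch_semigroup_fun_coeff[OF a Y_def] unfolding S by blast
    then obtain i j where ij: "k + n = i * n + j * m" using function_order_at[of N c] by auto
    have "0 < k + n" using n by simp
    from form_of_weight[OF ij this] show ?thesis unfolding Y_def by blast
  next
    case False
    with kl have lk: "l < enat k" by simp
    then obtain l' where l': "l = enat l'" by (cases l) auto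
    with l have ne: "\<Lambda> - S \<noteq> {}" by auto
    define w where "w = (LEAST i. i \<in> \<Lambda> \<and> i \<notin> S)"
    have w: "w \<in> \<Lambda>" "w \<notin> S" using least[OF ne] by (auto simp: w_def)
    have lw: "l' = w - n" using l l' ne by (auto simp: w_def)
    \<comment> \<open>For any branch, contact orders below \<open>Suc m + n\<close> lie in the
      semigroup. Hence \<open>l' > m\<close>, and the natural subtraction \<open>w - n\<close> is
      not truncated.\<close>
    have "\<not> w < Suc m + n" using below[of "Suc m" w] w by auto
    then have wl: "w = l' + n" "m < l'" using lw by auto
    have z: "a i = 0" if "m < i" "i < l'" for i
    proof (rule red)
      show "\<not> allowed_exponent n \<Lambda> l i" unfolding allowed_exponent_def l' using that by auto
    qed (use that lk l' in auto)
    \<comment> \<open>If this coefficient vanished, the gap would extend past \<open>l'\<close> and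
      put \<open>w\<close> into the semigroup.\<close>
    have al: "a l' \<noteq> 0"
    proof
      assume "a l' = 0"
      then have "a i = 0" if "m < i" "i < Suc l'" for i using z that less_Suc_eq by blast
      then have "w \<in> S" using below[of "Suc l'" w] w wl by auto
      then show False using w by blast
    qed
    interpret puiseux_fps n m l' Y by (rule pf[OF wl(2) z])
    have "k + n \<in> \<Lambda>" using k(2) lk unfolding allowed_exponent_def by auto
    then obtain N A B where N: "2 \<le> N" "form_coeff N A B (k + n) \<noteq> 0" "\<forall>u<k + n. form_coeff N A B u = 0"
      unfolding \<Lambda> contact_orders_form_coeff[OF a Y_def] by blast
    have "B 1 0 = 0"
    proof (rule no_euler_part[of k N A B])
      show "l' < k" using lk l' by simp
      show "fps_nth Y l' \<noteq> 0" using al wl by (simp add: Y_def puiseux_series_nth)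
      show "\<nexists>i j. l' + n = i * n + j * m"
        using monomial_in_branch_semigroup[OF a Y_def] w(2) unfolding S wl(1) by metis
    qed (use N in auto)
    then show ?thesis using N unfolding Y_def by blast
  qed
qed

lemma reduction_step:
  assumes nm: "0 < n" "n < m" "\<not> n dvd m"
    and l: "l = (if \<Lambda> - S = {} then \<infinity> else enat ((LEAST i. i \<in> \<Lambda> \<and> i \<notin> S) - n))"
    and red: "reduced_up_to n m S \<Lambda> l k a \<Gamma>" and k: "m \<le> k"
  shows "\<exists>a' \<Gamma>'. reduced_up_to n m S \<Lambda> l (Suc k) a' \<Gamma>' \<and>
    (if allowed_exponent n \<Lambda> l (Suc k) \<or> a (Suc k) = 0 then a' = a \<and> \<Gamma>' = \<Gamma>
     else flow_eliminates n m (Suc k) a \<Gamma> a' \<Gamma>')"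
proof (cases "allowed_exponent n \<Lambda> l (Suc k) \<or> a (Suc k) = 0")
  case True
  then have "reduced_up_to n m S \<Lambda> l (Suc k) a \<Gamma>"
    using red unfolding reduced_up_to_def by (metis le_Suc_eq)
  then show ?thesis using True by auto
next
  case False
  have r: "puiseux_parametrization n m a \<Gamma>" "S = branch_semigroup (puiseux n m a)" "\<Lambda> = contact_orders (puiseux n m a)"
    "\<And>i. m < i \<Longrightarrow> i < Suc k \<Longrightarrow> \<not> allowed_exponent n \<Lambda> l i \<Longrightarrow> a i = 0"
    using red unfolding reduced_up_to_def by auto
  have a: "conv_radius a > 0" using r(1) unfolding puiseux_parametrization_def by blast
  have k': "m < Suc k" "\<not> allowed_exponent n \<Lambda> l (Suc k)" "a (Suc k) \<noteq> 0" using k False by auto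
  obtain N A B where N: "2 \<le> N" "puiseux_fps.form_coeff n (puiseux_series m a) N A B (Suc k + n) \<noteq> 0"
    "\<And>u. u < Suc k + n \<Longrightarrow> puiseux_fps.form_coeff n (puiseux_series m a) N A B u = 0" "B 1 0 = 0"
    using form_for_elimination[OF nm a r(2,3) l r(4) k'] by blast
  obtain a' \<Gamma>' where e: "flow_eliminates n m (Suc k) a \<Gamma> a' \<Gamma>'"
    "branch_semigroup (puiseux n m a') = branch_semigroup (puiseux n m a)"
    "contact_orders (puiseux n m a') = contact_orders (puiseux n m a)"
    using flow_elimination_step[OF nm r(1) k'(1) N] by blast
  have "a' i = 0" if "m < i" "i \<le> Suc k" "\<not> allowed_exponent n \<Lambda> l i" for i
  proof (cases "i = Suc k")
    case False
    then have "a' i = a i" using e(1) that unfolding flow_eliminates_def by auto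
    then show ?thesis using r(4) that False by auto
  qed (use e(1) in \<open>auto simp: flow_eliminates_def\<close>)
  moreover have "puiseux_parametrization n m a' \<Gamma>'" using e(1) unfolding flow_eliminates_def by blast
  ultimately have "reduced_up_to n m S \<Lambda> l (Suc k) a' \<Gamma>'" unfolding reduced_up_to_def using e r by simp
  then show ?thesis using e(1) False by auto
qed

text \<open>\<open>a'\<close> collects the limiting coefficients of the flow reduction, and
  \<open>\<Gamma>'\<close> is obtained from a late stage by a shear. Both parts of the conclusion
  therefore concern the same series, although no limit of the flows is formed.\<close>

theorem theorem1:
  fixes n m :: nat and a :: "nat \<Rightarrow> complex" and \<Gamma> :: "(complex \<times> complex) set"
    and \<Lambda> :: "nat set" and l :: enat
  assumes "0 < n" and "n < m" and "\<not> n dvd m"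
    and "puiseux_parametrization n m a \<Gamma>"
    and "\<Lambda> = contact_orders (puiseux n m a)"
    and "l = zariski_invariant n (puiseux n m a)"
  shows "\<exists>a' \<Gamma>'. puiseux_parametrization n m a' \<Gamma>' \<and>
    (\<forall>i>m. a' i \<noteq> 0 \<longrightarrow> enat i = l \<or> (enat i > l \<and> i + n \<notin> \<Lambda>)) \<and>
    analytically_equivalent \<Gamma> \<Gamma>' \<and>
    flow_reduction n m (allowed_exponent n \<Lambda> l) a \<Gamma> a'"
proof -
  note nm = assms(1-3)
  define S where "S = branch_semigroup (puiseux n m a)"
  let ?ok = "allowed_exponent n \<Lambda> l"
  have l: "l = (if \<Lambda> - S = {} then \<infinity> else enat ((LEAST i. i \<in> \<Lambda> \<and> i \<notin> S) - n))"
    unfolding assms(5,6) zariski_invariant_def S_def ..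
  \<comment> \<open>The stages are counted from 0, that is, \<open>j\<close> stands for the exponent
    \<open>m + j\<close>; the last conjunct pins the initial stage.\<close>
  define good where "good = (\<lambda>j x. reduced_up_to n m S \<Lambda> l (m + j) (fst x) (snd x) \<and> (j = 0 \<longrightarrow> x = (a, \<Gamma>)))"
  define step where "step = (\<lambda>j (x :: (nat \<Rightarrow> complex) \<times> (complex \<times> complex) set) x'.
    if ?ok (Suc (m + j)) \<or> fst x (Suc (m + j)) = 0 then x' = x
    else flow_eliminates n m (Suc (m + j)) (fst x) (snd x) (fst x') (snd x'))"
  have "\<exists>f. \<forall>j. good j (f j) \<and> step j (f j) (f (Suc j))"
  proof (rule dependent_nat_choice)
    show "\<exists>x. good 0 x"
      unfolding good_def by (intro exI[of _ "(a, \<Gamma>)"]) (use assms in \<open>auto simp: reduced_up_to_def S_def\<close>)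
    fix x j assume "good j x"
    then have "reduced_up_to n m S \<Lambda> l (m + j) (fst x) (snd x)" unfolding good_def by blast
    from reduction_step[OF nm l this] obtain a' \<Gamma>' where
      "reduced_up_to n m S \<Lambda> l (Suc (m + j)) a' \<Gamma>'"
      "if ?ok (Suc (m + j)) \<or> fst x (Suc (m + j)) = 0 then a' = fst x \<and> \<Gamma>' = snd x
       else flow_eliminates n m (Suc (m + j)) (fst x) (snd x) a' \<Gamma>'" by auto
    then show "\<exists>x'. good (Suc j) x' \<and> step j x x'"
      unfolding good_def step_def by (intro exI[of _ "(a', \<Gamma>')"]) (auto split: if_splits)
  qed
  then obtain f where f: "\<And>j. good j (f j)" "\<And>j. step j (f j) (f (Suc j))" by blast
  define c where "c = (\<lambda>k. fst (f (k - m)))"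
  define B where "B = (\<lambda>k. snd (f (k - m)))"
  have start: "c m = a" "B m = \<Gamma>" using f(1)[of 0] unfolding good_def c_def B_def by auto
  have red: "reduced_up_to n m S \<Lambda> l k (c k) (B k)" if "m \<le> k" for k
    using f(1)[of "k - m"] that unfolding good_def c_def B_def by simp
  have st: "if ?ok k \<or> c (k - 1) k = 0 then c k = c (k - 1) \<and> B k = B (k - 1)
      else flow_eliminates n m k (c (k - 1)) (B (k - 1)) (c k) (B k)" if "m < k" for k
  proof -
    define j where "j = k - 1 - m"
    have j: "k - 1 - m = j" "k - m = Suc j" "k = Suc (m + j)" using that by (auto simp: j_def)
    show ?thesis
      using f(2)[of j] unfolding step_def c_def B_def j(1,2) j(3)[symmetric] by (simp add: prod_eq_iff)
  qed
  define a' where "a' = (\<lambda>i. c i i)"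
  have keep: "c k i = c (k - 1) i" if "m < i" "i < k" for i k
    using st[of k] that unfolding flow_eliminates_def by (auto split: if_splits)
  have stable: "c k i = a' i" if "m < i" "i \<le> k" for i k
    using that(2)
  proof (induction k rule: dec_induct)
    case (step k)
    then show ?case using keep[of i "Suc k"] that(1) by simp
  qed (simp add: a'_def)
  have a'0: "a' i = 0" if "m < i" "\<not> ?ok i" for i
    using red[of i] that unfolding reduced_up_to_def a'_def by simp
  have equiv: "analytically_equivalent \<Gamma> (B k)" if "m \<le> k" for k
    using that
  proof (induction k rule: dec_induct)
    case base
    then show ?case using start analytically_equivalent_refl by simp
  next
    case (step k)
    have "B (Suc k) = B k \<or> analytically_equivalent (B k) (B (Suc k))"
      using st[of "Suc k"] step(1) unfolding flow_eliminates_def analytically_equivalent_def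
      by (auto split: if_splits)
    then show ?case using step.IH analytically_equivalent_trans by metis
  qed
  obtain q where q: "\<And>\<eta>. \<eta> ^ n = 1 \<Longrightarrow> \<eta> \<noteq> 1 \<Longrightarrow> \<exists>i\<le>q. fps_nth (puiseux_series m a) i * (\<eta> ^ i - 1) \<noteq> 0"
    using conjugates_of_parametrization[OF nm(1) assms(4)] by blast
  have conv: "conv_radius (c k) > 0" if "m \<le> k" for k
    using red[OF that] unfolding reduced_up_to_def puiseux_parametrization_def by blast
  have conv_a: "conv_radius a > 0" using conv[of m] start by simp
  have large: "e \<in> S" "e + n \<in> \<Lambda>" if "n * q < e" for e
    using large_orders_in_semigroup[OF nm(1) _ conv_a q that] nm unfolding S_def assms(5) by auto
  \<comment> \<open>\<open>q'\<close> is congruent to 1 modulo \<open>n\<close> and exceeds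
    \<open>n * q\<close>, so it lies in the semigroup. It replaces \<open>q\<close>, which was found
    for the initial branch, as a bound valid at the late stage.\<close>
  define q' where "q' = n * (n * q + 1) + 1"
  have "n * q \<le> n * (n * q)" using nm(1) by simp
  then have "n * q < q'" unfolding q'_def distrib_left by linarith
  then have q': "q' \<in> S" by (rule large(1))
  have q'mod: "q' mod n = 1 mod n" unfolding q'_def by (rule mod_mult_self4)
  \<comment> \<open>For \<open>l = \<infinity>\<close> the default 0 is harmless, since then
    \<open>enat i \<noteq> l\<close> for every \<open>i\<close>.\<close>
  define l' where "l' = (case l of enat i \<Rightarrow> i | \<infinity> \<Rightarrow> 0)"
  \<comment> \<open>From \<open>M\<close> on no exponent is allowed: \<open>i > n * q\<close> puts
    \<open>i + n\<close> into \<open>\<Lambda>\<close>, and \<open>i > l'\<close> excludes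
    \<open>enat i = l\<close>. The summand \<open>n * q'\<close> makes stage \<open>M\<close> agree
    with \<open>a'\<close> to the order required by the shear.\<close>
  define M where "M = m + n * q' + l' + n * q + 1"
  have zero: "a' i = 0" if "M \<le> i" for i
  proof (rule a'0)
    show "m < i" using that by (simp add: M_def)
    have "i + n \<in> \<Lambda>" using large(2)[of i] that by (simp add: M_def)
    moreover have "enat i \<noteq> l" using that by (cases l) (auto simp: M_def l'_def)
    ultimately show "\<not> ?ok i" unfolding allowed_exponent_def by blast
  qed
  have mM: "m \<le> M" by (simp add: M_def)
  \<comment> \<open>Only finitely many coefficients of \<open>a'\<close> are nonzero, so the
    diagonal limit converges without any estimate on the stages.\<close>
  have conv_a': "conv_radius a' > 0"
  proof -
    have "\<forall>\<^sub>F i in sequentially. a' i = 0" using zero unfolding eventually_sequentially by blast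
    then have "conv_radius a' = conv_radius (\<lambda>i. 0 :: complex)" by (intro conv_radius_cong') auto
    then show ?thesis by simp
  qed
  have redM: "branch_semigroup (puiseux n m (c M)) = S" "puiseux_parametrization n m (c M) (B M)"
    using red[OF mM] unfolding reduced_up_to_def by auto
  interpret pf: puiseux_fps n m "Suc m" "puiseux_series m (c M)"
    by unfold_locales (use nm in \<open>auto simp: puiseux_series_nth\<close>)
  obtain \<Gamma>' where \<Gamma>': "puiseux_parametrization n m a' \<Gamma>'" "analytically_equivalent (B M) \<Gamma>'"
  proof -
    have "\<exists>\<Gamma>'. puiseux_parametrization n m a' \<Gamma>' \<and> analytically_equivalent (B M) \<Gamma>'"
    proof (rule truncation_equivalent[OF nm(1,2) redM(2) conv_a'])
      show "\<exists>i\<le>q'. fps_nth (puiseux_series m (c M)) i * (\<eta> ^ i - 1) \<noteq> 0" if "\<eta> ^ n = 1" "\<eta> \<noteq> 1" for \<eta>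
        by (rule pf.conjugates_of_semigroup[OF conv[OF mM] refl _ q'mod that]) (use redM(1) q' in simp)
      show "a' i = c M i" if "m < i" "i \<le> n * q'" for i using stable[of i M] that by (simp add: M_def)
    qed
    then show thesis using that by blast
  qed
  have "flow_reduction n m ?ok a \<Gamma> a'"
    unfolding flow_reduction_def
    by (intro exI[of _ c] exI[of _ B] conjI start allI impI st) (auto simp: a'_def)
  moreover have "analytically_equivalent \<Gamma> \<Gamma>'" by (rule analytically_equivalent_trans[OF equiv[OF mM] \<Gamma>'(2)])
  moreover have "\<forall>i>m. a' i \<noteq> 0 \<longrightarrow> enat i = l \<or> (enat i > l \<and> i + n \<notin> \<Lambda>)"
    using a'0 unfolding allowed_exponent_def by blast
  ultimately show ?thesis using \<Gamma>'(1) by blast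
qed

end
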